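(* Let $n\ge2$ and $K\ge1$. There exists a constant $0<r_0(n,K)<1$, depending only on $n$ and $K$, such that if $f:\mathbb{B}^n\to\mathbb{R}^n$ is a $K$-quasiregular mapping with $f(0)=0$, then $0\le M<\max_{|x|\le r_0(n,K)}|f(x)|$ implies $$\int_{\{x\in\mathbb{B}^n:\,|f(x)|<M\}}J(x,f)\,dx\ge\alpha_nM^n.$$
   Context: $\mathbb{B}^n$ is the open unit ball of $\mathbb{R}^n$ and $\alpha_n$ is its volume. For an open set $\Omega\subset\mathbb{R}^n$ and $K\ge1$, a mapping $f:\Omega\to\mathbb{R}^n$ is called $K$-quasiregular if it belongs to the Sobolev class $W^{1,n}_{loc}(\Omega,\mathbb{R}^n)$ and satisfies $\|Df(x)\|^n\le K J(x,f)$ for almost every $x\in\Omega$, where $\|Df(x)\|$ is the operator norm of the derivative matrix $Df(x)=(\partial f_i/\partial x_j)_{i,j=1}^n$ and $J(x,f)=\det Df(x)$. Quasiregular mappings are continuous (i.e. taken to be the continuous representative). *)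

theory Defs
  imports "HOL-Analysis.Analysis"
begin

definition partial_deriv :: "'n::finite \<Rightarrow> (real ^ 'n \<Rightarrow> real) \<Rightarrow> real ^ 'n \<Rightarrow> real" where
  "partial_deriv j \<phi> x = frechet_derivative \<phi> (at x) (axis j 1)"

primrec C_k :: "nat \<Rightarrow> (real ^ 'n::finite \<Rightarrow> real) \<Rightarrow> bool" where
  "C_k 0 \<phi> \<longleftrightarrow> continuous_on UNIV \<phi>"
| "C_k (Suc k) \<phi> \<longleftrightarrow> \<phi> differentiable_on UNIV \<and> (\<forall>j. C_k k (partial_deriv j \<phi>))"

text \<open>Elements of \<open>C\<^sub>c\<^sup>\<infinity>(\<Omega>)\<close>, extended by zero to the whole space.\<close>

definition test_function :: "(real ^ 'n::finite) set \<Rightarrow> (real ^ 'n \<Rightarrow> real) \<Rightarrow> bool" where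
  "test_function \<Omega> \<phi> \<longleftrightarrow>
     (\<forall>k. C_k k \<phi>) \<and>
     compact (closure {x. \<phi> x \<noteq> 0}) \<and> closure {x. \<phi> x \<noteq> 0} \<subseteq> \<Omega>"

definition locally_Lp ::
    "nat \<Rightarrow> (real ^ 'n::finite) set \<Rightarrow> (real ^ 'n \<Rightarrow> 'b::euclidean_space) \<Rightarrow> bool" where
  "locally_Lp p \<Omega> g \<longleftrightarrow>
     g \<in> borel_measurable (lebesgue_on \<Omega>) \<and>
     (\<forall>C. compact C \<and> C \<subseteq> \<Omega> \<longrightarrow> integrable (lebesgue_on C) (\<lambda>x. norm (g x) ^ p))"

text \<open>Local integrability of \<open>f\<close> and \<open>D\<close> is required here so that both integrals below
  converge.\<close>

definition has_weak_derivative ::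
    "(real ^ 'n::finite) set \<Rightarrow> (real ^ 'n \<Rightarrow> real ^ 'm::finite) \<Rightarrow> (real ^ 'n \<Rightarrow> real ^ 'n ^ 'm) \<Rightarrow> bool"
  where
  "has_weak_derivative \<Omega> f D \<longleftrightarrow>
     locally_Lp 1 \<Omega> f \<and> locally_Lp 1 \<Omega> D \<and>
     (\<forall>\<phi> i j. test_function \<Omega> \<phi> \<longrightarrow>
        (LINT x|lebesgue_on \<Omega>. f x $ i * partial_deriv j \<phi> x) =
        - (LINT x|lebesgue_on \<Omega>. D x $ i $ j * \<phi> x))"

definition sobolev_W1_loc ::
    "nat \<Rightarrow> (real ^ 'n::finite) set \<Rightarrow> (real ^ 'n \<Rightarrow> real ^ 'm::finite) \<Rightarrow> bool" where
  "sobolev_W1_loc p \<Omega> f \<longleftrightarrow>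
     locally_Lp p \<Omega> f \<and> (\<exists>D. has_weak_derivative \<Omega> f D \<and> locally_Lp p \<Omega> D)"

text \<open>On an open set a weak derivative is unique up to a null set, so that the representative
  chosen here is immaterial in almost-everywhere statements and in integrals.\<close>

definition weak_derivative ::
    "(real ^ 'n::finite) set \<Rightarrow> (real ^ 'n \<Rightarrow> real ^ 'm::finite) \<Rightarrow> real ^ 'n \<Rightarrow> real ^ 'n ^ 'm" where
  "weak_derivative \<Omega> f = (SOME D. has_weak_derivative \<Omega> f D)"

definition jacobian_det ::
    "(real ^ 'n::finite) set \<Rightarrow> (real ^ 'n \<Rightarrow> real ^ 'n) \<Rightarrow> real ^ 'n \<Rightarrow> real" where
  "jacobian_det \<Omega> f x = det (weak_derivative \<Omega> f x)"

text \<open>Values of \<open>f\<close> outside \<open>\<Omega>\<close> play no role.\<close>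

definition quasiregular ::
    "real \<Rightarrow> (real ^ 'n::finite) set \<Rightarrow> (real ^ 'n \<Rightarrow> real ^ 'n) \<Rightarrow> bool" where
  "quasiregular K \<Omega> f \<longleftrightarrow>
     open \<Omega> \<and> 1 \<le> K \<and>
     continuous_on \<Omega> f \<and> sobolev_W1_loc CARD('n) \<Omega> f \<and>
     (AE x in lebesgue_on \<Omega>.
        onorm ((*v) (weak_derivative \<Omega> f x)) ^ CARD('n) \<le> K * jacobian_det \<Omega> f x)"

end

(* A quasiregular map f is approximated by mollifications g_k, which satisfy the distortion inequality
   up to an error tending to 0 in mean. For a smooth map the pull-back b(g) det(Dg) of a divergence is
   again a divergence; applied to suitable radial fields this yields a maximum principle for |f - b|,
   the fact that f(0) = 0 and |f| >= M on the boundary of a cube force the image to contain the ball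
   of radius M, and an energy estimate for log log |f| in terms of the Jacobian integral over {|f| < M}.
   Suppose this integral is less than alpha_n M^n. Then |f| < M somewhere on every cube boundary around
   0. A finite energy forces small oscillation on the boundaries of suitable cubes (Morrey's inequality
   on slices), so first |f| <= C M near 0 by the maximum principle, and then, by pigeonholing the energy
   over dyadic shells, |f| <= 2M/5 on a ball whose radius depends only on n and K. *)

theory Submission
  imports Defs
begin

section \<open>Continuously differentiable functions\<close>

text \<open>The exponent n is critical in n variables: an energy bound alone gives no bound on the
  oscillation. On the boundary of a cube, which has dimension n - 1, it does. Faces of cubes are
  coordinate slices, so Fubini selects a good cube. The Jacobian is controlled only where |f| < M,
  while the gradient is needed everywhere. It is therefore weighted by roughly 1 / (|g| log |g|).
  The n-th power of this weight is, for large |g|, dominated by a divergence, so that after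
  integration by parts only bounded values of |g| and a cutoff term remain. The weight 1 / |g| would
  just fail: a field of matching size, y / |y|^n, is divergence free. The antiderivative of the
  weight is still unbounded, so its oscillation controls |f|. No degree of a Sobolev map is used;
  every topological fact is an integral identity for C^1 maps, and the limit is taken afterwards.
  Values are scaled so that M = 5, which leaves room for approximation errors below 1/4, for the
  radius 4 beyond which the domination holds, and for the final bound 2.\<close>

definition has_grad :: "(real ^ 'n::finite \<Rightarrow> real) \<Rightarrow> (real ^ 'n \<Rightarrow> real ^ 'n) \<Rightarrow> bool" where
  "has_grad u U \<longleftrightarrow> (\<forall>x. (u has_derivative (\<lambda>h. U x \<bullet> h)) (at x)) \<and> continuous_on UNIV U"

definition C1_map :: "(real ^ 'n::finite \<Rightarrow> real ^ 'm::finite) \<Rightarrow> (real ^ 'n \<Rightarrow> real ^ 'n ^ 'm) \<Rightarrow> bool" where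
  "C1_map g G \<longleftrightarrow> (\<forall>i. has_grad (\<lambda>x. g x $ i) (\<lambda>x. G x $ i))"

lemma has_gradD: "has_grad u U \<Longrightarrow> (u has_derivative (\<lambda>h. U x \<bullet> h)) (at x)"
  and has_grad_cont_grad: "has_grad u U \<Longrightarrow> continuous_on S U"
  by (auto simp: has_grad_def intro: continuous_on_subset)

lemma has_grad_cont: "has_grad u U \<Longrightarrow> continuous_on S u"
  by (meson continuous_at_imp_continuous_on has_derivative_continuous has_gradD)

lemma has_grad_const [intro]: "has_grad (\<lambda>_. c) (\<lambda>_. 0)"
  by (auto simp: has_grad_def intro!: derivative_eq_intros)

lemma has_grad_coord [intro]: "has_grad (\<lambda>x. x $ i) (\<lambda>_. axis i 1)"
  by (auto simp: has_grad_def inner_axis' intro!: derivative_eq_intros bounded_linear_imp_has_derivative)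

lemma has_grad_add [intro]:
  "has_grad u U \<Longrightarrow> has_grad v V \<Longrightarrow> has_grad (\<lambda>x. u x + v x) (\<lambda>x. U x + V x)"
  unfolding has_grad_def
  by (auto simp: inner_add_left intro!: derivative_eq_intros continuous_intros)

lemma has_grad_sum [intro]:
  "(\<And>i. i \<in> I \<Longrightarrow> has_grad (u i) (U i)) \<Longrightarrow> has_grad (\<lambda>x. \<Sum>i\<in>I. u i x) (\<lambda>x. \<Sum>i\<in>I. U i x)"
  unfolding has_grad_def
  by (auto simp: inner_sum_left intro!: derivative_eq_intros continuous_intros)

lemma has_grad_mult [intro]:
  "has_grad u U \<Longrightarrow> has_grad v V \<Longrightarrow> has_grad (\<lambda>x. u x * v x) (\<lambda>x. u x *\<^sub>R V x + v x *\<^sub>R U x)"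
  using has_grad_cont[of u U UNIV] has_grad_cont[of v V UNIV]
  unfolding has_grad_def
  by (auto simp: inner_add_left algebra_simps intro!: derivative_eq_intros continuous_intros)

lemma has_grad_cmult:
  "has_grad u U \<Longrightarrow> has_grad (\<lambda>x. c * u x) (\<lambda>x. c *\<^sub>R U x)"
  using has_grad_mult[OF has_grad_const[of c]] by simp

lemma has_grad_diff:
  "has_grad u U \<Longrightarrow> has_grad v V \<Longrightarrow> has_grad (\<lambda>x. u x - v x) (\<lambda>x. U x - V x)"
  unfolding has_grad_def
  by (auto simp: inner_diff_left intro!: derivative_eq_intros continuous_intros)

text \<open>The outer function need only be differentiable on a set \<open>T\<close> containing the
  range of \<open>u\<close>: later \<open>u\<close> is a squared norm, \<open>T\<close> is the
  half-line from 0, and \<open>p\<close> involves logarithms that are undefined far to the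
  left.\<close>

lemma has_grad_compose_on:
  assumes p: "\<And>t. t \<in> T \<Longrightarrow> (p has_real_derivative p' t) (at t)" and p': "continuous_on T p'"
    and u: "has_grad u U" and T: "\<And>x. u x \<in> T"
  shows "has_grad (\<lambda>x. p (u x)) (\<lambda>x. p' (u x) *\<^sub>R U x)"
  unfolding has_grad_def
proof (intro conjI allI)
  show "((\<lambda>x. p (u x)) has_derivative (\<lambda>h. p' (u x) *\<^sub>R U x \<bullet> h)) (at x)" for x
    using has_derivative_compose[OF has_gradD[OF u, of x], of p "\<lambda>h. p' (u x) * h"] p[OF T, of x]
    by (simp add: has_field_derivative_def)
  show "continuous_on UNIV (\<lambda>x. p' (u x) *\<^sub>R U x)"
    by (intro continuous_intros continuous_on_compose2[OF p'] has_grad_cont[OF u] has_grad_cont_grad[OF u]) (use T in auto)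
qed

lemmas has_grad_compose = has_grad_compose_on[where T=UNIV, simplified]

lemma has_grad_norm2:
  "has_grad (\<lambda>x. (norm (x - b))\<^sup>2) (\<lambda>x. 2 *\<^sub>R (x - b))"
  unfolding has_grad_def power2_norm_eq_inner
  by (auto intro!: derivative_eq_intros continuous_intros simp: inner_commute)

lemma C1_map_grad: "C1_map g G \<Longrightarrow> has_grad (\<lambda>x. g x $ i) (\<lambda>x. G x $ i)"
  by (simp add: C1_map_def)

lemma C1_map_deriv:
  assumes "C1_map g G"
  shows "(g has_derivative (\<lambda>h. G x *v h)) (at x)"
proof -
  have "((\<lambda>x. \<chi> i. g x $ i) has_derivative (\<lambda>h. \<chi> i. G x $ i \<bullet> h)) (at x)"
    unfolding has_derivative_componentwise_within[of "\<lambda>x. \<chi> i. g x $ i"]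
    using has_gradD[OF C1_map_grad[OF assms]]
    by (auto simp: Basis_vec_def inner_axis)
  then show ?thesis
    by (simp add: matrix_vector_mul_component[abs_def] matrix_vector_mult_def inner_vec_def)
qed

lemma C1_map_cont: "C1_map g G \<Longrightarrow> continuous_on S g"
  by (meson C1_map_deriv continuous_at_imp_continuous_on has_derivative_continuous)

lemma C1_map_cont_deriv: "C1_map g G \<Longrightarrow> continuous_on S G"
  using continuous_on_vec_lambda[of S "\<lambda>i x. G x $ i"] has_grad_cont_grad[OF C1_map_grad] by fastforce

lemma continuous_on_det [continuous_intros]:
  fixes A :: "'a::topological_space \<Rightarrow> real ^ 'n ^ 'n"
  shows "continuous_on S A \<Longrightarrow> continuous_on S (\<lambda>x. det (A x))"
  unfolding det_def by (auto intro!: continuous_intros)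

lemma has_grad_chain:
  assumes v: "has_grad v V" and g: "C1_map g G"
  shows "has_grad (\<lambda>x. v (g x)) (\<lambda>x. V (g x) v* G x)"
  unfolding has_grad_def
proof (intro conjI allI)
  show "((\<lambda>x. v (g x)) has_derivative (\<lambda>h. (V (g x) v* G x) \<bullet> h)) (at x)" for x
    using has_derivative_compose[OF C1_map_deriv[OF g] has_gradD[OF v]]
    by (simp add: dot_lmul_matrix)
  have "continuous_on UNIV (\<lambda>x. V (g x))"
    by (rule continuous_on_compose2[OF has_grad_cont_grad[OF v, of UNIV] C1_map_cont[OF g]]) auto
  then show "continuous_on UNIV (\<lambda>x. V (g x) v* G x)"
    using C1_map_cont_deriv[OF g, of UNIV] unfolding vector_matrix_mult_def
    by (auto intro!: continuous_intros)
qed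

lemma C1_map_scaleR:
  assumes "C1_map g G" shows "C1_map (\<lambda>x. c *\<^sub>R g x) (\<lambda>x. c *\<^sub>R G x)"
  using assms has_grad_cmult unfolding C1_map_def by fastforce

section \<open>Concentric cubes and their boundaries\<close>

definition cube :: "real \<Rightarrow> (real ^ 'n::finite) set" where
  "cube r = cbox (\<chi> i. - r) (\<chi> i. r)"

lemma mem_cube: "x \<in> cube r \<longleftrightarrow> (\<forall>i. \<bar>x $ i\<bar> \<le> r)"
  by (auto simp: cube_def mem_box_cart abs_le_iff minus_le_iff)

lemma cube_mono: "r \<le> s \<Longrightarrow> cube r \<subseteq> cube s"
  unfolding mem_cube subset_iff by (meson order_trans)

lemma compact_cube [simp, intro]: "compact (cube r)"
  and convex_cube [simp, intro]: "convex (cube r)"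
  and closed_cube [simp, intro]: "closed (cube r)"
  by (auto simp: cube_def closed_cbox)

lemma zero_in_cube [simp]: "0 \<le> r \<Longrightarrow> 0 \<in> cube r"
  by (simp add: mem_cube)

lemma norm_cube: "x \<in> cube r \<Longrightarrow> norm (x :: real ^ 'n::finite) \<le> real CARD('n) * (r :: real)"
  using norm_le_l1_cart[of x] sum_bounded_above[of UNIV "\<lambda>i. \<bar>x $ i\<bar>" r] by (force simp: mem_cube)

lemma ball_subset_cube: "cball 0 r \<subseteq> cube r"
proof
  fix x :: "real^'a" assume "x \<in> cball 0 r"
  then show "x \<in> cube r"
    using component_le_norm_cart[of x] by (auto simp: mem_cube intro: order_trans)
qed

definition cubeb :: "real \<Rightarrow> (real ^ 'n::finite) set" where
  "cubeb r = {x \<in> cube r. \<exists>i. \<bar>x $ i\<bar> = r}"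

lemma cubeb_subset: "cubeb r \<subseteq> cube r"
  by (auto simp: cubeb_def)

lemma measure_cube: "0 \<le> (r :: real) \<Longrightarrow> measure lborel (cube r :: (real ^ 'n::finite) set) = (2 * r) ^ CARD('n)"
  unfolding cube_def by (subst content_cbox_cart) (auto simp: interval_eq_empty_cart mem_box_cart intro!: exI[of _ 0])

lemma integrable_cube: "continuous_on (cube r) f \<Longrightarrow> (f :: real ^ 'n::finite \<Rightarrow> 'b::banach) integrable_on cube r"
  unfolding cube_def by (rule integrable_continuous)

lemma integral_cube_eq_superset:
  fixes f :: "real ^ 'n::finite \<Rightarrow> real"
  assumes "continuous_on UNIV f" "\<And>x. x \<notin> cube r \<Longrightarrow> f x = 0" "r \<le> s"
  shows "integral (cube s) f = integral (cube r) f"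
proof -
  have "(f has_integral integral (cube r) f) (cube r)"
    by (rule integrable_integral[OF integrable_cube]) (use assms in \<open>auto intro: continuous_on_subset\<close>)
  then have "(f has_integral integral (cube r) f) (cube s)"
    by (rule has_integral_on_superset) (use assms cube_mono in auto)
  then show ?thesis by blast
qed

subsection \<open>Cutoff functions\<close>

text \<open>Cutoffs and bumps only have to be continuously differentiable, so a squared positive
  part takes the place of a smooth bump.\<close>

definition sqp :: "real \<Rightarrow> real" where "sqp t = (max 0 t)\<^sup>2"

lemma sqp_nonneg [simp]: "0 \<le> sqp t" by (simp add: sqp_def)

lemma sqp_eq_0 [simp]: "sqp t = 0 \<longleftrightarrow> t \<le> 0" by (auto simp: sqp_def max_def)

lemma sqp_deriv: "(sqp has_real_derivative 2 * max 0 t) (at t)"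
proof (cases "t = 0")
  case True
  have "((\<lambda>h. max 0 h) \<longlongrightarrow> max 0 0) (at (0::real))"
    by (intro tendsto_intros)
  then have "((\<lambda>h. max 0 h :: real) \<longlongrightarrow> 0) (at 0)" by simp
  moreover have "\<forall>\<^sub>F h in at 0. max 0 h = (sqp (0 + h) - sqp 0) / h"
    by (rule eventually_mono[OF eventually_True]) (auto simp: sqp_def max_def power2_eq_square)
  ultimately have "((\<lambda>h. (sqp (0 + h) - sqp 0) / h) \<longlongrightarrow> 0) (at 0)"
    by (rule Lim_transform_eventually)
  then show ?thesis using True by (simp add: DERIV_def)
next
  case False
  show ?thesis
  proof (cases "t > 0")
    case True
    have "((\<lambda>t. t\<^sup>2) has_real_derivative 2 * max 0 t) (at t)"
      using True by (auto intro!: derivative_eq_intros)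
    then show ?thesis
      by (rule has_field_derivative_transform_within_open[of _ _ _ "{0<..}"]) (use True in \<open>auto simp: sqp_def\<close>)
  next
    case 2: False
    have "((\<lambda>t. 0) has_real_derivative 2 * max 0 t) (at t)"
      using 2 by (auto intro!: derivative_eq_intros)
    then show ?thesis
      by (rule has_field_derivative_transform_within_open[of _ _ _ "{..<0}"]) (use 2 False in \<open>auto simp: sqp_def\<close>)
  qed
qed

lemma has_grad_sqp:
  "has_grad u U \<Longrightarrow> has_grad (\<lambda>x. sqp (u x)) (\<lambda>x. (2 * max 0 (u x)) *\<^sub>R U x)"
  by (rule has_grad_compose[OF sqp_deriv]) (auto intro!: continuous_intros)

text \<open>For 0 \<le> a < b the inner sum is 0 on \<open>cube a\<close>, while off
  \<open>cube b\<close> a single summand already reaches (b^2 - a^2)^2; this gives the values 1 and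
  0. Squared coordinates are used because the maximum norm, whose balls are the cubes, is not
  differentiable.\<close>

definition cut :: "real \<Rightarrow> real \<Rightarrow> real ^ 'n::finite \<Rightarrow> real" where
  "cut a b x = sqp (1 - (1 / (b\<^sup>2 - a\<^sup>2)\<^sup>2) * (\<Sum>i\<in>UNIV. sqp ((x $ i)\<^sup>2 - a\<^sup>2)))"

lemma cut_grad: "\<exists>\<Phi>. has_grad (cut a b :: real ^ 'n::finite \<Rightarrow> real) \<Phi>"
proof -
  have "\<exists>U. has_grad (\<lambda>x::real^'n. sqp ((x $ i)\<^sup>2 - a\<^sup>2)) U" for i
    unfolding power2_eq_square
    by (rule exI, rule has_grad_sqp, rule has_grad_diff, rule has_grad_mult) auto
  then obtain U where U: "has_grad (\<lambda>x::real^'n. sqp ((x $ i)\<^sup>2 - a\<^sup>2)) (U i)" for i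
    by metis
  show ?thesis
    unfolding cut_def[abs_def]
    by (rule exI, rule has_grad_sqp, rule has_grad_diff, rule has_grad_const,
        rule has_grad_cmult, rule has_grad_sum, rule U)
qed

lemma cut_nonneg: "0 \<le> cut a b x" by (simp add: cut_def)

lemma cut_le_1: "cut a b x \<le> 1"
  unfolding cut_def sqp_def by (rule power_le_one) (auto intro!: sum_nonneg divide_nonneg_nonneg)

lemma cut_eq_1: assumes "0 \<le> a" "x \<in> cube a" shows "cut a b x = 1"
proof -
  have "(x $ i)\<^sup>2 \<le> a\<^sup>2" for i
    using assms by (simp add: mem_cube flip: abs_le_square_iff)
  then show ?thesis by (simp add: cut_def sqp_def)
qed

lemma cut_eq_0: assumes "0 \<le> a" "a < b" "x \<notin> cube b" shows "cut a b x = 0"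
proof -
  obtain i where i: "\<bar>x $ i\<bar> > b" using assms by (auto simp: mem_cube not_le)
  have ab: "0 < b\<^sup>2 - a\<^sup>2" using assms by (simp add: power_strict_mono)
  have "b\<^sup>2 < (x $ i)\<^sup>2" using i assms power_strict_mono[of b "\<bar>x $ i\<bar>" 2] by simp
  then have "(b\<^sup>2 - a\<^sup>2)\<^sup>2 \<le> sqp ((x $ i)\<^sup>2 - a\<^sup>2)"
    using ab unfolding sqp_def by (intro power_mono) auto
  also have "\<dots> \<le> (\<Sum>i\<in>UNIV. sqp ((x $ i)\<^sup>2 - a\<^sup>2))"
    by (rule member_le_sum) auto
  finally show ?thesis using ab by (simp add: cut_def field_simps)
qed

subsection \<open>Elementary inequalities\<close>

text \<open>Young's inequality without fractional powers: if a \<le> e b the first term alone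
  dominates, otherwise b < a / e and the second one does. The constants are not optimal, but only
  their dependence on n and \<open>e\<close> matters.\<close>

lemma young_split:
  fixes a b e :: real
  assumes "0 \<le> a" "0 \<le> b" "0 < e"
  shows "a * b ^ k \<le> e * b ^ Suc k + (1 / e) ^ k * a ^ Suc k"
proof (cases "a \<le> e * b")
  case True
  then have "a * b ^ k \<le> (e * b) * b ^ k" using assms by (intro mult_right_mono) auto
  moreover have "0 \<le> (1 / e) ^ k * a ^ Suc k" using assms by simp
  ultimately show ?thesis by (simp add: mult_ac)
next
  case False
  then have "b \<le> a / e" using assms by (simp add: field_simps)
  then have "a * b ^ k \<le> a * (a / e) ^ k" using assms by (intro mult_left_mono power_mono) auto
  moreover have "0 \<le> e * b ^ Suc k" using assms by simp
  ultimately show ?thesis by (simp add: power_divide field_simps)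
qed

lemma le_young:
  fixes t m :: real
  assumes "0 \<le> t" "0 < m"
  shows "t \<le> m + (1 / m) ^ k * t ^ Suc k"
  using young_split[of t 1 m k] assms by simp

lemma norm_matrix_vector_le:
  fixes A :: "real ^ 'n ^ 'm"
  shows "norm (A *v h) \<le> norm A * norm h"
proof -
  have "norm (A *v h) = L2_set (\<lambda>i. \<bar>A $ i \<bullet> h\<bar>) UNIV"
    by (simp add: norm_vec_def matrix_vector_mul_component)
  also have "\<dots> \<le> L2_set (\<lambda>i. norm h * norm (A $ i)) UNIV"
    by (rule L2_set_mono) (auto simp: Cauchy_Schwarz_ineq2 mult.commute[of "norm h"])
  also have "\<dots> = norm h * L2_set (\<lambda>i. norm (A $ i)) UNIV" by (simp add: L2_set_right_distrib)
  also have "\<dots> = norm A * norm h" by (simp add: norm_vec_def[of A])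
  finally show ?thesis .
qed

lemma det_row_bound:
  fixes A :: "real ^ 'n ^ 'n"
  assumes "\<And>i. norm (A $ i) \<le> b i"
  shows "\<bar>det A\<bar> \<le> fact CARD('n) * (\<Prod>i\<in>UNIV. b i)"
proof -
  have "\<bar>det A\<bar> \<le> (\<Sum>p | p permutes (UNIV :: 'n set). \<bar>of_int (sign p) * (\<Prod>i\<in>UNIV. A $ i $ p i)\<bar>)"
    unfolding det_def by (rule sum_abs)
  also have "\<dots> \<le> (\<Sum>p | p permutes (UNIV :: 'n set). (\<Prod>i\<in>UNIV. b i))"
  proof (rule sum_mono)
    fix p assume "p \<in> {p. p permutes (UNIV :: 'n set)}"
    have "\<bar>A $ i $ p i\<bar> \<le> b i" for i
      using component_le_norm_cart[of "A $ i" "p i"] assms[of i] by linarith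
    then have "(\<Prod>i\<in>UNIV. \<bar>A $ i $ p i\<bar>) \<le> (\<Prod>i\<in>UNIV. b i)"
      by (intro prod_mono) auto
    then show "\<bar>of_int (sign p) * (\<Prod>i\<in>UNIV. A $ i $ p i)\<bar> \<le> (\<Prod>i\<in>UNIV. b i)"
      by (simp add: abs_mult abs_prod flip: of_int_abs)
  qed
  also have "\<dots> = fact CARD('n) * (\<Prod>i\<in>UNIV. b i)"
    by (simp add: card_permutations)
  finally show ?thesis .
qed

lemma det_replace_row_bound:
  fixes A :: "real ^ 'n ^ 'n"
  shows "\<bar>det (\<chi> k. if k = i then v else A $ k)\<bar> \<le> fact CARD('n) * (norm v * norm A ^ (CARD('n) - 1))"
proof -
  have "(\<Prod>k\<in>UNIV. if k = i then norm v else norm A) = norm v * norm A ^ (CARD('n) - 1)"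
    by (subst prod.remove[of _ i]) (auto simp: card_Diff_singleton intro!: prod.cong)
  then show ?thesis
    using det_row_bound[of "\<chi> k. if k = i then v else A $ k" "\<lambda>k. if k = i then norm v else norm A"]
    by (simp add: Finite_Cartesian_Product.norm_nth_le)
qed

section \<open>Reindexing to a well-ordered index type\<close>

text \<open>The library's change-of-variables results are stated for index types of class
  \<open>wellorder\<close> only; \<open>'n wo\<close> is a well-ordered copy of \<open>'n\<close>.\<close>

typedef 'n wo = "UNIV :: 'n set" by simp

instance wo :: (finite) finite
proof
  have "(UNIV :: 'a wo set) = range Abs_wo" by (metis Rep_wo_inverse UNIV_eq_I rangeI)
  then show "finite (UNIV :: 'a wo set)" by (metis finite finite_imageI)
qed

instantiation wo :: (finite) wellorder
begin

definition enum_wo :: "'a wo \<Rightarrow> nat" where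
  "enum_wo = (SOME h. inj h)"

lemma inj_enum_wo: "inj (enum_wo :: 'a wo \<Rightarrow> nat)"
  unfolding enum_wo_def
  by (rule someI_ex[of inj]) (use finite_imp_inj_to_nat_seg[of "UNIV :: 'a wo set"] in auto)

definition "x \<le> y \<longleftrightarrow> enum_wo x \<le> enum_wo (y :: 'a wo)"
definition "x < y \<longleftrightarrow> enum_wo x < enum_wo (y :: 'a wo)"

instance
proof
  fix x y z :: "'a wo" and P :: "'a wo \<Rightarrow> bool"
  show "x < y \<longleftrightarrow> x \<le> y \<and> \<not> y \<le> x" by (auto simp: less_eq_wo_def less_wo_def)
  show "x \<le> x" by (auto simp: less_eq_wo_def)
  show "x \<le> y \<Longrightarrow> y \<le> z \<Longrightarrow> x \<le> z" by (auto simp: less_eq_wo_def)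
  show "x \<le> y \<Longrightarrow> y \<le> x \<Longrightarrow> x = y" using inj_enum_wo by (auto simp: less_eq_wo_def inj_def)
  show "x \<le> y \<or> y \<le> x" by (auto simp: less_eq_wo_def)
  show "(\<And>x. (\<And>y. y < x \<Longrightarrow> P y) \<Longrightarrow> P x) \<Longrightarrow> P x"
    by (rule measure_induct_rule[of enum_wo]) (simp add: less_wo_def)
qed

end

definition ri :: "real ^ 'n::finite wo \<Rightarrow> real ^ 'n" where "ri x = (\<chi> i. x $ Abs_wo i)"
definition ri_inv :: "real ^ 'n::finite \<Rightarrow> real ^ 'n wo" where "ri_inv x = (\<chi> i. x $ Rep_wo i)"

lemma ri_simps [simp]: "ri x $ i = x $ Abs_wo i" "ri_inv y $ j = y $ Rep_wo j"
  "ri (ri_inv y) = y" "ri_inv (ri x) = x"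
  by (auto simp: ri_def ri_inv_def vec_eq_iff Abs_wo_inverse Rep_wo_inverse)

lemma bij_Rep_wo: "bij (Rep_wo :: 'n wo \<Rightarrow> 'n)"
  by (rule bij_betw_byWitness[where f'=Abs_wo]) (auto simp: Abs_wo_inverse Rep_wo_inverse)

lemma bij_Abs_wo: "bij (Abs_wo :: 'n \<Rightarrow> 'n wo)"
  by (rule bij_betw_byWitness[where f'=Rep_wo]) (auto simp: Abs_wo_inverse Rep_wo_inverse)

lemma linear_ri: "linear ri" and linear_ri_inv: "linear ri_inv"
  by (auto intro!: linearI simp: vec_eq_iff)

lemma prod_Basis_cart: "(\<Prod>b\<in>Basis. f b) = (\<Prod>i\<in>(UNIV :: 'n::finite set). f (axis i (1::real)))"
proof -
  have eq: "(Basis :: (real^'n) set) = (\<lambda>i. axis i 1) ` UNIV" by (auto simp: Basis_vec_def)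
  show ?thesis unfolding eq by (subst prod.reindex) (auto simp: inj_on_def axis_eq_axis)
qed

text \<open>Relabelling coordinates maps boxes to boxes of the same volume, and Lebesgue measure is
  determined by its values on boxes.\<close>

lemma distr_ri: "distr lborel borel ri = (lborel :: (real ^ 'n::finite) measure)"
proof (rule lborel_eqI[symmetric])
  fix l u :: "real ^ 'n" assume le: "\<And>b. b \<in> Basis \<Longrightarrow> l \<bullet> b \<le> u \<bullet> b"
  have [measurable]: "ri \<in> borel \<rightarrow>\<^sub>M (borel :: (real ^ 'n) measure)"
    by (intro borel_measurable_continuous_onI linear_continuous_on linear_conv_bounded_linear[THEN iffD1] linear_ri)
  have le': "l $ i \<le> u $ i" for i using le[of "axis i 1"] by (auto simp: inner_axis)
  have "ri -` box l u = box (ri_inv l) (ri_inv u)"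
    by (auto simp: mem_box_cart) (metis Abs_wo_inverse UNIV_I Rep_wo_inverse)+
  then have "emeasure (distr lborel borel ri) (box l u) = emeasure lborel (box (ri_inv l) (ri_inv u))"
    by (simp add: emeasure_distr)
  also have "\<dots> = (\<Prod>b\<in>Basis. (ri_inv u - ri_inv l) \<bullet> b)"
    by (rule emeasure_lborel_box) (auto simp: Basis_vec_def inner_axis le')
  also have "(\<Prod>b\<in>Basis. (ri_inv u - ri_inv l) \<bullet> b) = (\<Prod>b\<in>Basis. (u - l) \<bullet> b)"
    unfolding prod_Basis_cart by (auto simp: inner_axis intro!: prod.reindex_bij_betw[OF bij_Rep_wo, of "\<lambda>i. u $ i - l $ i"])
  finally show "emeasure (distr lborel borel ri) (box l u) = (\<Prod>b\<in>Basis. (u - l) \<bullet> b)" .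
qed simp

lemma compact_ri_vimage: "compact S \<Longrightarrow> compact (ri -` S)"
proof -
  assume S: "compact S"
  have eq: "ri -` S = ri_inv ` S" by (auto simp: image_iff) (metis ri_simps(4))
  show "compact (ri -` S)"
    unfolding eq by (intro compact_continuous_image S linear_continuous_on linear_conv_bounded_linear[THEN iffD1] linear_ri_inv)
qed

lemma ri_vimage_cube: "ri -` cube r = cube r"
  unfolding set_eq_iff vimage_eq mem_cube by simp (metis Rep_wo_inverse)

lemma integral_ri:
  fixes f :: "real ^ 'n::finite \<Rightarrow> real"
  assumes "continuous_on UNIV f" "compact S"
  shows "integral (ri -` S) (\<lambda>x. f (ri x)) = integral S f"
proof -
  have c: "continuous_on UNIV (ri :: real ^ 'n wo \<Rightarrow> _)"
    by (intro linear_continuous_on linear_conv_bounded_linear[THEN iffD1] linear_ri)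
  have [measurable]: "ri \<in> borel \<rightarrow>\<^sub>M (borel :: (real ^ 'n) measure)"
    using c by (rule borel_measurable_continuous_onI)
  have *: "integral S h = (\<integral>x. indicator S x * h x \<partial>lborel)"
    if "continuous_on UNIV h" "compact S" for h :: "real ^ 'm::finite \<Rightarrow> real" and S
  proof -
    have "set_integrable lborel S h"
      unfolding set_integrable_def
      by (rule borel_integrable_compact) (use that in \<open>auto intro: continuous_on_subset\<close>)
    from set_borel_integral_eq_integral(2)[OF this] show ?thesis
      by (simp add: set_lebesgue_integral_def)
  qed
  have m: "(\<lambda>x. indicator S x * f x) \<in> borel_measurable borel"
    using borel_measurable_continuous_onI[OF assms(1)] assms(2)
    by (intro borel_measurable_times borel_measurable_indicator) (auto simp: compact_imp_closed borel_closed)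
  have ind: "indicator S (ri x) = (indicator (ri -` S) x :: real)" for x :: "real ^ 'n wo"
    by (simp add: indicator_def)
  have "integral S f = (\<integral>x. indicator S x * f x \<partial>distr lborel borel ri)"
    unfolding distr_ri by (rule *[OF assms])
  also have "\<dots> = (\<integral>x. indicator S (ri x) * f (ri x) \<partial>lborel)"
    by (rule integral_distr) (use m in auto)
  also have "\<dots> = (\<integral>x. indicator (ri -` S) x * f (ri x) \<partial>lborel)"
    unfolding ind ..
  also have "\<dots> = integral (ri -` S) (\<lambda>x. f (ri x))"
    by (rule *[symmetric])
      (use compact_ri_vimage[OF assms(2)] in \<open>auto intro: continuous_on_compose2[OF assms(1) c]\<close>)
  finally show ?thesis by simp
qed

definition ri_mat :: "real ^ 'n::finite ^ 'n \<Rightarrow> real ^ 'n wo ^ 'n wo" where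
  "ri_mat A = (\<chi> i j. A $ Rep_wo i $ Rep_wo j)"

text \<open>Conjugation by the bijection \<open>Rep_wo\<close> matches the permutations of the two
  index types and preserves signs, so the two Leibniz sums agree term by term.\<close>

lemma det_ri_mat: "det (ri_mat A) = det (A :: real ^ 'n::finite ^ 'n)"
proof -
  have mp: "map_permutation UNIV Rep_wo p permutes (UNIV :: 'n set)"
    and sg: "sign (map_permutation UNIV Rep_wo p) = sign p"
    and ap: "map_permutation UNIV Rep_wo p (Rep_wo i) = Rep_wo (p i)"
    if "p permutes (UNIV :: 'n wo set)" for p i
    using map_permutation_permutes[OF bij_Rep_wo that] sign_map_permutation[OF bij_is_inj[OF bij_Rep_wo] that]
      map_permutation_apply[OF bij_is_inj[OF bij_Rep_wo]] by auto
  have mp2: "map_permutation UNIV Abs_wo p permutes (UNIV :: 'n wo set)"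
    if "p permutes (UNIV :: 'n set)" for p
    using map_permutation_permutes[OF bij_Abs_wo that] by auto
  show ?thesis
    unfolding det_def
  proof (rule sum.reindex_bij_witness[where j="map_permutation UNIV Rep_wo" and i="map_permutation UNIV Abs_wo"])
    fix p assume "p \<in> {p. p permutes (UNIV :: 'n wo set)}"
    then have p: "p permutes UNIV" by simp
    show "map_permutation UNIV Abs_wo (map_permutation UNIV Rep_wo p) = p"
      using map_permutation_compose_inv[OF bij_Rep_wo p] by (simp add: Rep_wo_inverse)
    show "map_permutation UNIV Rep_wo p \<in> {p. p permutes (UNIV :: 'n set)}" using mp[OF p] by simp
    have "(\<Prod>i\<in>UNIV. A $ i $ map_permutation UNIV Rep_wo p i)
       = (\<Prod>i\<in>UNIV. A $ Rep_wo i $ map_permutation UNIV Rep_wo p (Rep_wo i))"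
      by (rule prod.reindex_bij_betw[OF bij_Rep_wo, symmetric])
    then show "of_int (sign (map_permutation UNIV Rep_wo p)) * (\<Prod>i\<in>UNIV. A $ i $ map_permutation UNIV Rep_wo p i) =
         of_int (sign p) * (\<Prod>i\<in>UNIV. ri_mat A $ i $ p i)"
      by (simp add: sg[OF p] ap[OF p] ri_mat_def)
  next
    fix p assume "p \<in> {p. p permutes (UNIV :: 'n set)}"
    then have p: "p permutes UNIV" by simp
    show "map_permutation UNIV Rep_wo (map_permutation UNIV Abs_wo p) = p"
      using map_permutation_compose_inv[OF bij_Abs_wo p] by (simp add: Abs_wo_inverse)
    show "map_permutation UNIV Abs_wo p \<in> {p. p permutes (UNIV :: 'n wo set)}" using mp2[OF p] by simp
  qed
qed

lemma has_grad_ri: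
  assumes "has_grad u U" shows "has_grad (\<lambda>x. u (ri x)) (\<lambda>x. ri_inv (U (ri x)))"
proof -
  have bl: "bounded_linear (ri :: real ^ 'a wo \<Rightarrow> _)" "bounded_linear (ri_inv :: real ^ 'a \<Rightarrow> _)"
    by (auto simp: linear_ri linear_ri_inv linear_conv_bounded_linear[symmetric])
  have adj: "ri_inv a \<bullet> h = a \<bullet> ri h" for a :: "real ^ 'a" and h
    unfolding inner_vec_def
    by (simp add: prod.reindex_bij_betw) (subst sum.reindex_bij_betw[OF bij_Rep_wo, symmetric], simp add: Rep_wo_inverse)
  show ?thesis
    unfolding has_grad_def
  proof (intro conjI allI)
    show "((\<lambda>x. u (ri x)) has_derivative (\<bullet>) (ri_inv (U (ri x)))) (at x)" for x
      using has_derivative_compose[OF bounded_linear_imp_has_derivative[OF bl(1)] has_gradD[OF assms]]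
      by (simp add: adj[abs_def])
    show "continuous_on UNIV (\<lambda>x. ri_inv (U (ri x)))"
      by (intro continuous_on_compose2[OF linear_continuous_on[OF bl(2), of UNIV]]
          continuous_on_compose2[OF has_grad_cont_grad[OF assms, of UNIV]]
          linear_continuous_on[OF bl(1)]) auto
  qed
qed

lemma C1_map_ri:
  assumes "C1_map g G"
  shows "C1_map (\<lambda>x. ri_inv (g (ri x))) (\<lambda>x. ri_mat (G (ri x)))"
proof -
  have "ri_mat A $ i = ri_inv (A $ Rep_wo i)" for A :: "real ^ 'a ^ 'a" and i
    by (simp add: ri_mat_def vec_eq_iff)
  then show ?thesis
    using has_grad_ri[OF C1_map_grad[OF assms]] by (simp add: C1_map_def)
qed

section \<open>The Jacobian determinant is a null Lagrangian\<close>

text \<open>Each Leibniz product is expanded over the set \<open>X\<close> of factors taken from t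
  W, and \<open>card X\<close> is the power of t. At the top degree \<open>X\<close> can only be the
  whole index set, which leaves det (W x). The coefficients are continuous, so the polynomial may be
  integrated coefficientwise.\<close>

lemma det_add_scaleR_poly:
  fixes W :: "real ^ 'n \<Rightarrow> real ^ 'n ^ 'n"
  assumes "continuous_on UNIV W"
  obtains c where "\<And>k. continuous_on UNIV (c k)"
    "\<And>t x. det (mat 1 + t *\<^sub>R W x) = (\<Sum>k\<le>CARD('n). c k x * t ^ k)"
    "\<And>x. c CARD('n) x = det (W x)"
proof -
  define c where "c k x = (\<Sum>p | p permutes (UNIV :: 'n set). of_int (sign p) *
      (\<Sum>X | X \<subseteq> UNIV \<and> card X = k. (\<Prod>i\<in>X. W x $ i $ p i) * (\<Prod>i\<in>UNIV - X. (mat 1 :: real^'n^'n) $ i $ p i)))" for k x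
  show ?thesis
  proof (rule that)
    show "continuous_on UNIV (c k)" for k
      unfolding c_def by (intro continuous_intros assms)
    have "{X. X \<subseteq> (UNIV :: 'n set) \<and> card X = CARD('n)} = {UNIV}"
      using card_subset_eq[of "UNIV :: 'n set"] by auto
    then show "c CARD('n) x = det (W x)" for x
      unfolding c_def det_def by simp
    fix t x
    have "(\<Prod>i\<in>UNIV. (mat 1 + t *\<^sub>R W x) $ i $ p i) = (\<Sum>k\<le>CARD('n). t ^ k *
      (\<Sum>X | X \<subseteq> UNIV \<and> card X = k. (\<Prod>i\<in>X. W x $ i $ p i) * (\<Prod>i\<in>UNIV - X. (mat 1 :: real^'n^'n) $ i $ p i)))" for p
    proof -
      have "(\<Prod>i\<in>UNIV. (mat 1 + t *\<^sub>R W x) $ i $ p i) = (\<Prod>i\<in>UNIV. t * W x $ i $ p i + (mat 1 :: real^'n^'n) $ i $ p i)"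
        by (simp add: add.commute)
      also have "\<dots> = (\<Sum>X\<in>Pow UNIV. (\<Prod>i\<in>X. t * W x $ i $ p i) * (\<Prod>i\<in>UNIV - X. (mat 1 :: real^'n^'n) $ i $ p i))"
        by (rule prod_add) simp
      also have "\<dots> = (\<Sum>X\<in>Pow UNIV. t ^ card X * ((\<Prod>i\<in>X. W x $ i $ p i) * (\<Prod>i\<in>UNIV - X. (mat 1 :: real^'n^'n) $ i $ p i)))"
        by (simp add: prod.distrib mult_ac)
      also have "\<dots> = (\<Sum>k\<le>CARD('n). \<Sum>X | X \<in> Pow UNIV \<and> card X = k. t ^ card X * ((\<Prod>i\<in>X. W x $ i $ p i) * (\<Prod>i\<in>UNIV - X. (mat 1 :: real^'n^'n) $ i $ p i)))"
        by (rule sum.group[symmetric]) (auto intro: card_mono)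
      also have "\<dots> = (\<Sum>k\<le>CARD('n). t ^ k *
        (\<Sum>X | X \<subseteq> UNIV \<and> card X = k. (\<Prod>i\<in>X. W x $ i $ p i) * (\<Prod>i\<in>UNIV - X. (mat 1 :: real^'n^'n) $ i $ p i)))"
        unfolding sum_distrib_left by (intro sum.cong) auto
      finally show ?thesis .
    qed
    then show "det (mat 1 + t *\<^sub>R W x) = (\<Sum>k\<le>CARD('n). c k x * t ^ k)"
      unfolding det_def c_def
      by (subst sum_distrib_right, subst sum.swap) (simp add: sum_distrib_left mult_ac)
  qed
qed

text \<open>For small \<open>t\<close> the map \<open>id + t w\<close> is a bijection of the cube, so that the polynomial
  \<open>t \<mapsto> \<integral> det (I + t Dw)\<close> is constant near \<open>0\<close> and its leading coefficient vanishes.\<close>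

lemma integral_det_compact_support_wo:
  fixes w :: "real ^ 'n::{finite,wellorder} \<Rightarrow> real ^ 'n::_"
  assumes w: "C1_map w W" and supp: "\<And>x. x \<notin> cube r \<Longrightarrow> w x = 0"
  shows "integral (cube r) (\<lambda>x. det (W x)) = 0"
proof -
  have der: "(w has_derivative (\<lambda>h. W x *v h)) (at x)" for x by (rule C1_map_deriv[OF w])
  have cW: "continuous_on S W" for S by (rule C1_map_cont_deriv[OF w])
  obtain c where c: "\<And>k. continuous_on UNIV (c k)"
    "\<And>t x. det (mat 1 + t *\<^sub>R W x) = (\<Sum>k\<le>CARD('n). c k x * t ^ k)"
    "\<And>x. c CARD('n) x = det (W x)"
    using det_add_scaleR_poly[OF cW] by metis
  \<comment> \<open>The complement of the cube is open and \<open>w\<close> vanishes there, hence so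
    does its derivative. This makes the bound on the cube a global Lipschitz constant.\<close>
  have W0: "W x = 0" if "x \<notin> cube r" for x
  proof -
    have "((\<lambda>_. 0) has_derivative (\<lambda>h. W x *v h)) (at x)"
      by (rule has_derivative_transform_within_open[OF der, where s="- cube r"]) (use that supp in \<open>auto simp: open_Compl\<close>)
    then have "(\<lambda>h. W x *v h) = (\<lambda>h. 0)"
      using has_derivative_unique has_derivative_const by blast
    then show ?thesis by (metis matrix_eq matrix_vector_mult_0)
  qed
  have "compact (W ` cube r)" by (intro compact_continuous_image cW) auto
  then obtain B where B: "0 < B" "\<And>x. x \<in> cube r \<Longrightarrow> norm (W x) \<le> B"
    by (metis bounded_pos compact_imp_bounded image_eqI)
  have B': "norm (W x) \<le> B" for x using B W0[of x] by (cases "x \<in> cube r") auto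
  have lip: "norm (w x - w y) \<le> B * norm (x - y)" for x y
  proof (rule differentiable_bound[of UNIV w "\<lambda>x h. W x *v h"])
    show "onorm ((*v) (W x)) \<le> B" for x
      by (rule onorm_bound) (use B(1) in \<open>auto intro: order_trans[OF norm_matrix_vector_le mult_right_mono[OF B']]\<close>)
  qed (use der in auto)
  define t0 where "t0 = 1 / (2 * B)"
  have "((\<lambda>A :: real^'n::_^'n::_. det A) \<longlongrightarrow> det (mat 1 :: real^'n::_^'n::_)) (at (mat 1))"
    using continuous_on_det[OF continuous_on_id, of UNIV] unfolding continuous_on_def by blast
  then have "\<forall>\<^sub>F A in at (mat 1 :: real^'n::_^'n::_). det A > 0"
    by (rule order_tendstoD) simp
  then obtain d where d: "0 < d" "\<And>A :: real^'n::_^'n::_. dist A (mat 1) < d \<Longrightarrow> det A > 0"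
    unfolding eventually_at by (metis UNIV_I det_I zero_less_one)
  define t1 where "t1 = min t0 (d / (2 * B))"
  have t1: "0 < t1" using B d by (simp add: t1_def t0_def)
  have eq: "integral (cube r) (\<lambda>x. det (mat 1 + t *\<^sub>R W x)) = measure lebesgue (cube r :: (real^'n::_) set)"
    if t: "0 < t" "t < t1" for t
  proof -
    define T where "T x = x + t *\<^sub>R w x" for x
    have tB: "t * B < 1 / 2" "t * B < d" using t B d by (auto simp: t1_def t0_def field_simps)
    have "inj T"
    proof (rule injI)
      fix x y assume "T x = T y"
      then have "x - y = t *\<^sub>R (w y - w x)" by (simp add: T_def algebra_simps)
      then have "norm (x - y) = t * norm (w y - w x)" using t by simp
      also have "\<dots> \<le> t * (B * norm (x - y))" using lip[of y x] t by (simp add: norm_minus_commute)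
      also have "\<dots> = (t * B) * norm (x - y)" by simp
      also have "\<dots> \<le> 1 / 2 * norm (x - y)" using tB by (intro mult_right_mono) auto
      finally show "x = y" by simp
    qed
    have "surj T"
    proof (unfold surj_def, rule allI)
      fix y
      \<comment> \<open>A preimage of y under \<open>T\<close> is the same as a fixed point of the
        contraction x -> y - t w x.\<close>
      have "\<exists>!x. y - t *\<^sub>R w x = x"
      proof (rule banach_fix_type[of "1/2"])
        show "\<forall>x x'. dist (y - t *\<^sub>R w x) (y - t *\<^sub>R w x') \<le> 1 / 2 * dist x x'"
        proof (intro allI)
          fix x x'
          have "dist (y - t *\<^sub>R w x) (y - t *\<^sub>R w x') = t * norm (w x' - w x)"
            using t by (simp add: dist_norm flip: scaleR_diff_right)
          also have "\<dots> \<le> t * (B * norm (x - x'))" using lip[of x' x] t by (simp add: norm_minus_commute)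
          also have "\<dots> = (t * B) * norm (x - x')" by simp
          also have "\<dots> \<le> 1 / 2 * norm (x - x')" using tB by (intro mult_right_mono) auto
          finally show "dist (y - t *\<^sub>R w x) (y - t *\<^sub>R w x') \<le> 1 / 2 * dist x x'" by (simp add: dist_norm)
        qed
      qed auto
      then obtain x where "y - t *\<^sub>R w x = x" by blast
      then show "\<exists>x. y = T x" by (intro exI[of _ x]) (simp add: T_def algebra_simps)
    qed
    have out: "T x = x" if "x \<notin> cube r" for x using supp[OF that] by (simp add: T_def)
    have img: "T ` cube r = cube r"
    proof
      show "T ` cube r \<subseteq> cube r" using out \<open>inj T\<close> by (metis image_subsetI injD)
      show "cube r \<subseteq> T ` cube r"
      proof
        fix y :: "real ^ 'n::_" assume y: "y \<in> cube r"
        obtain x where "y = T x" using \<open>surj T\<close> unfolding surj_def by blast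
        with y out[of x] show "y \<in> T ` cube r" by (cases "x \<in> cube r") auto
      qed
    qed
    have derT: "(T has_derivative (\<lambda>h. (mat 1 + t *\<^sub>R W x) *v h)) (at x within cube r)" for x
    proof -
      have "(T has_derivative (\<lambda>h. h + t *\<^sub>R (W x *v h))) (at x within cube r)"
        unfolding T_def
        by (intro has_derivative_add has_derivative_ident has_derivative_scaleR_right has_derivative_at_withinI[OF der])
      then show ?thesis
        by (simp only: matrix_vector_mult_add_rdistrib scaleR_matrix_vector_assoc matrix_vector_mul_lid)
    qed
    have pos: "det (mat 1 + t *\<^sub>R W x) > 0" for x
    proof (rule d(2))
      have "dist (mat 1 + t *\<^sub>R W x) (mat 1) = t * norm (W x)" using t by (simp add: dist_norm)
      also have "\<dots> \<le> t * B" using B' t by simp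
      finally show "dist (mat 1 + t *\<^sub>R W x) (mat 1) < d" using tB by simp
    qed
    \<comment> \<open>The constant 1 is taken in \<open>real ^ 1\<close> to match the codomain in
      the change-of-variables theorem; \<open>s\<close> below converts back to real
      integrals.\<close>
    have one: "(\<lambda>x::real^'n::_. 1 :: real^1) absolutely_integrable_on cube r"
      unfolding cube_def by (rule absolutely_integrable_continuous[OF continuous_on_const])
    have d0: "\<bar>det (matrix (\<lambda>h. (mat 1 + t *\<^sub>R W x) *v h))\<bar> = det (mat 1 + t *\<^sub>R W x)" for x
      by (simp only: matrix_of_matrix_vector_mul abs_of_pos[OF pos])
    have sl: "cube r \<in> sets lebesgue" for r :: real by (simp add: cube_def)
    have inj: "inj_on T (cube r)" using \<open>inj T\<close> by (rule inj_on_subset) simp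
    note cv = has_absolute_integral_change_of_variables[of "cube r" T "\<lambda>x h. (mat 1 + t *\<^sub>R W x) *v h"
        "\<lambda>_. 1 :: real^1" "integral (cube r) (\<lambda>_. 1)", OF sl derT inj, unfolded img d0]
    have e: "integral (cube r) (\<lambda>x. det (mat 1 + t *\<^sub>R W x) *\<^sub>R (1 :: real^1)) = integral (cube r) (\<lambda>x::real^'n::_. 1 :: real^1)"
      by (rule cv[THEN iffD2, THEN conjunct2, OF conjI[OF one refl]])
    have i: "(\<lambda>x. det (mat 1 + t *\<^sub>R W x)) integrable_on cube r"
      by (intro integrable_cube continuous_intros cW)
    have s: "integral (cube r) (\<lambda>x. h x *\<^sub>R (1 :: real^1)) = integral (cube r) h *\<^sub>R 1"
      if "h integrable_on cube r" for h :: "real ^ 'n::_ \<Rightarrow> real"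
      using integral_linear[OF that bounded_linear_scaleR_left[of "1 :: real^1"]] by (simp add: o_def)
    have "integral (cube r) (\<lambda>x. det (mat 1 + t *\<^sub>R W x)) *\<^sub>R (1 :: real^1)
        = integral (cube r) (\<lambda>x::real^'n::_. 1 :: real) *\<^sub>R 1"
    proof -
      have "integral (cube r) (\<lambda>x::real^'n::_. 1 :: real^1) = integral (cube r) (\<lambda>x::real^'n::_. 1 :: real) *\<^sub>R 1"
        using s[OF integrable_cube[OF continuous_on_const], of 1] by simp
      then show ?thesis by (rule trans[OF trans[OF sym[OF s[OF i]] e]])
    qed
    then have "integral (cube r) (\<lambda>x. det (mat 1 + t *\<^sub>R W x)) = integral (cube r) (\<lambda>x::real^'n::_. 1)"
      by (simp only: scaleR_cancel_right) simp
    also have "\<dots> = measure lebesgue (cube r :: (real^'n::_) set)"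
      by (rule lmeasure_integral[symmetric]) (simp add: cube_def)
    finally show ?thesis .
  qed
  define C where "C k = integral (cube r) (c k)" for k
  define m where "m = measure lebesgue (cube r :: (real^'n::_) set)"
  \<comment> \<open>Moving the measure of the cube into the constant coefficient turns constancy on
    (0, t1) into vanishing on an infinite set. As n > 0, the top coefficient is not affected by this
    change.\<close>
  define C' where "C' k = (if k = 0 then C 0 - m else C k)" for k
  have "(\<Sum>k\<le>CARD('n). C' k * t ^ k) = 0" if t: "t \<in> {0<..<t1}" for t
  proof -
    have "m = integral (cube r) (\<lambda>x. \<Sum>k\<le>CARD('n). c k x * t ^ k)"
      using eq[of t] t unfolding m_def c(2) by auto
    also have "\<dots> = (\<Sum>k\<le>CARD('n). integral (cube r) (\<lambda>x. c k x * t ^ k))"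
      by (rule integral_sum) (auto intro!: integrable_cube continuous_intros continuous_on_subset[OF c(1)])
    also have "\<dots> = (\<Sum>k\<le>CARD('n). C k * t ^ k)" by (simp add: C_def)
    also have "\<dots> = (\<Sum>k\<le>CARD('n). C' k * t ^ k) + m"
    proof -
      have "C' k * t ^ k = C k * t ^ k - (if k = 0 then m else 0)" for k by (simp add: C'_def)
      then show ?thesis by (simp add: sum_subtractf)
    qed
    finally show ?thesis by simp
  qed
  then have "{0<..<t1} \<subseteq> {t. (\<Sum>k\<le>CARD('n). C' k * t ^ k) = 0}" by auto
  then have "infinite {t. (\<Sum>k\<le>CARD('n). C' k * t ^ k) = 0}"
    by (meson finite_subset infinite_Ioo t1)
  then have "C' CARD('n) = 0" using polyfun_finite_roots[of C' "CARD('n)"] by auto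
  then have "C CARD('n) = 0" by (simp add: C'_def)
  then show ?thesis by (simp add: C_def c(3)[symmetric] eta_contract_eq)
qed

lemma integral_det_compact_support:
  fixes w :: "real ^ 'n::finite \<Rightarrow> real ^ 'n"
  assumes w: "C1_map w W" and supp: "\<And>x. x \<notin> cube r \<Longrightarrow> w x = 0"
  shows "integral (cube r) (\<lambda>x. det (W x)) = 0"
proof -
  have "integral (cube r) (\<lambda>x. det (ri_mat (W (ri x)))) = 0"
  proof (rule integral_det_compact_support_wo[OF C1_map_ri[OF w]])
    fix x :: "real ^ 'n wo" assume "x \<notin> cube r"
    then have "ri x \<notin> cube r" by (simp add: mem_cube) (metis Rep_wo_inverse)
    from supp[OF this] show "ri_inv (w (ri x)) = 0" by (simp add: vec_eq_iff)
  qed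
  then show ?thesis
    using integral_ri[of "\<lambda>x. det (W x)" "cube r"] C1_map_cont_deriv[OF w]
    by (simp add: det_ri_mat continuous_on_det ri_vimage_cube)
qed

text \<open>This is the half of the area formula that holds without injectivity. It will turn the
  covering of a ball by g into a lower bound for a Jacobian integral.\<close>

lemma measure_C1_image_le:
  fixes g :: "real ^ 'n::finite \<Rightarrow> real ^ 'n"
  assumes g: "C1_map g G" and S: "compact S"
  shows "measure lebesgue (g ` S) \<le> integral S (\<lambda>x. \<bar>det (G x)\<bar>)"
proof -
  define h where "h x = ri_inv (g (ri x))" for x
  define H where "H x = ri_mat (G (ri x))" for x
  define T where "T = (ri -` S :: (real ^ 'n wo) set)"
  have T: "compact T" unfolding T_def by (rule compact_ri_vimage[OF S])
  have h: "C1_map h H" unfolding h_def H_def by (rule C1_map_ri[OF g])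
  have int: "(\<lambda>x. \<bar>det (H x)\<bar>) integrable_on T"
  proof -
    have "set_integrable lborel T (\<lambda>x. \<bar>det (H x)\<bar>)"
      unfolding set_integrable_def
      by (rule borel_integrable_compact[OF T]) (intro continuous_intros C1_map_cont_deriv[OF h])
    then show ?thesis by (rule set_borel_integral_eq_integral(1))
  qed
  have "measure lebesgue (h ` T) \<le> integral T (\<lambda>x. \<bar>det (matrix (\<lambda>y. H x *v y))\<bar>)"
  proof (rule measure_differentiable_image)
    show "T \<in> sets lebesgue" using T lmeasurable_compact by blast
    show "(h has_derivative (*v) (H x)) (at x within T)" for x
      by (rule has_derivative_at_withinI[OF C1_map_deriv[OF h]])
  qed (use int in \<open>simp add: matrix_of_matrix_vector_mul\<close>)
  also have "\<dots> = integral T (\<lambda>x. \<bar>det (G (ri x))\<bar>)"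
    by (simp add: matrix_of_matrix_vector_mul H_def det_ri_mat)
  also have "\<dots> = integral S (\<lambda>x. \<bar>det (G x)\<bar>)"
    unfolding T_def by (rule integral_ri[OF _ S]) (intro continuous_intros C1_map_cont_deriv[OF g])
  finally have 1: "measure lebesgue (h ` T) \<le> integral S (\<lambda>x. \<bar>det (G x)\<bar>)" .
  have hT: "h ` T = ri -` (g ` S)"
  proof
    show "h ` T \<subseteq> ri -` (g ` S)" by (auto simp: h_def T_def)
    show "ri -` (g ` S) \<subseteq> h ` T"
    proof
      fix y assume "y \<in> ri -` (g ` S)"
      then obtain x where x: "x \<in> S" "ri y = g x" by auto
      then have "y = h (ri_inv x)" unfolding h_def by simp (metis ri_simps(4))
      with x show "y \<in> h ` T" by (auto simp: T_def)
    qed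
  qed
  have gS: "compact (g ` S)" using S C1_map_cont[OF g] by (rule compact_continuous_image[rotated])
  have "measure lebesgue (g ` S) = integral (g ` S) (\<lambda>x. 1)"
    using gS by (intro lmeasure_integral lmeasurable_compact)
  also have "\<dots> = integral (ri -` (g ` S)) (\<lambda>x. 1)"
    using integral_ri[of "\<lambda>_. 1", OF continuous_on_const gS] by simp
  also have "\<dots> = measure lebesgue (h ` T)"
    unfolding hT using compact_ri_vimage[OF gS] by (intro lmeasure_integral[symmetric] lmeasurable_compact)
  finally show ?thesis using 1 by simp
qed

lemma has_grad_eq_0_open:
  assumes "has_grad u U" "open S" "x \<in> S" "\<And>y. y \<in> S \<Longrightarrow> u y = c"
  shows "U x = 0"
proof -
  have "((\<lambda>_. c) has_derivative (\<lambda>h. U x \<bullet> h)) (at x)"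
    by (rule has_derivative_transform_within_open[OF has_gradD[OF assms(1)] assms(2,3)]) (use assms(4) in auto)
  then have "(\<lambda>h. U x \<bullet> h) = (\<lambda>h. 0)"
    using has_derivative_unique has_derivative_const by blast
  then have "U x \<bullet> U x = 0" by metis
  then show ?thesis by simp
qed

lemma has_grad_eq_0_max:
  assumes "has_grad u U" "\<And>y. u y \<le> u x"
  shows "U x = 0"
proof -
  have "(\<lambda>h. U x \<bullet> h) = (\<lambda>h. 0)"
    using differential_zero_maxmin[of x UNIV u "\<lambda>h. U x \<bullet> h"] has_gradD[OF assms(1), of x] assms(2) by auto
  then have "U x \<bullet> U x = 0" by metis
  then show ?thesis by simp
qed

text \<open>Multiplying the other components of g by a cutoff \<theta> makes the whole map compactly
  supported without changing the determinant: on \<open>cube r\<close> the cutoff is 1 with zero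
  gradient, and elsewhere row i vanishes together with \<open>u\<close>.\<close>

lemma integral_det_replace_row:
  fixes g :: "real ^ 'n::finite \<Rightarrow> real ^ 'n"
  assumes u: "has_grad u U" and supp: "\<And>x. x \<notin> cube r \<Longrightarrow> u x = 0" and g: "C1_map g G" and r: "0 < r"
  shows "integral (cube r) (\<lambda>x. det (\<chi> k. if k = i then U x else G x $ k)) = 0"
proof -
  define \<theta> where "\<theta> = (cut r (r + 1) :: real ^ 'n \<Rightarrow> real)"
  obtain \<Theta> where \<Theta>: "has_grad \<theta> \<Theta>" using cut_grad unfolding \<theta>_def by blast
  define w where "w x = (\<chi> k. if k = i then u x else \<theta> x * g x $ k)" for x
  define W where "W x = (\<chi> k. if k = i then U x else \<theta> x *\<^sub>R G x $ k + g x $ k *\<^sub>R \<Theta> x)" for x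
  define F where "F x = det (\<chi> k. if k = i then U x else G x $ k)" for x
  have "C1_map w W"
    unfolding C1_map_def
  proof
    fix k show "has_grad (\<lambda>x. w x $ k) (\<lambda>x. W x $ k)"
      using u has_grad_mult[OF \<Theta> C1_map_grad[OF g, of k]] by (cases "k = i") (auto simp: w_def W_def)
  qed
  moreover have "w x = 0" if "x \<notin> cube (r + 1)" for x
    using that supp[of x] cube_mono[of r "r+1"] cut_eq_0[of r "r + 1" x] r by (auto simp: w_def \<theta>_def vec_eq_iff)
  ultimately have 0: "integral (cube (r + 1)) (\<lambda>x. det (W x)) = 0"
    by (rule integral_det_compact_support)
  have U0: "U x = 0" if "x \<notin> cube r" for x
    by (rule has_grad_eq_0_open[OF u, of "- cube r" _ 0]) (use that supp in \<open>auto simp: open_Compl\<close>)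
  have F0: "F x = 0" if "x \<notin> cube r" for x
    unfolding F_def by (rule det_zero_row(1)[of i]) (simp add: row_def U0[OF that] vec_eq_iff)
  have "det (W x) = F x" for x
  proof (cases "x \<in> cube r")
    case True
    have \<theta>1: "\<theta> x = 1" unfolding \<theta>_def by (rule cut_eq_1) (use True r in auto)
    have "\<Theta> x = 0" by (rule has_grad_eq_0_max[OF \<Theta>]) (simp add: \<theta>1, simp add: \<theta>_def cut_le_1)
    with \<theta>1 show ?thesis by (simp add: W_def F_def cong: if_cong)
  next
    case False
    have "det (W x) = 0"
      unfolding W_def by (rule det_zero_row(1)[of i]) (simp add: row_def U0[OF False] vec_eq_iff)
    with F0[OF False] show ?thesis by simp
  qed
  with 0 have "integral (cube (r + 1)) F = 0" by simp
  moreover have "integral (cube (r + 1)) F = integral (cube r) F"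
  proof (rule integral_cube_eq_superset)
    show "continuous_on UNIV F"
      unfolding F_def
    proof (intro continuous_intros continuous_on_vec_lambda)
      fix k show "continuous_on UNIV (\<lambda>x. if k = i then U x else G x $ k)"
        using has_grad_cont_grad[OF u] C1_map_cont_deriv[OF g] by (cases "k = i") (auto intro!: continuous_intros)
    qed
  qed (use F0 in auto)
  ultimately show ?thesis by (simp add: F_def[abs_def])
qed

text \<open>By linearity in row i the combination contributes v_j times a determinant with row j in
  place i; for j \<noteq> i two rows coincide.\<close>

lemma det_replace_row_combination:
  fixes A :: "real ^ 'n ^ 'n"
  shows "det (\<chi> k. if k = i then v v* A else A $ k) = v $ i * det A"
proof -
  have rw: "row j A = A $ j" for j by (simp add: row_def vec_lambda_eta)
  have "v v* A = (\<Sum>j\<in>UNIV. v $ j *s A $ j)"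
    by (simp add: vec_eq_iff vector_matrix_mult_def mult.commute)
  then show ?thesis using cramer_lemma_transpose[of i v A] by (simp add: rw cong: if_cong)
qed

lemma continuous_on_det_replace_row:
  fixes G :: "'a::topological_space \<Rightarrow> real ^ 'n ^ 'n"
  assumes "continuous_on S U" "continuous_on S G"
  shows "continuous_on S (\<lambda>x. det (\<chi> k. if k = i then U x else G x $ k))"
proof (intro continuous_intros continuous_on_vec_lambda)
  fix k show "continuous_on S (\<lambda>x. if k = i then U x else G x $ k)"
    using assms by (cases "k = i") (auto intro!: continuous_intros)
qed

lemma continuous_on_trace:
  fixes B :: "'a::topological_space \<Rightarrow> real ^ 'n ^ 'n"
  shows "continuous_on S B \<Longrightarrow> continuous_on S (\<lambda>x. trace (B x))"
  unfolding trace_def by (intro continuous_intros)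

text \<open>The pull-back of a divergence under \<open>g\<close> is again a divergence.\<close>

lemma integral_pullback_divergence:
  fixes g :: "real ^ 'n::finite \<Rightarrow> real ^ 'n"
  assumes b: "C1_map b B" and \<phi>: "has_grad \<phi> \<Phi>" and supp: "\<And>x. x \<notin> cube r \<Longrightarrow> \<phi> x = 0"
    and g: "C1_map g G" and r: "0 < r"
  shows "integral (cube r) (\<lambda>x. \<phi> x * trace (B (g x)) * det (G x)) =
    - integral (cube r) (\<lambda>x. \<Sum>i\<in>UNIV. b (g x) $ i * det (\<chi> k. if k = i then \<Phi> x else G x $ k))"
proof -
  have cG: "continuous_on S G" and cg: "continuous_on S g" for S
    using C1_map_cont_deriv[OF g] C1_map_cont[OF g] by auto
  have cB: "continuous_on S (\<lambda>x. B (g x))" "continuous_on S (\<lambda>x. b (g x))" for S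
    using continuous_on_compose2[OF C1_map_cont_deriv[OF b, of UNIV] cg[of S]]
      continuous_on_compose2[OF C1_map_cont[OF b, of UNIV] cg[of S]] by auto
  have c\<phi>: "continuous_on S \<phi>" "continuous_on S \<Phi>" for S
    using has_grad_cont[OF \<phi>] has_grad_cont_grad[OF \<phi>] by auto
  note cont = cG cg cB c\<phi> continuous_on_det_replace_row[OF c\<phi>(2) cG]
  have 1: "integral (cube r) (\<lambda>x. \<phi> x * B (g x) $ i $ i * det (G x)) +
     integral (cube r) (\<lambda>x. b (g x) $ i * det (\<chi> k. if k = i then \<Phi> x else G x $ k)) = 0" for i
  proof -
    define U where "U x = \<phi> x *\<^sub>R (B (g x) $ i v* G x) + (b (g x) $ i) *\<^sub>R \<Phi> x" for x
    have u: "has_grad (\<lambda>x. \<phi> x * b (g x) $ i) U"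
      unfolding U_def by (rule has_grad_mult[OF \<phi> has_grad_chain[OF C1_map_grad[OF b] g]])
    \<comment> \<open>Linearity in row i: the first summand of \<open>U\<close> is a combination of
      the rows of \<open>G\<close> and leaves only the diagonal entry of \<open>B\<close>, the
      second leaves the term with the gradient of \<phi>. Summing over i produces the trace.\<close>
    have d: "det (\<chi> k. if k = i then U x else G x $ k) =
        \<phi> x * B (g x) $ i $ i * det (G x) + b (g x) $ i * det (\<chi> k. if k = i then \<Phi> x else G x $ k)" for x
      unfolding U_def
      using det_row_add[of i "\<lambda>_. \<phi> x *\<^sub>R (B (g x) $ i v* G x)" "\<lambda>_. (b (g x) $ i) *\<^sub>R \<Phi> x" "\<lambda>k. G x $ k"]
        det_row_mul[of i "\<phi> x" "\<lambda>_. B (g x) $ i v* G x" "\<lambda>k. G x $ k"]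
        det_row_mul[of i "b (g x) $ i" "\<lambda>_. \<Phi> x" "\<lambda>k. G x $ k"]
        det_replace_row_combination[of i "B (g x) $ i" "G x"]
      by (simp add: scalar_mult_eq_scaleR cong: if_cong)
    have "integral (cube r) (\<lambda>x. det (\<chi> k. if k = i then U x else G x $ k)) = 0"
      by (rule integral_det_replace_row[OF u _ g r]) (use supp in simp)
    then show ?thesis
      unfolding d by (subst (asm) integral_add) (auto intro!: integrable_cube continuous_intros cont)
  qed
  have "integral (cube r) (\<lambda>x. \<phi> x * trace (B (g x)) * det (G x)) =
     (\<Sum>i\<in>UNIV. integral (cube r) (\<lambda>x. \<phi> x * B (g x) $ i $ i * det (G x)))"
    unfolding trace_def sum_distrib_left sum_distrib_right
    by (rule integral_sum) (auto intro!: integrable_cube continuous_intros cont)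
  also have "\<dots> = (\<Sum>i\<in>UNIV. - integral (cube r) (\<lambda>x. b (g x) $ i * det (\<chi> k. if k = i then \<Phi> x else G x $ k)))"
    using 1 by (intro sum.cong) (auto simp: add_eq_0_iff2)
  also have "\<dots> = - integral (cube r) (\<lambda>x. \<Sum>i\<in>UNIV. b (g x) $ i * det (\<chi> k. if k = i then \<Phi> x else G x $ k))"
    unfolding sum_negf by (subst integral_sum) (auto intro!: integrable_cube continuous_intros cont)
  finally show ?thesis .
qed

section \<open>Oscillation on boundaries of cubes\<close>

lemma nn_integral_cube_eq:
  fixes h :: "real ^ 'n::finite \<Rightarrow> real"
  assumes "continuous_on UNIV h" "\<And>x. 0 \<le> h x"
  shows "(\<integral>\<^sup>+x. indicator (cube r) x * ennreal (h x) \<partial>lborel) = ennreal (integral (cube r) h)"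
proof -
  have "set_integrable lborel (cube r) h"
    unfolding set_integrable_def
    by (rule borel_integrable_compact) (use assms in \<open>auto intro: continuous_on_subset\<close>)
  from this set_borel_integral_eq_integral(2)[OF this] have "integrable lborel (\<lambda>x. indicator (cube r) x * h x)"
    and eq: "integral (cube r) h = (\<integral>x. indicator (cube r) x * h x \<partial>lborel)"
    by (auto simp: set_integrable_def set_lebesgue_integral_def)
  then have "(\<integral>\<^sup>+x. ennreal (indicator (cube r) x * h x) \<partial>lborel) = ennreal (integral (cube r) h)"
    unfolding eq using assms by (intro nn_integral_eq_integral) auto
  then show ?thesis by (simp add: ennreal_mult' ennreal_indicator)
qed

lemma nn_integral_lborel_diagonal:
  fixes c :: "'n::finite \<Rightarrow> real" and t :: "real ^ 'n"
  assumes c: "\<And>i. 0 < c i" and h: "h \<in> borel_measurable borel"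
  shows "(\<integral>\<^sup>+x. h x \<partial>lborel) = ennreal (\<Prod>i\<in>UNIV. c i) * (\<integral>\<^sup>+x. h (\<chi> i. t $ i + c i * x $ i) \<partial>lborel)"
proof -
  define c' where "c' b = (\<Sum>i\<in>UNIV. c i * b $ i)" for b :: "real ^ 'n"
  have c'_axis: "c' (axis i 1) = c i" for i
    unfolding c'_def axis_def by (simp add: if_distrib[of "(*) _"] cong: if_cong)
  define T where "T x = t + (\<Sum>j\<in>Basis. (c' j * (x \<bullet> j)) *\<^sub>R j)" for x :: "real ^ 'n"
  have sB: "(\<Sum>b\<in>Basis. f b) = (\<Sum>i\<in>(UNIV :: 'n set). f (axis i (1::real)))" for f :: "_ \<Rightarrow> real ^ 'n"
  proof -
    have eq: "(Basis :: (real^'n) set) = (\<lambda>i. axis i 1) ` UNIV" by (auto simp: Basis_vec_def)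
    show ?thesis unfolding eq by (subst sum.reindex) (auto simp: inj_on_def axis_eq_axis)
  qed
  have T: "T x = (\<chi> i. t $ i + c i * x $ i)" for x
  proof -
    have "(c i * x $ i) *\<^sub>R axis i (1::real) = axis i (c i * x $ i)" for i
      by (simp add: axis_def vec_eq_iff)
    then have "T x = t + (\<Sum>i\<in>UNIV. axis i (c i * x $ i))"
      unfolding T_def sB c'_axis by (simp add: inner_axis)
    also have "\<dots> = (\<chi> i. t $ i + c i * x $ i)"
      by (simp add: vec_eq_iff axis_def)
    finally show ?thesis .
  qed
  have "lborel = density (distr lborel borel T) (\<lambda>_. (\<Prod>j\<in>Basis. \<bar>c' j\<bar>))"
    unfolding T_def
    by (rule lborel_affine_euclidean) (use c in \<open>auto simp: Basis_vec_def c'_axis less_imp_neq[symmetric]\<close>)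
  also have "(\<Prod>j\<in>Basis. \<bar>c' j\<bar>) = (\<Prod>i\<in>UNIV. c i)"
    unfolding prod_Basis_cart c'_axis using c by (simp add: less_imp_le)
  finally have l: "lborel = density (distr lborel borel T) (\<lambda>_. ennreal (\<Prod>i\<in>UNIV. c i))" .
  have mT: "T \<in> borel \<rightarrow>\<^sub>M borel"
    unfolding T_def by (intro borel_measurable_continuous_onI continuous_intros)
  have "(\<integral>\<^sup>+x. h x \<partial>lborel) = ennreal (\<Prod>i\<in>UNIV. c i) * (\<integral>\<^sup>+x. h (T x) \<partial>lborel)"
    by (subst l) (use h mT in \<open>simp add: nn_integral_density nn_integral_distr nn_integral_cmult\<close>)
  then show ?thesis unfolding T .
qed

text \<open>The affine image of the cube lies in the cube again and \<open>H\<close> is nonnegative,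
  so integrating over the image only loses; the product of the \<open>c i\<close> is the
  Jacobian.\<close>

lemma integral_contraction_le:
  fixes H :: "real ^ 'n::finite \<Rightarrow> real"
  assumes c: "\<And>i. 0 < c i" and H: "continuous_on UNIV H" "\<And>x. 0 \<le> H x"
    and T: "\<And>x. x \<in> cube r \<Longrightarrow> (\<chi> i. t $ i + c i * x $ i) \<in> cube r"
  shows "(\<Prod>i\<in>UNIV. c i) * integral (cube r) (\<lambda>x. H (\<chi> i. t $ i + c i * x $ i)) \<le> integral (cube r) H"
proof -
  let ?T = "\<lambda>x. \<chi> i. t $ i + c i * x $ i"
  have mH: "(\<lambda>x. indicator (cube r) x * ennreal (H x)) \<in> borel_measurable borel"
  proof -
    have [measurable]: "H \<in> borel_measurable borel" "cube r \<in> sets (borel :: (real ^ 'n) measure)"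
      using borel_measurable_continuous_onI[OF H(1)] by (auto simp: borel_closed)
    show ?thesis by measurable
  qed
  have cHT: "continuous_on UNIV (\<lambda>x. H (?T x))"
    by (intro continuous_on_compose2[OF H(1)] continuous_intros) auto
  have p: "0 \<le> (\<Prod>i\<in>UNIV. c i)" using c by (intro prod_nonneg) (auto intro: less_imp_le)
  have "ennreal ((\<Prod>i\<in>UNIV. c i) * integral (cube r) (\<lambda>x. H (?T x))) =
      ennreal (\<Prod>i\<in>UNIV. c i) * (\<integral>\<^sup>+x. indicator (cube r) x * ennreal (H (?T x)) \<partial>lborel)"
    by (subst nn_integral_cube_eq[OF cHT]) (auto simp: H p ennreal_mult')
  also have "\<dots> \<le> ennreal (\<Prod>i\<in>UNIV. c i) * (\<integral>\<^sup>+x. indicator (cube r) (?T x) * ennreal (H (?T x)) \<partial>lborel)"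
    by (intro mult_left_mono nn_integral_mono mult_right_mono) (use T in \<open>auto simp: indicator_def\<close>)
  also have "\<dots> = (\<integral>\<^sup>+x. indicator (cube r) x * ennreal (H x) \<partial>lborel)"
    by (rule nn_integral_lborel_diagonal[OF c mH, symmetric])
  also have "\<dots> = ennreal (integral (cube r) H)" by (rule nn_integral_cube_eq[OF H])
  finally show ?thesis
    using H by (subst (asm) ennreal_le_iff) (auto intro!: integral_nonneg integrable_cube continuous_on_subset[OF H(1)])
qed

text \<open>The generality in \<open>P\<close> and \<open>p\<close> covers two uses:
  \<open>P\<close> projects onto a slice and p = n in the Morrey estimate, \<open>P\<close> is the
  identity and p = 1 for plain contractions of the cube.\<close>

lemma average_deriv:
  fixes u :: "real ^ 'n::finite \<Rightarrow> real"
  assumes u: "has_grad u U" and P: "continuous_on UNIV P" and t: "t \<in> {0..1}"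
  shows "((\<lambda>t. integral (cube r) (\<lambda>z. u (x + t ^ p *\<^sub>R (P z - x)))) has_field_derivative
     integral (cube r) (\<lambda>z. real p * t ^ (p - 1) * (U (x + t ^ p *\<^sub>R (P z - x)) \<bullet> (P z - x)))) (at t within {0..1})"
  unfolding cube_def
proof (rule leibniz_rule_field_derivative)
  fix t z
  have 1: "((\<lambda>t. x + t ^ p *\<^sub>R (P z - x)) has_derivative (\<lambda>h. (h * (real p * t ^ (p - 1))) *\<^sub>R (P z - x))) (at t within {0..1})"
    by (auto intro!: derivative_eq_intros simp: algebra_simps)
  show "((\<lambda>t. u (x + t ^ p *\<^sub>R (P z - x))) has_field_derivative real p * t ^ (p - 1) * (U (x + t ^ p *\<^sub>R (P z - x)) \<bullet> (P z - x))) (at t within {0..1})"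
    unfolding has_field_derivative_def
    by (rule has_derivative_eq_rhs[OF has_derivative_compose[OF 1 has_gradD[OF u]]]) (auto simp: fun_eq_iff)
next
  have cP: "continuous_on S P" for S using P by (rule continuous_on_subset) simp
  show "(\<lambda>z. u (x + t ^ p *\<^sub>R (P z - x))) integrable_on cbox (\<chi> i. - r) (\<chi> i. r)" for t
    by (intro integrable_continuous continuous_on_compose2[OF has_grad_cont[OF u, of UNIV]] continuous_intros cP) auto
  show "continuous_on ({0..1} \<times> cbox (\<chi> i. - r) (\<chi> i. r))
     (\<lambda>(t, z). real p * t ^ (p - 1) * (U (x + t ^ p *\<^sub>R (P z - x)) \<bullet> (P z - x)))"
    unfolding split_beta
    by (intro continuous_intros continuous_on_compose2[OF has_grad_cont_grad[OF u, of UNIV]]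
        continuous_on_compose2[OF P]) auto
qed (use t in auto)

lemma integral_cube_const:
  fixes r k :: real
  assumes "0 \<le> r"
  shows "integral (cube r) (\<lambda>x::real ^ 'n::finite. k) = (2 * r) ^ CARD('n) * k"
  using measure_cube[OF assms, where 'n='n] by (simp add: cube_def)

text \<open>Along the path \<open>x + t ^ n *\<^sub>R (P z - x)\<close> the derivative is split by Young's inequality with parameter
  \<open>l / t ^ (n - 1)\<close>, so that the power of \<open>t\<close> in front of the integral of \<open>G\<close> cancels the Jacobian of the
  contraction of the slice.\<close>

lemma slice_morrey:
  fixes u :: "real ^ 'n::finite \<Rightarrow> real" and r s l :: real
  assumes n: "CARD('n) \<ge> 2"
    and u: "has_grad u U" and G: "continuous_on UNIV G" and UG: "\<And>x. x \<in> cube r \<Longrightarrow> norm (U x) ^ CARD('n) \<le> G x"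
    and G0: "\<And>x. 0 \<le> G x"
    and x: "x \<in> cube r" "x $ j = s" and r: "0 < r" and l: "0 < l"
  defines "P \<equiv> \<lambda>z. \<chi> i. if i = j then s else z $ i"
  shows "\<bar>(2 * r) ^ CARD('n) * u x - integral (cube r) (\<lambda>z. u (P z))\<bar>
    \<le> 2 * (real CARD('n))\<^sup>2 * r * (l * (2 * r) ^ CARD('n) + (1 / l) ^ (CARD('n) - 1) * integral (cube r) (\<lambda>z. G (P z)))"
    (is "_ \<le> ?D")
proof -
  define n where "n = CARD('n)"
  define k where "k = n - 1"
  have nk: "n = Suc k" and k: "1 \<le> k" using n by (auto simp: n_def k_def)
  have s: "\<bar>s\<bar> \<le> r" using x by (auto simp: mem_cube)
  have P: "P z \<in> cube r" if "z \<in> cube r" for z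
    using that s by (auto simp: P_def mem_cube)
  have cP: "continuous_on S P" for S
    unfolding P_def
  proof (intro continuous_on_vec_lambda)
    fix i show "continuous_on S (\<lambda>z. if i = j then s else z $ i)"
      by (cases "i = j") (auto intro!: continuous_intros)
  qed
  define F where "F t = integral (cube r) (\<lambda>z. u (x + t ^ n *\<^sub>R (P z - x)))" for t
  define F' where "F' t = integral (cube r) (\<lambda>z. real n * t ^ k * (U (x + t ^ n *\<^sub>R (P z - x)) \<bullet> (P z - x)))" for t
  have der: "(F has_field_derivative F' t) (at t within {0..1})" if "t \<in> {0..1}" for t
    using average_deriv[OF u cP that, of r x n] unfolding F_def F'_def k_def .
  have cGP: "continuous_on S (\<lambda>z. G (P z))" for S
    by (intro continuous_on_compose2[OF G] cP) auto
  define S where "S = integral (cube r) (\<lambda>z. G (P z))"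
  have S0: "0 \<le> S" unfolding S_def by (intro integral_nonneg integrable_cube cGP) (auto simp: G0)
  define D where "D = 2 * (real n)\<^sup>2 * r * (l * (2 * r) ^ n + (1 / l) ^ k * S)"
  have D0: "0 \<le> D" using S0 r l by (simp add: D_def)
  have bound: "norm (F' t) \<le> D" if t: "t \<in> {0..1}" for t
  \<comment> \<open>At t = 0 the Young parameter is not defined, but the factor t ^ (n - 1) in the
    derivative vanishes because n \<ge> 2.\<close>
  proof (cases "t = 0")
    case True
    then show ?thesis using k D0 by (simp add: F'_def power_0_left)
  next
    case False
    then have t0: "0 < t" "t \<le> 1" using t by auto
    define y where "y z = x + t ^ n *\<^sub>R (P z - x)" for z
    \<comment> \<open>Coordinate j is left uncontracted, since on the slice it is frozen at s. Hence
      the Jacobian is (t ^ n) ^ (n - 1) and not (t ^ n) ^ n; this is the gain from working in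
      dimension n - 1.\<close>
    define c where "c i = (if i = j then 1 else t ^ n)" for i
    define v where "v = (\<chi> i. if i = j then 0 else (1 - t ^ n) * x $ i)"
    have tn: "0 \<le> t ^ n" "t ^ n \<le> 1" using t0 by (auto intro: power_le_one)
    have yT: "y z = P (\<chi> i. v $ i + c i * z $ i)" for z
      using x(2) by (auto simp: y_def P_def c_def v_def vec_eq_iff algebra_simps)
    have T: "(\<chi> i. v $ i + c i * z $ i) \<in> cube r" if "z \<in> cube r" for z
      unfolding mem_cube
    proof
      fix i
      have zi: "\<bar>z $ i\<bar> \<le> r" "\<bar>x $ i\<bar> \<le> r" using that x by (auto simp: mem_cube)
      have "\<bar>(1 - t ^ n) * x $ i + t ^ n * z $ i\<bar> \<le> \<bar>(1 - t ^ n) * x $ i\<bar> + \<bar>t ^ n * z $ i\<bar>"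
        by (rule abs_triangle_ineq)
      also have "\<dots> \<le> (1 - t ^ n) * r + t ^ n * r"
        unfolding abs_mult using tn zi by (intro add_mono mult_mono) auto
      also have "\<dots> = r" by (simp add: algebra_simps)
      finally have "\<bar>(1 - t ^ n) * x $ i + t ^ n * z $ i\<bar> \<le> r" .
      then show "\<bar>(\<chi> i. v $ i + c i * z $ i) $ i\<bar> \<le> r" using zi by (auto simp: v_def c_def)
    qed
    have yc: "y z \<in> cube r" if "z \<in> cube r" for z unfolding yT by (intro P T that)
    have cy: "continuous_on S y" for S unfolding y_def by (intro continuous_intros cP)
    have pc: "(\<Prod>i\<in>UNIV. c i) = (t ^ n) ^ k"
      unfolding c_def k_def n_def by (subst prod.remove[of _ j]) (auto simp: card_Diff_singleton)
    have "(t ^ n) ^ k * integral (cube r) (\<lambda>z. G (y z)) \<le> S"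
      unfolding S_def yT pc[symmetric]
      by (rule integral_contraction_le[of c "\<lambda>z. G (P z)" r v]) (use t0 cGP G0 T in \<open>auto simp: c_def\<close>)
    then have contr: "t ^ (n * k) * integral (cube r) (\<lambda>z. G (y z)) \<le> S" by (simp add: power_mult)
    have pt: "\<bar>real n * t ^ k * (U (y z) \<bullet> (P z - x))\<bar> \<le> 2 * (real n)\<^sup>2 * r * (l + (1 / l) ^ k * t ^ (n * k) * G (y z))"
      if z: "z \<in> cube r" for z
    proof -
      have "P z - x \<in> cube (2 * r)"
        unfolding mem_cube
      proof
        fix i have "\<bar>P z $ i\<bar> \<le> r" "\<bar>x $ i\<bar> \<le> r" using P[OF z] x by (auto simp: mem_cube)
        then show "\<bar>(P z - x) $ i\<bar> \<le> 2 * r" by simp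
      qed
      then have nP: "norm (P z - x) \<le> 2 * real n * r" using norm_cube[of "P z - x" "2 * r"] by (simp add: n_def)
      define m where "m = l / t ^ k"
      have m: "0 < m" using l t0 by (simp add: m_def)
      have "norm (U (y z)) \<le> m + (1 / m) ^ k * norm (U (y z)) ^ n"
        using le_young[of "norm (U (y z))" m k] m by (simp add: nk)
      also have "\<dots> \<le> m + (1 / m) ^ k * G (y z)"
        using UG[OF yc[OF z]] m by (intro add_left_mono mult_left_mono) (auto simp: n_def)
      finally have "t ^ k * norm (U (y z)) \<le> t ^ k * (m + (1 / m) ^ k * G (y z))"
        using t0 by (intro mult_left_mono) auto
      \<comment> \<open>The exponents add up to k + k * k = n * k, exactly the power of t that
        \<open>contr\<close> can absorb.\<close>
      also have "\<dots> = l + (1 / l) ^ k * t ^ (n * k) * G (y z)"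
      proof -
        have "(1 / m) ^ k = (1 / l) ^ k * t ^ (k * k)" by (simp add: m_def power_divide power_mult)
        then show ?thesis using t0 by (simp add: m_def nk algebra_simps power_add)
      qed
      finally have 1: "t ^ k * norm (U (y z)) \<le> l + (1 / l) ^ k * t ^ (n * k) * G (y z)" .
      have "\<bar>real n * t ^ k * (U (y z) \<bullet> (P z - x))\<bar> \<le> real n * t ^ k * (norm (U (y z)) * norm (P z - x))"
        using t0 by (simp add: abs_mult mult_left_mono Cauchy_Schwarz_ineq2)
      also have "\<dots> = (t ^ k * norm (U (y z))) * (real n * norm (P z - x))" by simp
      also have "\<dots> \<le> (l + (1 / l) ^ k * t ^ (n * k) * G (y z)) * (real n * (2 * real n * r))"
        using 1 nP l t0 G0 by (intro mult_mono mult_left_mono[OF nP]) auto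
      finally show ?thesis by (simp add: power2_eq_square mult_ac)
    qed
    have cUy: "continuous_on S (\<lambda>z. U (y z))" for S
      by (intro continuous_on_compose2[OF has_grad_cont_grad[OF u, of UNIV]] cy) auto
    have cGy: "continuous_on S (\<lambda>z. G (y z))" for S by (intro continuous_on_compose2[OF G] cy) auto
    have "norm (F' t) \<le> integral (cube r) (\<lambda>z. 2 * (real n)\<^sup>2 * r * (l + (1 / l) ^ k * t ^ (n * k) * G (y z)))"
      unfolding F'_def y_def[symmetric]
      by (rule integral_norm_bound_integral)
         (use pt in \<open>auto intro!: integrable_cube continuous_intros cUy cGy cP\<close>)
    also have "\<dots> = 2 * (real n)\<^sup>2 * r * (l * (2 * r) ^ n + (1 / l) ^ k * (t ^ (n * k) * integral (cube r) (\<lambda>z. G (y z))))"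
    proof -
      have "integral (cube r) (\<lambda>z. l + (1 / l) ^ k * t ^ (n * k) * G (y z)) =
        integral (cube r) (\<lambda>z::real^'n. l) + (1 / l) ^ k * t ^ (n * k) * integral (cube r) (\<lambda>z. G (y z))"
        by (subst integral_add) (auto intro!: integrable_cube continuous_intros cGy)
      then show ?thesis using integral_cube_const[of r l, where 'n='n] r by (simp add: n_def mult_ac)
    qed
    also have "\<dots> \<le> D"
      unfolding D_def using contr r l by (intro mult_left_mono add_left_mono) auto
    finally show ?thesis .
  qed
  have "norm (F 0 - F 1) \<le> D * norm (0 - 1 :: real)"
    by (rule field_differentiable_bound[of "{0..1}" F F' D]) (use der bound in auto)
  moreover have "F 0 = (2 * r) ^ n * u x" using r nk by (simp add: F_def integral_cube_const n_def)
  moreover have "F 1 = integral (cube r) (\<lambda>z. u (P z))" by (simp add: F_def)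
  ultimately show ?thesis by (simp add: D_def n_def k_def S_def)
qed

text \<open>Averaging over \<open>c\<close> the integral of \<open>G\<close> over the slice \<open>x $ j = \<sigma> c\<close>, which is written as an
  integral over the whole cube of a function that does not depend on the \<open>j\<close>-th coordinate.\<close>

lemma nn_integral_slices_le:
  fixes G :: "real ^ 'n::finite \<Rightarrow> real" and r \<sigma> :: real
  assumes G: "continuous_on UNIV G" and r: "0 < r" and sg: "\<bar>\<sigma>\<bar> = 1"
  shows "(\<integral>\<^sup>+c. indicator {r/2<..r} c * (\<integral>\<^sup>+z. indicator (cube r) z * ennreal (G (\<chi> i. if i = j then \<sigma> * c else z $ i)) \<partial>lborel) \<partial>lborel)
    \<le> ennreal (4 * r) * (\<integral>\<^sup>+z. indicator (cube r - cube (r/2)) z * ennreal (G z) \<partial>lborel)"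
proof -
  define e where "e = (axis j 1 :: real ^ 'n)"
  define A where "A = (cube r - cube (r/2) :: (real ^ 'n) set)"
  have [measurable]: "G \<in> borel_measurable borel" "cube r \<in> sets (borel :: (real ^ 'n) measure)" "A \<in> sets borel"
    using borel_measurable_continuous_onI[OF G] by (auto simp: A_def borel_closed)
  have [measurable]: "(\<lambda>z::real^'n. z $ j) \<in> borel_measurable borel"
    by (intro borel_measurable_continuous_onI continuous_intros)
  have sg2: "\<sigma> * (\<sigma> * a) = a" for a using sg by (auto simp: abs_if split: if_splits)
  have upd: "(\<chi> i. if i = j then \<sigma> * c else z $ i) = z + (\<sigma> * c - z $ j) *\<^sub>R e" for c z
    by (simp add: vec_eq_iff e_def axis_def)
  \<comment> \<open>After substituting c = \<sigma> (z_j + t), the evaluation point is z shifted by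
    t along \<open>e\<close>. The shifted point lies in the shell, and |t| \<le> 2 r because both
    j-th coordinates are at most r in absolute value. The length 4 r of this interval is the
    constant in the claim.\<close>
  have le: "indicator {r/2<..r} (\<sigma> * z $ j + \<sigma> * t) * (indicator (cube r) z * ennreal (G (z + t *\<^sub>R e)))
      \<le> indicator {-2*r..2*r} t * (indicator A (t *\<^sub>R e + z) * ennreal (G (t *\<^sub>R e + z)))" for t z
  proof -
    have "t \<in> {-2*r..2*r} \<and> t *\<^sub>R e + z \<in> A" if 1: "\<sigma> * z $ j + \<sigma> * t \<in> {r/2<..r}" and 2: "z \<in> cube r"
    proof -
      have zj: "\<bar>z $ j\<bar> \<le> r" using 2 by (auto simp: mem_cube)
      have "\<bar>\<sigma>\<bar> * \<bar>z $ j + t\<bar> = \<bar>\<sigma> * z $ j + \<sigma> * t\<bar>" by (simp add: abs_mult[symmetric] distrib_left)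
      with 1 r sg have ab: "r/2 < \<bar>z $ j + t\<bar>" "\<bar>z $ j + t\<bar> \<le> r" by auto
      have "t *\<^sub>R e + z \<in> cube r" unfolding mem_cube
        using ab 2 by (auto simp: e_def axis_def mem_cube add.commute)
      moreover have "t *\<^sub>R e + z \<notin> cube (r/2)" unfolding mem_cube
        using ab by (auto simp: e_def axis_def add.commute not_le intro!: exI[of _ j])
      ultimately show ?thesis using ab zj by (auto simp: A_def)
    qed
    then show ?thesis
      by (auto simp: indicator_def add.commute)
  qed
  have tr: "(\<integral>\<^sup>+z. (indicator A (t *\<^sub>R e + z) * ennreal (G (t *\<^sub>R e + z))) \<partial>lborel) = (\<integral>\<^sup>+z. (indicator A z * ennreal (G z)) \<partial>lborel)" for t
  proof -
    have "(\<integral>\<^sup>+z. (indicator A z * ennreal (G z)) \<partial>lborel) = (\<integral>\<^sup>+z. (indicator A z * ennreal (G z)) \<partial>distr lborel borel ((+) (t *\<^sub>R e)))"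
      by (simp add: lborel_distr_plus)
    also have "\<dots> = (\<integral>\<^sup>+z. (indicator A (t *\<^sub>R e + z) * ennreal (G (t *\<^sub>R e + z))) \<partial>lborel)"
      by (rule nn_integral_distr) measurable
    finally show ?thesis ..
  qed
  have "(\<integral>\<^sup>+c. indicator {r/2<..r} c * (\<integral>\<^sup>+z. indicator (cube r) z * ennreal (G (z + (\<sigma> * c - z $ j) *\<^sub>R e)) \<partial>lborel) \<partial>lborel)
    = (\<integral>\<^sup>+c. (\<integral>\<^sup>+z. indicator {r/2<..r} c * (indicator (cube r) z * ennreal (G (z + (\<sigma> * c - z $ j) *\<^sub>R e))) \<partial>lborel) \<partial>lborel)"
    by (intro nn_integral_cong nn_integral_cmult[symmetric]) measurable
  also have "\<dots> = (\<integral>\<^sup>+z. (\<integral>\<^sup>+c. indicator {r/2<..r} c * (indicator (cube r) z * ennreal (G (z + (\<sigma> * c - z $ j) *\<^sub>R e))) \<partial>lborel) \<partial>lborel)"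
    by (rule lborel_pair.Fubini') measurable
  also have "\<dots> = (\<integral>\<^sup>+z. (\<integral>\<^sup>+t. indicator {r/2<..r} (\<sigma> * z $ j + \<sigma> * t) * (indicator (cube r) z * ennreal (G (z + t *\<^sub>R e))) \<partial>lborel) \<partial>lborel)"
  proof (rule nn_integral_cong)
    fix z :: "real ^ 'n"
    have "\<sigma> \<noteq> 0" using sg by auto
    show "(\<integral>\<^sup>+c. indicator {r/2<..r} c * (indicator (cube r) z * ennreal (G (z + (\<sigma> * c - z $ j) *\<^sub>R e))) \<partial>lborel)
      = (\<integral>\<^sup>+t. indicator {r/2<..r} (\<sigma> * z $ j + \<sigma> * t) * (indicator (cube r) z * ennreal (G (z + t *\<^sub>R e))) \<partial>lborel)"
      by (subst nn_integral_real_affine[where c=\<sigma> and t="\<sigma> * z $ j"]) (measurable, use \<open>\<sigma> \<noteq> 0\<close> in \<open>simp_all add: sg sg2 distrib_left\<close>)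
  qed
  also have "\<dots> = (\<integral>\<^sup>+t. (\<integral>\<^sup>+z. indicator {r/2<..r} (\<sigma> * z $ j + \<sigma> * t) * (indicator (cube r) z * ennreal (G (z + t *\<^sub>R e))) \<partial>lborel) \<partial>lborel)"
    by (rule lborel_pair.Fubini') measurable
  also have "\<dots> \<le> (\<integral>\<^sup>+t. (\<integral>\<^sup>+z. indicator {-2*r..2*r} t * (indicator A (t *\<^sub>R e + z) * ennreal (G (t *\<^sub>R e + z))) \<partial>lborel) \<partial>lborel)"
    by (intro nn_integral_mono le)
  also have "\<dots> = (\<integral>\<^sup>+t. indicator {-2*r..2*r} t * (\<integral>\<^sup>+z. (indicator A (t *\<^sub>R e + z) * ennreal (G (t *\<^sub>R e + z))) \<partial>lborel) \<partial>(lborel :: real measure))"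
    by (intro nn_integral_cong nn_integral_cmult) measurable
  also have "\<dots> = (\<integral>\<^sup>+t. indicator {-2*r..2*r} t * (\<integral>\<^sup>+z. (indicator A z * ennreal (G z)) \<partial>lborel) \<partial>(lborel :: real measure))"
    unfolding tr ..
  also have "\<dots> = ennreal (4 * r) * (\<integral>\<^sup>+z. (indicator A z * ennreal (G z)) \<partial>lborel)"
    using r by (simp add: nn_integral_multc)
  finally show ?thesis unfolding upd A_def .
qed

text \<open>Chebyshev over all 2 n faces at once, so that a single c serves every face. If each c in
  an interval of length r / 2 had a face exceeding 32 n E, the faces would contribute at least 16 n
  r E in total, but they contribute at most 2 n * 4 r E.\<close>

lemma exists_good_slices:
  fixes G :: "real ^ 'n::finite \<Rightarrow> real" and r E :: real
  assumes G: "continuous_on UNIV G" "\<And>x. 0 \<le> G x" and r: "0 < r" and E: "0 < E"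
    and GE: "(\<integral>\<^sup>+z. indicator (cube r - cube (r/2)) z * ennreal (G z) \<partial>lborel) \<le> ennreal E"
  shows "\<exists>c\<in>{r/2<..r}. \<forall>j. \<forall>\<sigma>\<in>{1,-1}.
    integral (cube r) (\<lambda>z. G (\<chi> i. if i = j then \<sigma> * c else z $ i)) \<le> 32 * real CARD('n) * E"
proof (rule ccontr)
  assume neg: "\<not> ?thesis"
  define n where "n = real CARD('n)"
  have n: "0 < n" by (simp add: n_def)
  define I where "I j \<sigma> c = (\<integral>\<^sup>+z. indicator (cube r) z * ennreal (G (\<chi> i. if i = j then \<sigma> * c else z $ i)) \<partial>lborel)" for j and \<sigma> c :: real
  have cG: "continuous_on UNIV (\<lambda>z. G (\<chi> i. if i = j then s else z $ i))" for j and s :: real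
  proof (intro continuous_on_compose2[OF G(1)] continuous_on_vec_lambda)
    fix i show "continuous_on UNIV (\<lambda>z. if i = j then s else z $ i)"
      by (cases "i = j") (auto intro!: continuous_intros)
  qed auto
  have I: "I j \<sigma> c = ennreal (integral (cube r) (\<lambda>z. G (\<chi> i. if i = j then \<sigma> * c else z $ i)))" for j \<sigma> c
    unfolding I_def by (rule nn_integral_cube_eq[OF cG]) (rule G)
  have upd: "(\<chi> i. if i = j then \<sigma> * c else z $ i) = z + (\<sigma> * c - z $ j) *\<^sub>R axis j 1" for j \<sigma> c and z :: "real ^ 'n"
    by (simp add: vec_eq_iff axis_def)
  have [measurable]: "G \<in> borel_measurable borel" "cube r \<in> sets (borel :: (real ^ 'n) measure)"
    using borel_measurable_continuous_onI[OF G(1)] by (auto simp: borel_closed)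
  have [measurable]: "(\<lambda>z::real^'n. z $ j) \<in> borel_measurable borel" for j
    by (intro borel_measurable_continuous_onI continuous_intros)
  have [measurable]: "I j \<sigma> \<in> borel_measurable borel" for j \<sigma>
    unfolding I_def upd by measurable
  have ge: "ennreal (32 * n * E) \<le> (\<Sum>j\<in>UNIV. \<Sum>\<sigma>\<in>{1,-1}. I j \<sigma> c)" if c: "c \<in> {r/2<..r}" for c
  proof -
    have "\<not> (\<forall>j. \<forall>\<sigma>\<in>{1,-1}. integral (cube r) (\<lambda>z. G (\<chi> i. if i = j then \<sigma> * c else z $ i)) \<le> 32 * n * E)"
      using neg c unfolding n_def by blast
    then obtain j \<sigma> where j: "\<sigma> \<in> {1,-1}" "\<not> integral (cube r) (\<lambda>z. G (\<chi> i. if i = j then \<sigma> * c else z $ i)) \<le> 32 * n * E"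
      by blast
    have "ennreal (32 * n * E) \<le> I j \<sigma> c" unfolding I using j(2) by (intro ennreal_leI) linarith
    also have "\<dots> \<le> (\<Sum>\<sigma>\<in>{1,-1}. I j \<sigma> c)" using j by (intro member_le_sum) auto
    also have "\<dots> \<le> (\<Sum>j\<in>UNIV. \<Sum>\<sigma>\<in>{1,-1}. I j \<sigma> c)" by (rule member_le_sum) auto
    finally show ?thesis .
  qed
  have "ennreal (32 * n * E) * ennreal (r/2) = (\<integral>\<^sup>+c. indicator {r/2<..r} c * ennreal (32 * n * E) \<partial>lborel)"
    using r by (simp add: nn_integral_multc mult.commute)
  also have "\<dots> \<le> (\<integral>\<^sup>+c. indicator {r/2<..r} c * (\<Sum>j\<in>UNIV. \<Sum>\<sigma>\<in>{1,-1}. I j \<sigma> c) \<partial>lborel)"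
    using ge by (intro nn_integral_mono) (auto simp: indicator_def)
  also have "\<dots> = (\<Sum>j\<in>UNIV. \<Sum>\<sigma>\<in>{1,-1}. (\<integral>\<^sup>+c. indicator {r/2<..r} c * I j \<sigma> c \<partial>lborel))"
    unfolding sum_distrib_left by (subst nn_integral_sum, measurable)+
  also have "\<dots> \<le> (\<Sum>j\<in>(UNIV :: 'n set). \<Sum>\<sigma>\<in>{1,-1::real}. ennreal (4 * r) * ennreal E)"
  proof (intro sum_mono)
    fix j :: 'n and \<sigma> :: real assume "\<sigma> \<in> {1,-1}"
    then have "(\<integral>\<^sup>+c. indicator {r/2<..r} c * I j \<sigma> c \<partial>lborel) \<le> ennreal (4 * r) * (\<integral>\<^sup>+z. indicator (cube r - cube (r/2)) z * ennreal (G z) \<partial>lborel)"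
      unfolding I_def by (intro nn_integral_slices_le[OF G(1) r]) auto
    also have "\<dots> \<le> ennreal (4 * r) * ennreal E" by (intro mult_left_mono GE) auto
    finally show "(\<integral>\<^sup>+c. indicator {r/2<..r} c * I j \<sigma> c \<partial>lborel) \<le> ennreal (4 * r) * ennreal E" .
  qed
  also have "\<dots> = ennreal (n * 2 * (4 * r * E))"
    using r E n by (simp add: n_def ennreal_mult'[symmetric] ennreal_of_nat_eq_real_of_nat mult_ac flip: ennreal_numeral ennreal_mult'')
  finally have "32 * n * E * (r/2) \<le> n * 2 * (4 * r * E)"
    using r E n by (simp add: ennreal_mult'[symmetric])
  then show False using r E n by simp
qed

text \<open>Six times the one-face constant 2 n^2 (1 + 32 n): two points of one face differ by at
  most 2 such units, points of adjacent faces by 4, and passing through an adjacent face in between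
  costs 2 + 4. The term 32 n comes from the choice of good slices.\<close>

definition osc_const :: "nat \<Rightarrow> real" where
  "osc_const n = 12 * (real n)\<^sup>2 * (1 + 32 * real n)"

lemma osc_const_pos: "0 < n \<Longrightarrow> 0 < osc_const n" by (simp add: osc_const_def)

text \<open>The cube is chosen from the majorant \<open>G\<close> alone, before \<open>u\<close>, so
  that the same boundary works for all components of a map. Each point value on a face is compared
  with the mean over that face; faces are then chained through points common to adjacent
  ones.\<close>

lemma cube_boundary_osc:
  fixes G :: "real ^ 'n::finite \<Rightarrow> real" and r \<kappa> :: real
  assumes n: "CARD('n) \<ge> 2" and G: "continuous_on UNIV G" "\<And>x. 0 \<le> G x" and r: "0 < r" and k: "0 < \<kappa>"
    and GE: "(\<integral>\<^sup>+z. indicator (cube r - cube (r/2)) z * ennreal (G z) \<partial>lborel) \<le> ennreal (\<kappa> ^ CARD('n))"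
  shows "\<exists>c\<in>{r/2<..r}. \<forall>u U. has_grad u U \<longrightarrow> (\<forall>x\<in>cube r. norm (U x) ^ CARD('n) \<le> G x) \<longrightarrow>
    (\<forall>x\<in>cubeb c. \<forall>y\<in>cubeb c. \<bar>u x - u y\<bar> \<le> osc_const CARD('n) * \<kappa>)"
proof -
  obtain c where c: "c \<in> {r/2<..r}" and sl: "\<And>j \<sigma>. \<sigma> \<in> {1,-1} \<Longrightarrow>
    integral (cube r) (\<lambda>z. G (\<chi> i. if i = j then \<sigma> * c else z $ i)) \<le> 32 * real CARD('n) * \<kappa> ^ CARD('n)"
    using exists_good_slices[OF G r zero_less_power[OF k] GE] by blast
  have c0: "0 < c" using c r by auto
  define n where "n = real CARD('n)"
  define N where "N = CARD('n)"
  have nN: "n = real N" "2 \<le> N" using assms(1) by (auto simp: n_def N_def)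
  define D where "D = 2 * n\<^sup>2 * (1 + 32 * n) * \<kappa>"
  have D0: "0 \<le> D" using k by (simp add: D_def n_def)
  show ?thesis
  proof (intro bexI[OF _ c] allI impI ballI)
    fix u and U and x y :: "real ^ 'n"
    assume u: "has_grad u U" and UG: "\<forall>x\<in>cube r. norm (U x) ^ CARD('n) \<le> G x"
      and x: "x \<in> cubeb c" and y: "y \<in> cubeb c"
    have face: "\<bar>u p - u q\<bar> \<le> 2 * D" if "p \<in> cube c" "q \<in> cube c" "p $ j = \<sigma> * c" "q $ j = \<sigma> * c" "\<sigma> \<in> {1,-1}" for p q j \<sigma>
    proof -
      define I where "I = integral (cube r) (\<lambda>z. u (\<chi> i. if i = j then \<sigma> * c else z $ i))"
      have one: "\<bar>u p - I / (2 * r) ^ N\<bar> \<le> D" if p: "p \<in> cube c" "p $ j = \<sigma> * c" for p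
      proof -
        have pr: "p \<in> cube r" using p c cube_mono[of c r] by auto
        define S where "S = integral (cube r) (\<lambda>z. G (\<chi> i. if i = j then \<sigma> * c else z $ i))"
        have S: "S \<le> 32 * n * \<kappa> ^ N" unfolding S_def n_def N_def by (rule sl) fact
        \<comment> \<open>The Young parameter \<kappa> / r balances both terms: (r / \<kappa>) ^ (n
          - 1) times a slice energy of order \<kappa> ^ n is again of order \<kappa> r ^ (n -
          1).\<close>
        have "\<bar>(2 * r) ^ N * u p - I\<bar> \<le> 2 * n\<^sup>2 * r * ((\<kappa>/r) * (2 * r) ^ N + (1 / (\<kappa>/r)) ^ (N - 1) * S)"
          unfolding I_def n_def N_def S_def
          by (rule slice_morrey[OF assms(1) u G(1) _ G(2) pr p(2) r]) (use UG k r in auto)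
        also have "\<dots> \<le> 2 * n\<^sup>2 * r * ((\<kappa>/r) * (2 * r) ^ N + (1 / (\<kappa>/r)) ^ (N - 1) * (32 * n * \<kappa> ^ N))"
          using S r k by (intro mult_left_mono add_left_mono) auto
        also have "(1 / (\<kappa>/r)) ^ (N - 1) * (32 * n * \<kappa> ^ N) = 32 * n * (\<kappa> / r) * r ^ N"
        proof -
          obtain m where m: "N = Suc m" using nN by (cases N) auto
          show ?thesis using k r by (simp add: m power_divide field_simps)
        qed
        also have "2 * n\<^sup>2 * r * ((\<kappa>/r) * (2 * r) ^ N + 32 * n * (\<kappa> / r) * r ^ N) \<le>
           2 * n\<^sup>2 * r * ((\<kappa>/r) * (2 * r) ^ N + 32 * n * (\<kappa> / r) * (2 * r) ^ N)"
          using r k nN by (intro mult_left_mono add_left_mono power_mono) auto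
        also have "\<dots> = (2 * r) ^ N * D" using r by (simp add: D_def field_simps)
        finally have "\<bar>(2 * r) ^ N * u p - I\<bar> / (2 * r) ^ N \<le> D"
          using r by (simp add: divide_le_eq mult.commute)
        moreover have "\<bar>(2 * r) ^ N * u p - I\<bar> / (2 * r) ^ N = \<bar>u p - I / (2 * r) ^ N\<bar>"
        proof -
          have a: "0 < (2 * r) ^ N" using r by simp
          have "u p - I / (2 * r) ^ N = ((2 * r) ^ N * u p - I) / (2 * r) ^ N"
            using r by (simp add: field_simps)
          then show ?thesis by (simp only: abs_divide abs_of_pos[OF a])
        qed
        ultimately show ?thesis by simp
      qed
      from one[of p] one[of q] that(1-4) show ?thesis by linarith
    qed
    have bd: "\<exists>j \<sigma>. z \<in> cube c \<and> \<sigma> \<in> {1,-1} \<and> z $ j = \<sigma> * c" if "z \<in> cubeb c" for z :: "real ^ 'n"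
    proof -
      obtain j where j: "\<bar>z $ j\<bar> = c" "z \<in> cube c" using \<open>z \<in> cubeb c\<close> by (auto simp: cubeb_def)
      show ?thesis
        by (rule exI[of _ j], rule exI[of _ "if 0 \<le> z $ j then 1 else - 1"]) (use j in auto)
    qed
    have nb: "\<bar>u p - u q\<bar> \<le> 4 * D" if "p \<in> cube c" "q \<in> cube c" "p $ j = \<sigma> * c" "q $ i = \<tau> * c" "\<sigma> \<in> {1,-1}" "\<tau> \<in> {1,-1}" "i \<noteq> j" for p q i j \<sigma> \<tau>
    proof -
      define z where "z = (\<chi> l. if l = j then \<sigma> * c else if l = i then \<tau> * c else 0)"
      have "z \<in> cube c" using that c0 by (auto simp: z_def mem_cube)
      moreover have "z $ j = \<sigma> * c" "z $ i = \<tau> * c" using that by (auto simp: z_def)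
      ultimately have "\<bar>u p - u z\<bar> \<le> 2 * D" "\<bar>u z - u q\<bar> \<le> 2 * D"
        using face[of p z j \<sigma>] face[of z q i \<tau>] that by blast+
      then show ?thesis by linarith
    qed
    obtain j \<sigma> i \<tau> where xx: "x \<in> cube c" "\<sigma> \<in> {1,-1}" "x $ j = \<sigma> * c" and yy: "y \<in> cube c" "\<tau> \<in> {1,-1}" "y $ i = \<tau> * c"
      using bd[OF x] bd[OF y] by blast
    have "\<bar>u x - u y\<bar> \<le> 6 * D"
    proof (cases "i = j")
      case False
      then show ?thesis using nb[of x y j \<sigma> i \<tau>] xx yy D0 by fastforce
    next
      case True
      \<comment> \<open>Equal and opposite faces have the same index j; they are connected through a
        face in another direction l, which exists because n \<ge> 2.\<close>
      obtain l where l: "l \<noteq> j"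
      proof -
        have "(UNIV :: 'n set) \<noteq> {j}" using assms(1) by (metis card.empty card.insert empty_iff finite.emptyI not_less_eq_eq numeral_2_eq_2 order_refl)
        then show ?thesis using that by blast
      qed
      define z where "z = (\<chi> m. if m = l then 1 * c else if m = j then \<sigma> * c else 0)"
      have "z \<in> cube c" "z $ l = 1 * c" "z $ j = \<sigma> * c" using xx(2) c0 l by (auto simp: z_def mem_cube)
      then have "\<bar>u x - u z\<bar> \<le> 2 * D" "\<bar>u z - u y\<bar> \<le> 4 * D"
        using face[of x z j \<sigma>] nb[of z y l 1 i \<tau>] xx yy l True by blast+
      then show ?thesis by linarith
    qed
    then show "\<bar>u x - u y\<bar> \<le> osc_const CARD('n) * \<kappa>"
      by (simp add: D_def osc_const_def n_def mult_ac)
  qed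
qed

text \<open>Contracting the cube towards \<open>x\<close> changes the mean value of \<open>u k\<close> by at most a multiple of
  \<open>\<integral> |\<nabla> u k|\<close>; in the limit the mean value of \<open>u\<close> over the cube equals \<open>u x\<close>.\<close>

lemma constant_of_small_gradients:
  fixes u :: "nat \<Rightarrow> real ^ 'n::finite \<Rightarrow> real"
  assumes u: "\<And>k. has_grad (u k) (U k)" and lim: "uniform_limit (cube r) u v sequentially"
    and cv: "continuous_on (cube r) v"
    and U: "(\<lambda>k. integral (cube r) (\<lambda>x. norm (U k x))) \<longlonglongrightarrow> 0"
    and r: "0 < r" and x: "x \<in> cube r" and y: "y \<in> cube r"
  shows "v x = v y"
proof -
  define n where "n = CARD('n)"
  have seg: "x + t *\<^sub>R (z - x) \<in> cube r" if "x \<in> cube r" "z \<in> cube r" "0 \<le> t" "t \<le> 1" for x z :: "real ^ 'n" and t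
    using convexD_alt[OF convex_cube that] by (simp add: algebra_simps)
  \<comment> \<open>The bound for the derivative carries the factor (1 / t) ^ n, so t is kept fixed
    while k tends to infinity and is sent to 0 only afterwards, in \<open>val\<close>.\<close>
  have mean: "integral (cube r) (\<lambda>z. v (x + t *\<^sub>R (z - x))) = integral (cube r) v"
    if x: "x \<in> cube r" and t: "0 < t" "t \<le> 1" for x t
  proof -
    define F where "F k s = integral (cube r) (\<lambda>z. u k (x + s ^ 1 *\<^sub>R (z - x)))" for k s
    define F' where "F' k s = integral (cube r) (\<lambda>z. real 1 * s ^ (1 - 1) * (U k (x + s ^ 1 *\<^sub>R (z - x)) \<bullet> (z - x)))" for k s
    have der: "(F k has_field_derivative F' k s) (at s within {t..1})" if "s \<in> {t..1}" for k s
      unfolding F_def F'_def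
      by (rule DERIV_subset[OF average_deriv[OF u, where P="\<lambda>z. z" and t=s]]) (use that t in auto)
    define \<epsilon> where "\<epsilon> k = integral (cube r) (\<lambda>x. norm (U k x))" for k
    have bound: "norm (F' k s) \<le> (1 / t) ^ n * (2 * real n * r) * \<epsilon> k" if s: "s \<in> {t..1}" for k s
    proof -
      have s0: "0 < s" "s \<le> 1" "t \<le> s" using s t by auto
      have cU: "continuous_on S (U k)" for S by (rule has_grad_cont_grad[OF u])
      have cU': "continuous_on S (\<lambda>z. U k (x + s *\<^sub>R (z - x)))" for S
        by (intro continuous_on_compose2[OF cU[of UNIV]] continuous_intros) auto
      have "norm (F' k s) \<le> integral (cube r) (\<lambda>z. (2 * real n * r) * norm (U k (x + s *\<^sub>R (z - x))))"
        unfolding F'_def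
      proof (rule integral_norm_bound_integral)
        fix z :: "real ^ 'n" assume z: "z \<in> cube r"
        have "z - x \<in> cube (2 * r)"
          unfolding mem_cube
        proof
          fix i have "\<bar>z $ i\<bar> \<le> r" "\<bar>x $ i\<bar> \<le> r" using z x by (auto simp: mem_cube)
          then show "\<bar>(z - x) $ i\<bar> \<le> 2 * r" by simp
        qed
        then have "norm (z - x) \<le> 2 * real n * r" using norm_cube[of "z - x" "2 * r"] by (simp add: n_def)
        then have "norm (U k (x + s *\<^sub>R (z - x))) * norm (z - x) \<le> norm (U k (x + s *\<^sub>R (z - x))) * (2 * real n * r)"
          by (intro mult_left_mono) auto
        then show "norm (real 1 * s ^ (1 - 1) * (U k (x + s ^ 1 *\<^sub>R (z - x)) \<bullet> (z - x))) \<le> 2 * real n * r * norm (U k (x + s *\<^sub>R (z - x)))"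
          using Cauchy_Schwarz_ineq2[of "U k (x + s *\<^sub>R (z - x))" "z - x"] by (simp add: mult_ac)
      qed (auto intro!: integrable_cube continuous_intros cU' continuous_on_subset[OF cU'])
      also have "\<dots> = (2 * real n * r) * integral (cube r) (\<lambda>z. norm (U k (x + s *\<^sub>R (z - x))))" by simp
      also have "\<dots> \<le> (2 * real n * r) * ((1 / t) ^ n * \<epsilon> k)"
      proof (intro mult_left_mono)
        have yT: "x + s *\<^sub>R (z - x) = (\<chi> i. ((1 - s) *\<^sub>R x) $ i + s * z $ i)" for z :: "real ^ 'n"
          by (simp add: vec_eq_iff algebra_simps)
        have "(\<Prod>i\<in>(UNIV :: 'n set). s) * integral (cube r) (\<lambda>z. norm (U k (x + s *\<^sub>R (z - x)))) \<le> \<epsilon> k"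
          unfolding yT \<epsilon>_def
        proof (rule integral_contraction_le)
          show "(\<chi> i. ((1 - s) *\<^sub>R x) $ i + s * z $ i) \<in> cube r" if "z \<in> cube r" for z
            using seg[OF x that, of s] s0 unfolding yT by auto
        qed (use s0 in \<open>auto intro!: continuous_intros cU\<close>)
        then have 1: "s ^ n * integral (cube r) (\<lambda>z. norm (U k (x + s *\<^sub>R (z - x)))) \<le> \<epsilon> k" by (simp add: n_def)
        have i0: "0 \<le> integral (cube r) (\<lambda>z. norm (U k (x + s *\<^sub>R (z - x))))"
          by (intro integral_nonneg integrable_cube continuous_intros cU') auto
        have "t ^ n * integral (cube r) (\<lambda>z. norm (U k (x + s *\<^sub>R (z - x)))) \<le> s ^ n * integral (cube r) (\<lambda>z. norm (U k (x + s *\<^sub>R (z - x))))"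
          using s0 t i0 by (intro mult_right_mono power_mono) auto
        with 1 have "t ^ n * integral (cube r) (\<lambda>z. norm (U k (x + s *\<^sub>R (z - x)))) \<le> \<epsilon> k" by simp
        then show "integral (cube r) (\<lambda>z. norm (U k (x + s *\<^sub>R (z - x)))) \<le> (1 / t) ^ n * \<epsilon> k"
          using t by (simp add: power_divide field_simps)
      qed (use r in auto)
      finally show ?thesis by (simp add: mult_ac)
    qed
    have diff: "norm (F k t - F k 1) \<le> (1 / t) ^ n * (2 * real n * r) * \<epsilon> k * norm (t - 1)" for k
      by (rule field_differentiable_bound[of "{t..1}" "F k" "F' k"]) (use der bound t in auto)
    have Flim: "(\<lambda>k. F k s) \<longlonglongrightarrow> integral (cube r) (\<lambda>z. v (x + s *\<^sub>R (z - x)))" if s: "0 < s" "s \<le> 1" for s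
    proof -
      have "uniform_limit (cube r) (\<lambda>k z. u k (x + s *\<^sub>R (z - x))) (\<lambda>z. v (x + s *\<^sub>R (z - x))) sequentially"
        by (rule uniform_limit_compose'[OF lim]) (use seg[OF x] s in auto)
      then obtain I J where IJ: "\<And>k. ((\<lambda>z. u k (x + s *\<^sub>R (z - x))) has_integral I k) (cube r)"
        "((\<lambda>z. v (x + s *\<^sub>R (z - x))) has_integral J) (cube r)" "I \<longlonglongrightarrow> J"
        unfolding cube_def
      proof (rule uniform_limit_integral_cbox)
        show "continuous_on (cbox (\<chi> i. - r) (\<chi> i. r)) (\<lambda>z. u k (x + s *\<^sub>R (z - x)))" for k
          by (intro continuous_on_compose2[OF has_grad_cont[OF u, of UNIV]] continuous_intros) auto
      qed auto
      have "(\<lambda>k. F k s) = I" unfolding F_def using integral_unique[OF IJ(1)] by (simp add: fun_eq_iff)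
      then show ?thesis using IJ(3) integral_unique[OF IJ(2)] by simp
    qed
    have "(\<lambda>k. F k t - F k 1) \<longlonglongrightarrow> integral (cube r) (\<lambda>z. v (x + t *\<^sub>R (z - x))) - integral (cube r) (\<lambda>z. v (x + 1 *\<^sub>R (z - x)))"
      by (intro tendsto_diff Flim t) auto
    moreover have "(\<lambda>k. F k t - F k 1) \<longlonglongrightarrow> 0"
    proof (rule Lim_null_comparison)
      show "\<forall>\<^sub>F k in sequentially. norm (F k t - F k 1) \<le> (1 / t) ^ n * (2 * real n * r) * \<epsilon> k * norm (t - 1)"
        using diff by simp
      show "(\<lambda>k. (1 / t) ^ n * (2 * real n * r) * \<epsilon> k * norm (t - 1)) \<longlonglongrightarrow> 0"
        using U unfolding \<epsilon>_def by (intro tendsto_eq_intros) auto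
    qed
    ultimately show ?thesis using LIMSEQ_unique by fastforce
  qed
  have val: "(2 * r) ^ n * v x = integral (cube r) v" if x: "x \<in> cube r" for x
  proof -
    define t where "t k = 1 / real (Suc k)" for k
    have t: "0 < t k" "t k \<le> 1" for k by (auto simp: t_def)
    have t0: "t \<longlonglongrightarrow> 0" unfolding t_def by (rule LIMSEQ_inverse_real_of_nat[unfolded inverse_eq_divide])
    have "uniform_limit (cube r) (\<lambda>k z. v (x + t k *\<^sub>R (z - x))) (\<lambda>z. v x) sequentially"
    proof (rule uniform_limitI)
      fix e :: real assume "e > 0"
      have "uniformly_continuous_on (cube r) v" by (rule compact_uniformly_continuous[OF cv]) simp
      then obtain d where d: "d > 0" "\<And>a b. a \<in> cube r \<Longrightarrow> b \<in> cube r \<Longrightarrow> dist a b < d \<Longrightarrow> dist (v a) (v b) < e"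
        unfolding uniformly_continuous_on_def using \<open>e > 0\<close> by metis
      have "bounded (cube r :: (real ^ 'n) set)" by (simp add: compact_imp_bounded)
      then obtain B where B: "0 < B" "\<And>z. z \<in> cube r \<Longrightarrow> norm (z :: real ^ 'n) \<le> B" by (metis bounded_pos)
      have "(\<lambda>k. t k * (2 * B)) \<longlonglongrightarrow> 0" using t0 by (intro tendsto_eq_intros) auto
      then have "\<forall>\<^sub>F k in sequentially. t k * (2 * B) < d" by (rule order_tendstoD) fact
      then show "\<forall>\<^sub>F k in sequentially. \<forall>z\<in>cube r. dist (v (x + t k *\<^sub>R (z - x))) (v x) < e"
      proof eventually_elim
        case (elim k)
        show ?case
        proof
          fix z :: "real ^ 'n" assume z: "z \<in> cube r"
          have "dist (x + t k *\<^sub>R (z - x)) x = t k * norm (z - x)" using t[of k] by (simp add: dist_norm)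
          also have "\<dots> \<le> t k * (2 * B)"
            using norm_triangle_ineq4[of z x] B(2)[OF z] B(2)[OF x] t[of k] by (intro mult_left_mono) auto
          also have "\<dots> < d" by fact
          finally show "dist (v (x + t k *\<^sub>R (z - x))) (v x) < e"
            using seg[OF x z, of "t k"] t[of k] by (intro d x) auto
        qed
      qed
    qed
    then obtain I J where IJ: "\<And>k. ((\<lambda>z. v (x + t k *\<^sub>R (z - x))) has_integral I k) (cube r)"
        "((\<lambda>z::real^'n. v x) has_integral J) (cube r)" "I \<longlonglongrightarrow> J"
      unfolding cube_def
    proof (rule uniform_limit_integral_cbox)
      show "continuous_on (cbox (\<chi> i. - r) (\<chi> i. r)) (\<lambda>z. v (x + t k *\<^sub>R (z - x)))" for k
        by (rule continuous_on_compose2[OF cv]) (use seg[OF x] t[of k] in \<open>auto simp: cube_def intro!: continuous_intros\<close>)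
    qed auto
    have "I = (\<lambda>k. integral (cube r) v)"
      using mean[OF x t] integral_unique[OF IJ(1)] by (simp add: fun_eq_iff)
    with IJ(3) have "J = integral (cube r) v" by (simp add: LIMSEQ_const_iff)
    then show ?thesis using integral_unique[OF IJ(2)] integral_cube_const[of r "v x", where 'n='n] r by (simp add: n_def)
  qed
  have "(2 * r) ^ n * v x = (2 * r) ^ n * v y" using val x y by simp
  then show ?thesis using r by simp
qed

section \<open>Degree-type identities\<close>

lemma norm_vector_matrix_le:
  fixes A :: "real ^ 'n ^ 'm"
  shows "norm (v v* A) \<le> norm v * norm A"
proof -
  have "(norm (v v* A))\<^sup>2 = v \<bullet> (A *v (v v* A))"
    by (simp add: power2_norm_eq_inner dot_lmul_matrix)
  also have "\<dots> \<le> norm v * norm (A *v (v v* A))" by (rule norm_cauchy_schwarz)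
  also have "\<dots> \<le> norm v * (norm A * norm (v v* A))"
    by (intro mult_left_mono norm_matrix_vector_le) auto
  finally have "norm (v v* A) * norm (v v* A) \<le> (norm v * norm A) * norm (v v* A)"
    by (simp add: power2_eq_square mult_ac)
  then show ?thesis by (cases "norm (v v* A) = 0") (auto simp: mult_le_cancel_right)
qed

text \<open>The constant part \<open>v\<close> serves the transport of a bump whose centre moves;
  the maximum principle and the logarithmic field take \<open>v = 0\<close> and
  \<open>a = 1\<close>. The argument of \<eta> is a squared norm, hence nonnegative, and smooth at
  the centre.\<close>

lemma radial_field:
  fixes v b :: "real ^ 'n::finite"
  assumes e: "\<And>t. 0 \<le> t \<Longrightarrow> (\<eta> has_real_derivative \<eta>' t) (at t)" "continuous_on {0..} \<eta>'"
  shows "\<exists>B. C1_map (\<lambda>y. \<eta> ((norm (y - b))\<^sup>2) *\<^sub>R (v + a *\<^sub>R (y - b))) B \<and>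
    (\<forall>y. trace (B y) = real CARD('n) * a * \<eta> ((norm (y - b))\<^sup>2)
      + 2 * \<eta>' ((norm (y - b))\<^sup>2) * ((y - b) \<bullet> (v + a *\<^sub>R (y - b))))"
proof -
  define q where "q y = (norm (y - b))\<^sup>2" for y
  define B where "B y = (\<chi> i. \<eta> (q y) *\<^sub>R (0 + a *\<^sub>R (axis i 1 - 0))
      + (v $ i + a * (y $ i - b $ i)) *\<^sub>R (\<eta>' (q y) *\<^sub>R 2 *\<^sub>R (y - b)))" for y
  have "C1_map (\<lambda>y. \<eta> (q y) *\<^sub>R (v + a *\<^sub>R (y - b))) B"
    unfolding C1_map_def
  proof
    fix i
    have "has_grad (\<lambda>y. \<eta> (q y) * (v $ i + a * (y $ i - b $ i)))
      (\<lambda>y. \<eta> (q y) *\<^sub>R (0 + a *\<^sub>R (axis i 1 - 0)) + (v $ i + a * (y $ i - b $ i)) *\<^sub>R (\<eta>' (q y) *\<^sub>R 2 *\<^sub>R (y - b)))"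
      unfolding q_def
      by (intro has_grad_mult has_grad_add has_grad_cmult has_grad_diff has_grad_const has_grad_coord
          has_grad_compose_on[of "{0..}", OF e] has_grad_norm2) auto
    then show "has_grad (\<lambda>y. (\<eta> (q y) *\<^sub>R (v + a *\<^sub>R (y - b))) $ i) (\<lambda>y. B y $ i)"
      by (simp add: B_def)
  qed
  moreover have "trace (B y) = real CARD('n) * a * \<eta> (q y) + 2 * \<eta>' (q y) * ((y - b) \<bullet> (v + a *\<^sub>R (y - b)))" for y
  proof -
    have "trace (B y) = (\<Sum>i\<in>UNIV. \<eta> (q y) * a + 2 * \<eta>' (q y) * ((y - b) $ i * (v + a *\<^sub>R (y - b)) $ i))"
      unfolding trace_def B_def by (intro sum.cong) (auto simp: axis_def algebra_simps)
    also have "\<dots> = real CARD('n) * a * \<eta> (q y) + 2 * \<eta>' (q y) * ((y - b) \<bullet> (v + a *\<^sub>R (y - b)))"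
      unfolding inner_vec_def by (simp add: sum.distrib sum_distrib_left)
    finally show ?thesis .
  qed
  ultimately show ?thesis unfolding q_def by blast
qed

text \<open>Divergence theorem with boundary values zero: a cutoff equal to 1 on
  \<open>cube a\<close> can be inserted for free, and in the remaining term either the gradient of
  the cutoff or the pulled-back field is 0 at every point.\<close>

lemma integral_divergence_collar:
  fixes g :: "real ^ 'n::finite \<Rightarrow> real ^ 'n"
  assumes b: "C1_map b B" and g: "C1_map g G" and a: "0 \<le> a" "a < c"
    and z: "\<And>x. x \<in> cube c \<Longrightarrow> x \<notin> cube a \<Longrightarrow> b (g x) = 0 \<and> trace (B (g x)) = 0"
  shows "integral (cube c) (\<lambda>x. trace (B (g x)) * det (G x)) = 0"
proof -
  obtain \<Phi> where \<Phi>: "has_grad (cut a c :: real ^ 'n \<Rightarrow> real) \<Phi>" using cut_grad by blast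
  have \<Phi>0: "\<Phi> x = 0" if "x \<in> cube a" for x
    using has_grad_eq_0_max[OF \<Phi>, of x] cut_eq_1[OF a(1) that, of c] by (simp add: cut_le_1)
  have "integral (cube c) (\<lambda>x. trace (B (g x)) * det (G x)) = integral (cube c) (\<lambda>x. cut a c x * trace (B (g x)) * det (G x))"
  proof (rule integral_cong)
    fix x :: "real ^ 'n" assume "x \<in> cube c"
    then show "trace (B (g x)) * det (G x) = cut a c x * trace (B (g x)) * det (G x)"
      using z[of x] cut_eq_1[OF a(1), of x c] by (cases "x \<in> cube a") auto
  qed
  also have "\<dots> = - integral (cube c) (\<lambda>x. \<Sum>i\<in>UNIV. b (g x) $ i * det (\<chi> k. if k = i then \<Phi> x else G x $ k))"
    by (rule integral_pullback_divergence[OF b \<Phi> _ g]) (use a cut_eq_0[OF a] in auto)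
  also have "integral (cube c) (\<lambda>x. \<Sum>i\<in>UNIV. b (g x) $ i * det (\<chi> k. if k = i then \<Phi> x else G x $ k)) = integral (cube c) (\<lambda>x::real^'n. 0)"
  proof (rule integral_cong)
    fix x :: "real ^ 'n" assume x: "x \<in> cube c"
    show "(\<Sum>i\<in>UNIV. b (g x) $ i * det (\<chi> k. if k = i then \<Phi> x else G x $ k)) = 0"
    proof (cases "x \<in> cube a")
      case True
      have "det (\<chi> k. if k = i then \<Phi> x else G x $ k) = 0" for i
        by (rule det_zero_row(1)[of i]) (simp add: row_def \<Phi>0[OF True] vec_eq_iff)
      then show ?thesis by simp
    qed (use z[OF x] in simp)
  qed
  finally show ?thesis by simp
qed

text \<open>If \<open>g\<close> omits \<open>y0\<close>, transport the bump on the ball of radius \<open>M\<close> to a small bump around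
  \<open>y0\<close>; the integral of its pull-back does not change along the way.\<close>

lemma integral_bump_eq_0_of_omitted:
  fixes g :: "real ^ 'n::finite \<Rightarrow> real ^ 'n"
  assumes g: "C1_map g G" and a: "0 \<le> a" "a < c"
    and M: "\<And>x. x \<in> cube c \<Longrightarrow> x \<notin> cube a \<Longrightarrow> M \<le> norm (g x)"
    and y0: "norm y0 < M" "y0 \<notin> g ` cube c"
  shows "integral (cube c) (\<lambda>x. sqp (M\<^sup>2 - (norm (g x))\<^sup>2) * det (G x)) = 0"
proof -
  define N where "N = CARD('n)"
  have M0: "0 < M" using y0 by (meson le_less_trans norm_ge_zero)
  have cg: "continuous_on S g" for S by (rule C1_map_cont[OF g])
  have cG: "continuous_on S G" for S by (rule C1_map_cont_deriv[OF g])
  have "closed (g ` cube c)"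
    by (intro compact_imp_closed compact_continuous_image cg) auto
  then have "open (- (g ` cube c))" by (rule open_Compl)
  with y0 obtain d where d: "0 < d" "ball y0 d \<subseteq> - (g ` cube c)"
    by (meson ComplI open_contains_ball)
  \<comment> \<open>The bound by d makes the final bump around y0 miss the image of g. The bound by
    M - |y0| keeps every intermediate ball, of radius \<open>t s\<close> about s y0, inside the ball
    of radius M, so that all bumps vanish on the collar.\<close>
  define t1 where "t1 = min d (M - norm y0)"
  have t1: "0 < t1" "t1 \<le> d" "t1 + norm y0 \<le> M" using d y0 by (auto simp: t1_def)
  define t where "t s = (1 - s) * M + s * t1" for s
  have t_pos: "0 < t s" if "s \<in> {0..1}" for s
  proof -
    have "0 < min M t1" using M0 t1 by simp
    also have "\<dots> = (1 - s) * min M t1 + s * min M t1" by (simp add: algebra_simps)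
    also have "\<dots> \<le> t s" unfolding t_def using that by (intro add_mono mult_left_mono) auto
    finally show ?thesis .
  qed
  define l where "l s = 1 / t s" for s
  define t' where "t' = t1 - M"
  have dl: "(l has_field_derivative - t' * (l s)\<^sup>2) (at s within {0..1})" if "s \<in> {0..1}" for s
    unfolding l_def t_def[abs_def] t'_def using t_pos[OF that, unfolded t_def]
    by (auto intro!: derivative_eq_intros simp: power2_eq_square divide_simps)
  define z where "z s x = g x - s *\<^sub>R y0" for s x
  \<comment> \<open>A bump of radius \<open>t s\<close> about s y0, evaluated at g x; the factor l ^
    N conserves its mass. It is carried along by the velocity y0 + (t' / t) z, so by the continuity
    equation its derivative in s is minus the divergence of bump times velocity, which is
    \<open>dv\<close>.\<close>
  define h where "h s x = l s ^ N * sqp (1 - (l s)\<^sup>2 * (norm (z s x))\<^sup>2)" for s x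
  define dv where "dv s x = real N * (t' * l s) * (l s ^ N * sqp (1 - (l s)\<^sup>2 * (norm (z s x))\<^sup>2))
     + 2 * (l s ^ N * (2 * max 0 (1 - (l s)\<^sup>2 * (norm (z s x))\<^sup>2) * (- (l s)\<^sup>2))) * (z s x \<bullet> (y0 + (t' * l s) *\<^sub>R z s x))" for s x
  have far: "1 - (l s)\<^sup>2 * (norm (z s x))\<^sup>2 \<le> 0" if s: "s \<in> {0..1}" and x: "x \<in> cube c" "x \<notin> cube a" for s x
  proof -
    have "t s \<le> M - s * norm y0"
    proof -
      have "s * t1 \<le> s * (M - norm y0)" using t1 s by (intro mult_left_mono) auto
      then show ?thesis by (simp add: t_def algebra_simps)
    qed
    also have "\<dots> \<le> norm (g x) - norm (s *\<^sub>R y0)" using M[OF x] s by simp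
    also have "\<dots> \<le> norm (z s x)" unfolding z_def by (rule norm_triangle_ineq2)
    finally have "1 \<le> l s * norm (z s x)" using t_pos[OF s] by (simp add: l_def field_simps)
    then have "1 \<le> (l s * norm (z s x))\<^sup>2" by simp
    then show ?thesis by (simp add: power_mult_distrib)
  qed
  have z0: "integral (cube c) (\<lambda>x. dv s x * det (G x)) = 0" if s: "s \<in> {0..1}" for s
  proof -
    define \<eta> where "\<eta> q = l s ^ N * sqp (1 - (l s)\<^sup>2 * q)" for q
    define \<eta>' where "\<eta>' q = l s ^ N * (2 * max 0 (1 - (l s)\<^sup>2 * q) * (- (l s)\<^sup>2))" for q
    have 1: "(\<eta> has_real_derivative \<eta>' q) (at q)" for q
      unfolding \<eta>_def[abs_def] \<eta>'_def
      by (intro DERIV_cmult DERIV_chain2[OF sqp_deriv]) (auto intro!: derivative_eq_intros)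
    have 2: "continuous_on UNIV \<eta>'" unfolding \<eta>'_def by (intro continuous_intros)
    obtain B where B: "C1_map (\<lambda>y. \<eta> ((norm (y - s *\<^sub>R y0))\<^sup>2) *\<^sub>R (y0 + (t' * l s) *\<^sub>R (y - s *\<^sub>R y0))) B"
      and tr: "\<And>y. trace (B y) = real CARD('n) * (t' * l s) * \<eta> ((norm (y - s *\<^sub>R y0))\<^sup>2)
      + 2 * \<eta>' ((norm (y - s *\<^sub>R y0))\<^sup>2) * ((y - s *\<^sub>R y0) \<bullet> (y0 + (t' * l s) *\<^sub>R (y - s *\<^sub>R y0)))"
      using radial_field[OF 1 continuous_on_subset[OF 2]] by blast
    have dv: "dv s x = trace (B (g x))" for x
      unfolding tr dv_def \<eta>_def \<eta>'_def z_def N_def by simp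
    show ?thesis unfolding dv
    proof (rule integral_divergence_collar[OF B g a])
      fix x :: "real ^ 'n" assume "x \<in> cube c" "x \<notin> cube a"
      from far[OF s this] show "\<eta> ((norm (g x - s *\<^sub>R y0))\<^sup>2) *\<^sub>R (y0 + (t' * l s) *\<^sub>R (g x - s *\<^sub>R y0)) = 0 \<and> trace (B (g x)) = 0"
        unfolding tr by (simp add: \<eta>_def \<eta>'_def z_def)
    qed
  qed
  define F where "F s = integral (cube c) (\<lambda>x. h s x * det (G x))" for s
  have cl: "continuous_on {0..1} l"
    by (rule DERIV_continuous_on[OF dl])
  have cl2: "continuous_on ({0..1} \<times> S) (\<lambda>p. l (fst p))" for S :: "(real ^ 'n) set"
    by (rule continuous_on_compose2[OF cl]) (auto intro!: continuous_intros)
  have cg2: "continuous_on S (\<lambda>p. g (snd p))" "continuous_on S (\<lambda>p. G (snd p))" for S :: "(real \<times> (real ^ 'n)) set"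
    by (rule continuous_on_compose2[OF cg[of UNIV]] continuous_on_compose2[OF cG[of UNIV]]; auto intro!: continuous_intros)+
  have csqp: "continuous_on S (\<lambda>x. sqp (w x))" if "continuous_on S w" for S :: "'z::topological_space set" and w
    unfolding sqp_def by (intro continuous_intros that)
  have dF: "(F has_field_derivative integral (cube c) (\<lambda>x. - (dv s x * det (G x)))) (at s within {0..1})" if s: "s \<in> {0..1}" for s
    unfolding F_def cube_def
  proof (rule leibniz_rule_field_derivative[OF _ _ _ s])
    fix s :: real and x :: "real ^ 'n" assume s: "s \<in> {0..1}"
    define q where "q s = (norm (z s x))\<^sup>2" for s
    have dq: "(q has_field_derivative - 2 * (z s x \<bullet> y0)) (at s within {0..1})"
      unfolding q_def z_def power2_norm_eq_inner has_field_derivative_def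
      by (auto intro!: derivative_eq_intros simp: fun_eq_iff inner_commute algebra_simps)
    have dl': "(l has_field_derivative - t' * (l s)\<^sup>2) (at s within {0..1})" using dl s by simp
    have d1: "((\<lambda>s. 1 - (l s)\<^sup>2 * q s) has_field_derivative 2 * t' * l s ^ 3 * q s + 2 * (l s)\<^sup>2 * (z s x \<bullet> y0)) (at s within {0..1})"
      by (rule derivative_eq_intros dl' dq refl | simp)+ (simp add: algebra_simps power2_eq_square power3_eq_cube)
    have d2: "((\<lambda>s. sqp (1 - (l s)\<^sup>2 * q s)) has_field_derivative
       2 * max 0 (1 - (l s)\<^sup>2 * q s) * (2 * t' * l s ^ 3 * q s + 2 * (l s)\<^sup>2 * (z s x \<bullet> y0))) (at s within {0..1})"
      using DERIV_chain2[OF sqp_deriv d1] .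
    have d3: "((\<lambda>s. l s ^ N) has_field_derivative real N * (- t' * (l s)\<^sup>2) * l s ^ (N - 1)) (at s within {0..1})"
      by (rule derivative_eq_intros dl' refl | simp)+
    have pw: "l s * l s ^ (N - 1) = l s ^ N" by (simp add: N_def power_eq_if)
    have qz: "z s x \<bullet> (y0 + (t' * l s) *\<^sub>R z s x) = z s x \<bullet> y0 + t' * l s * q s"
      by (simp add: q_def inner_add_right power2_norm_eq_inner)
    \<comment> \<open>Once \<open>l ^ N\<close> is split as \<open>l * l ^ (N - 1)\<close>, the
      output of the product and chain rules and - \<open>dv\<close> agree as polynomials.\<close>
    have id: "real N * (- t' * L\<^sup>2) * P * A + 2 * m * (2 * t' * L ^ 3 * Q + 2 * L\<^sup>2 * w) * (L * P)
       = - (real N * (t' * L) * (L * P * A) + 2 * (L * P * (2 * m * (- L\<^sup>2))) * (w + t' * L * Q))" for L P A m Q w :: real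
      by algebra
    have dv: "dv s x = real N * (t' * l s) * (l s ^ N * sqp (1 - (l s)\<^sup>2 * q s))
     + 2 * (l s ^ N * (2 * max 0 (1 - (l s)\<^sup>2 * q s) * (- (l s)\<^sup>2))) * (z s x \<bullet> y0 + t' * l s * q s)"
      unfolding dv_def qz q_def ..
    have "((\<lambda>s. l s ^ N * sqp (1 - (l s)\<^sup>2 * q s)) has_field_derivative - dv s x) (at s within {0..1})"
      unfolding dv
      by (rule DERIV_cong[OF DERIV_mult[OF d3 d2]]) (simp only: pw[symmetric] id)
    from DERIV_cmult_right[OF this, of "det (G x)"]
    show "((\<lambda>s. h s x * det (G x)) has_field_derivative - (dv s x * det (G x))) (at s within {0..1})"
      by (simp add: h_def q_def)
  next
    fix s :: real
    show "(\<lambda>x. h s x * det (G x)) integrable_on cbox (\<chi> i. - c) (\<chi> i. c)"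
      unfolding h_def z_def by (intro integrable_continuous continuous_intros csqp cg cG)
  next
    show "continuous_on ({0..1} \<times> cbox (\<chi> i. - c) (\<chi> i. c)) (\<lambda>(s, x). - (dv s x * det (G x)))"
      unfolding split_beta dv_def z_def by (intro continuous_intros csqp cl2 cg2)
  qed auto
  have "F 0 = F 1"
  proof -
    have "(F has_field_derivative 0) (at s within {0..1})" if "s \<in> {0..1}" for s
      using dF[OF that] z0[OF that] by simp
    then obtain k where "\<And>x. x \<in> {0..1} \<Longrightarrow> F x = k"
      using has_field_derivative_zero_constant[of "{0..1::real}" F] by auto
    then show ?thesis by simp
  qed
  moreover have "F 1 = 0"
  proof -
    have "h 1 x = 0" if "x \<in> cube c" for x
    proof -
      have "g x \<notin> ball y0 d" using d(2) that by blast
      then have "t1 \<le> norm (z 1 x)" using t1 by (simp add: z_def dist_norm norm_minus_commute not_less)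
      then have "1 \<le> l 1 * norm (z 1 x)" using t1 by (simp add: l_def t_def field_simps)
      then have "1 \<le> (l 1 * norm (z 1 x))\<^sup>2" by simp
      then show ?thesis by (simp add: h_def power_mult_distrib)
    qed
    then have "F 1 = integral (cube c) (\<lambda>x::real^'n. 0)" unfolding F_def by (intro integral_cong) simp
    then show ?thesis by simp
  qed
  moreover have "h 0 x = (1 / M) ^ N * (1 / M) ^ 4 * sqp (M\<^sup>2 - (norm (g x))\<^sup>2)" for x
  proof -
    have e: "1 - (1 / M)\<^sup>2 * (norm (g x))\<^sup>2 = (1 / M)\<^sup>2 * (M\<^sup>2 - (norm (g x))\<^sup>2)"
      using M0 by (simp add: field_simps)
    have "max 0 ((1 / M)\<^sup>2 * (M\<^sup>2 - (norm (g x))\<^sup>2)) = (1 / M)\<^sup>2 * max 0 (M\<^sup>2 - (norm (g x))\<^sup>2)"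
      using M0 by (auto simp: max_def mult_le_0_iff zero_le_mult_iff)
    then have "sqp (1 - (1 / M)\<^sup>2 * (norm (g x))\<^sup>2) = (1 / M) ^ 4 * sqp (M\<^sup>2 - (norm (g x))\<^sup>2)"
      unfolding e sqp_def by (simp add: power_mult_distrib flip: power_mult)
    then show ?thesis by (simp add: h_def l_def t_def z_def)
  qed
  ultimately have "integral (cube c) (\<lambda>x. ((1 / M) ^ N * (1 / M) ^ 4) * (sqp (M\<^sup>2 - (norm (g x))\<^sup>2) * det (G x))) = 0"
    unfolding F_def by (simp add: mult_ac)
  then show ?thesis using M0 by simp
qed

section \<open>Approximately quasiregular sequences\<close>

text \<open>The mollifications of a quasiregular map satisfy the distortion inequality up to an error that
  tends to \<open>0\<close> in mean. Everything about the limit map is deduced from this.\<close>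

locale qr_approx =
  fixes g :: "nat \<Rightarrow> real ^ 'n::finite \<Rightarrow> real ^ 'n" and G :: "nat \<Rightarrow> real ^ 'n \<Rightarrow> real ^ 'n ^ 'n"
    and f :: "real ^ 'n \<Rightarrow> real ^ 'n" and K R :: real
  assumes n2: "CARD('n) \<ge> 2"
    and g: "\<And>k. C1_map (g k) (G k)"
    and lim: "uniform_limit (cube R) g f sequentially"
    and R: "0 < R" and K: "1 \<le> K"
    and err: "(\<lambda>k. integral (cube R) (\<lambda>x. max 0 (norm (G k x) ^ CARD('n) - K * det (G k x)))) \<longlonglongrightarrow> 0"
begin

definition e where "e k x = max 0 (norm (G k x) ^ CARD('n) - K * det (G k x))"

lemma cg: "continuous_on S (g k)" by (rule C1_map_cont[OF g])
lemma cG: "continuous_on S (G k)" by (rule C1_map_cont_deriv[OF g])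
lemma ce: "continuous_on S (e k)" unfolding e_def by (intro continuous_intros cG)
lemma e_nonneg: "0 \<le> e k x" by (simp add: e_def)

lemma norm_le: "norm (G k x) ^ CARD('n) \<le> K * det (G k x) + e k x" by (simp add: e_def)

lemma err': "(\<lambda>k. integral (cube R) (e k)) \<longlonglongrightarrow> 0"
  using err by (simp add: e_def[abs_def])

lemma cf: "continuous_on (cube R) f"
  by (rule uniform_limit_theorem[OF _ lim]) (auto simp: cg)

text \<open>Allows an assertion about almost all k to be proved by contradiction: a failure for
  infinitely many k becomes a failure for all k of another approximating sequence with the same
  limit.\<close>

lemma subsequence:
  assumes r: "strict_mono r"
  shows "qr_approx (\<lambda>k. g (r k)) (\<lambda>k. G (r k)) f K R"
proof
  show "uniform_limit (cube R) (\<lambda>k. g (r k)) f sequentially"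
    unfolding uniform_limit_iff
  proof (intro allI impI)
    fix \<epsilon> :: real assume "0 < \<epsilon>"
    then have "\<forall>\<^sub>F k in sequentially. \<forall>x\<in>cube R. dist (g k x) (f x) < \<epsilon>"
      using lim unfolding uniform_limit_iff by blast
    then show "\<forall>\<^sub>F k in sequentially. \<forall>x\<in>cube R. dist (g (r k) x) (f x) < \<epsilon>"
      by (rule eventually_subseq[OF r])
  qed
  show "(\<lambda>k. integral (cube R) (\<lambda>x. max 0 (norm (G (r k) x) ^ CARD('n) - K * det (G (r k) x)))) \<longlonglongrightarrow> 0"
    using LIMSEQ_subseq_LIMSEQ[OF err r] by (simp add: o_def)
qed (use n2 g R K in auto)

text \<open>Turns boundary information on f into information on g_k over a collar whose width does
  not depend on k. The points with w (f x) \<le> (M + M') / 2 form a compact set away from the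
  boundary, hence inside a smaller cube; the other half of the gap M - M' absorbs the uniform error,
  as \<open>w\<close> is 1-Lipschitz.\<close>

lemma collar:
  assumes w: "\<And>y y'. \<bar>w y - w y'\<bar> \<le> dist y y'" and c: "0 < c" "c \<le> R"
    and M: "\<And>x. x \<in> cubeb c \<Longrightarrow> M \<le> w (f x)" and M': "M' < M"
  shows "\<exists>a. 0 \<le> a \<and> a < c \<and> (\<forall>\<^sub>F k in sequentially. \<forall>x\<in>cube c - cube a. M' < w (g k x))"
proof -
  define Z where "Z = {x \<in> cube c. w (f x) \<le> (M + M') / 2}"
  have cw: "continuous_on S w" for S
    by (rule lipschitz_on_continuous_on[of 1], rule lipschitz_onI) (use w in \<open>auto simp: dist_real_def\<close>)
  have cf': "continuous_on (cube c) f" using cf cube_mono[OF c(2)] by (rule continuous_on_subset)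
  have "compact Z"
  proof -
    have "closed Z" unfolding Z_def
      by (intro continuous_on_closed_Collect_le continuous_on_compose2[OF cw[of UNIV] cf'] continuous_on_const closed_cube) auto
    moreover have "cube c \<inter> Z = Z" by (auto simp: Z_def)
    ultimately show ?thesis using compact_Int_closed[OF compact_cube[of c], of Z] by simp
  qed
  have "\<exists>a. 0 \<le> a \<and> a < c \<and> Z \<subseteq> cube a"
  proof (cases "Z = {}")
    case True
    then show ?thesis using c by (intro exI[of _ 0]) auto
  next
    case False
    have "continuous_on Z (infnorm :: real ^ 'n \<Rightarrow> real)"
      unfolding continuous_on_def by (auto intro!: tendsto_infnorm)
    then obtain z where z: "z \<in> Z" "\<And>x. x \<in> Z \<Longrightarrow> infnorm x \<le> infnorm z"
      using continuous_attains_sup[OF \<open>compact Z\<close> False] by metis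
    have comp: "\<bar>x $ i\<bar> \<le> infnorm x" for x :: "real ^ 'n" and i
      using Basis_le_infnorm[of "axis i 1" x] by (auto simp: inner_axis Basis_vec_def)
    have "infnorm z < c"
    proof -
      have "z \<in> cube c" "z \<notin> cubeb c" using z M[of z] M' by (auto simp: Z_def)
      then have lt: "\<bar>z $ i\<bar> < c" for i by (auto simp: cubeb_def mem_cube less_le)
      have "infnorm z \<in> (\<lambda>b. \<bar>z \<bullet> b\<bar>) ` Basis"
        unfolding infnorm_Max by (rule Max_in) auto
      then show ?thesis using lt by (auto simp: Basis_vec_def inner_axis)
    qed
    moreover have "Z \<subseteq> cube (infnorm z)"
      unfolding subset_iff mem_cube using order_trans[OF comp z(2)] by blast
    ultimately show ?thesis using infnorm_pos_le by blast
  qed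
  then obtain a where a: "0 \<le> a" "a < c" "Z \<subseteq> cube a" by blast
  have "\<forall>\<^sub>F k in sequentially. \<forall>x\<in>cube R. dist (g k x) (f x) < (M - M') / 2"
    using lim[unfolded uniform_limit_iff, rule_format, of "(M - M') / 2"] M' by simp
  then have "\<forall>\<^sub>F k in sequentially. \<forall>x\<in>cube c - cube a. M' < w (g k x)"
  proof eventually_elim
    case (elim k)
    show ?case
    proof
      fix x :: "real ^ 'n" assume x: "x \<in> cube c - cube a"
      then have "(M + M') / 2 < w (f x)" using a by (auto simp: Z_def not_le)
      moreover have "dist (g k x) (f x) < (M - M') / 2" using elim x cube_mono[OF c(2)] by auto
      ultimately show "M' < w (g k x)" using w[of "g k x" "f x"] by (auto simp: field_simps)
    qed
  qed
  with a show ?thesis by blast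
qed

text \<open>If the integral of a non-negative weight \<open>d\<close> against the Jacobian vanishes, then so does, in
  the limit, the energy of \<open>g\<close> on \<open>{d > 0}\<close>, and a function with gradient dominated by \<open>d\<close>
  becomes constant.\<close>

lemma constant_of_null_integral:
  assumes d: "continuous_on UNIV d" "\<And>y. 0 \<le> d y" and c: "0 < c" "c \<le> R"
    and null: "\<forall>\<^sub>F k in sequentially. integral (cube c) (\<lambda>x. d (g k x) * det (G k x)) = 0"
    and v: "has_grad v V" and dv: "\<And>y. norm (V y) \<le> C * d y"
    and xy: "x \<in> cube c" "y \<in> cube c"
  shows "v (f x) = v (f y)"
proof -
  define N where "N = CARD('n)"
  obtain m where m: "N = Suc m" using n2 by (cases N) (auto simp: N_def)
  have cr: "cube c \<subseteq> cube R" by (rule cube_mono[OF c(2)])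
  have "compact (f ` cube R)" by (intro compact_continuous_image cf) auto
  then obtain b where b: "0 < b" "\<And>x. x \<in> cube R \<Longrightarrow> norm (f x) \<le> b"
    by (metis bounded_pos compact_imp_bounded image_eqI)
  have ev: "\<forall>\<^sub>F k in sequentially. \<forall>x\<in>cube R. g k x \<in> cball 0 (b + 1)"
  proof -
    have "\<forall>\<^sub>F k in sequentially. \<forall>x\<in>cube R. dist (g k x) (f x) < 1"
      using lim unfolding uniform_limit_iff by simp
    then show ?thesis
    proof eventually_elim
      case (elim k)
      show ?case
      proof
        fix x :: "real ^ 'n" assume "x \<in> cube R"
        then have "norm (g k x - f x) < 1" "norm (f x) \<le> b" using elim b by (auto simp: dist_norm)
        then show "g k x \<in> cball 0 (b + 1)" using norm_triangle_sub[of "g k x" "f x"] by simp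
      qed
    qed
  qed
  have "compact (d ` cball 0 (b + 1))"
    by (intro compact_continuous_image continuous_on_subset[OF d(1)]) auto
  then obtain B where B: "0 < B" "\<And>y. y \<in> cball 0 (b + 1) \<Longrightarrow> d y \<le> B"
    by (metis abs_le_D1 bounded_pos compact_imp_bounded image_eqI real_norm_def)
  define C' where "C' = max C 0"
  have C': "0 \<le> C'" "norm (V y) \<le> C' * d y" for y
    using order_trans[OF dv[of y] mult_right_mono[OF _ d(2), of C C' y]] by (auto simp: C'_def)
  have cd: "continuous_on S (\<lambda>x. d (g k x))" for S k
    by (rule continuous_on_compose2[OF d(1) cg]) auto
  have gr: "has_grad (\<lambda>x. v (g k x)) (\<lambda>x. V (g k x) v* G k x)" for k by (rule has_grad_chain[OF v g])
  define I where "I k = integral (cube c) (\<lambda>x. norm (V (g k x) v* G k x))" for k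
  define Q where "Q = (2 * c) ^ N"
  have Q: "0 \<le> Q" using c by (simp add: Q_def)
  \<comment> \<open>Young's inequality with parameter \<tau> splits the gradient into three parts:
    the first is small with \<tau>, the Jacobian part integrates to 0 by \<open>null\<close>, and
    the error part tends to 0 in k for each fixed \<tau>.\<close>
  have est: "\<forall>\<^sub>F k in sequentially. I k \<le> C' * (\<tau> * B * Q) + C' * (1 / \<tau>) ^ m * B * integral (cube R) (e k)"
    if t: "0 < \<tau>" for \<tau>
    using ev null
  proof eventually_elim
    case (elim k)
    have dB: "d (g k x) \<le> B" if "x \<in> cube c" for x using elim(1) cr that by (intro B) auto
    have pt: "norm (V (g k x) v* G k x) \<le> C' * \<tau> * B + (C' * (1 / \<tau>) ^ m * K) * (d (g k x) * det (G k x)) + (C' * (1 / \<tau>) ^ m * B) * e k x"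
      if x: "x \<in> cube c" for x
    proof -
      have "norm (V (g k x) v* G k x) \<le> norm (V (g k x)) * norm (G k x)" by (rule norm_vector_matrix_le)
      also have "\<dots> \<le> (C' * d (g k x)) * norm (G k x)" by (intro mult_right_mono C') auto
      also have "\<dots> \<le> (C' * d (g k x)) * (\<tau> + (1 / \<tau>) ^ m * norm (G k x) ^ N)"
        using C' d t le_young[of "norm (G k x)" \<tau> m] by (intro mult_left_mono) (auto simp: m)
      also have "\<dots> \<le> (C' * d (g k x)) * (\<tau> + (1 / \<tau>) ^ m * (K * det (G k x) + e k x))"
        using C' d t norm_le[of k x] by (intro mult_left_mono add_left_mono) (auto simp: N_def)
      also have "\<dots> = C' * \<tau> * d (g k x) + (C' * (1 / \<tau>) ^ m * K) * (d (g k x) * det (G k x)) + (C' * (1 / \<tau>) ^ m * e k x) * d (g k x)"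
        by (simp add: algebra_simps)
      also have "\<dots> \<le> C' * \<tau> * B + (C' * (1 / \<tau>) ^ m * K) * (d (g k x) * det (G k x)) + (C' * (1 / \<tau>) ^ m * e k x) * B"
        using C' t dB[OF x] e_nonneg[of k x] by (intro add_mono mult_left_mono order_refl) auto
      finally show ?thesis by (simp add: mult_ac)
    qed
    have "I k \<le> integral (cube c) (\<lambda>x. C' * \<tau> * B + (C' * (1 / \<tau>) ^ m * K) * (d (g k x) * det (G k x)) + (C' * (1 / \<tau>) ^ m * B) * e k x)"
      unfolding I_def
      by (rule integral_le)
        (use pt in \<open>auto intro!: integrable_cube continuous_intros cd cG ce has_grad_cont_grad[OF gr]\<close>)
    also have "\<dots> = Q * (C' * \<tau> * B) + (C' * (1 / \<tau>) ^ m * K) * integral (cube c) (\<lambda>x. d (g k x) * det (G k x)) + (C' * (1 / \<tau>) ^ m * B) * integral (cube c) (e k)"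
      unfolding Q_def N_def
      by (subst integral_add integral_cube_const[symmetric], (auto intro!: integrable_cube continuous_intros cd cG ce simp: c less_imp_le)[1], (auto intro!: integrable_cube continuous_intros cd cG ce simp: c less_imp_le)[1])+ (simp add: integral_cube_const c less_imp_le)
    also have "\<dots> = C' * (\<tau> * B * Q) + C' * (1 / \<tau>) ^ m * B * integral (cube c) (e k)"
      using elim(2) by (simp add: mult_ac)
    also have "\<dots> \<le> C' * (\<tau> * B * Q) + C' * (1 / \<tau>) ^ m * B * integral (cube R) (e k)"
      using C' t B
      by (intro add_left_mono mult_left_mono integral_subset_le cr) (auto intro!: integrable_cube ce e_nonneg)
    finally show ?case .
  qed
  have I0: "I \<longlonglongrightarrow> 0"
  proof (rule LIMSEQ_I)
    fix \<epsilon> :: real assume "0 < \<epsilon>"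
    define \<tau> where "\<tau> = \<epsilon> / (2 * (C' * B * Q + 1))"
    have t: "0 < \<tau>" using \<open>0 < \<epsilon>\<close> C' B Q by (simp add: \<tau>_def add_nonneg_pos)
    have half: "C' * (\<tau> * B * Q) < \<epsilon> / 2"
    proof -
      have "C' * (\<tau> * B * Q) = \<tau> * (C' * B * Q)" by simp
      also have "\<dots> < \<tau> * (C' * B * Q + 1)" using t by simp
      also have "\<dots> = \<epsilon> / 2"
      proof -
        have "0 < C' * B * Q + 1" using C' B Q by (simp add: add_nonneg_pos)
        then show ?thesis by (simp add: \<tau>_def field_simps)
      qed
      finally show ?thesis .
    qed
    have "(\<lambda>k. C' * (1 / \<tau>) ^ m * B * integral (cube R) (e k)) \<longlonglongrightarrow> 0"
      using err' by (intro tendsto_eq_intros) auto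
    then have "\<forall>\<^sub>F k in sequentially. C' * (1 / \<tau>) ^ m * B * integral (cube R) (e k) < \<epsilon> / 2"
      by (rule order_tendstoD) (use \<open>0 < \<epsilon>\<close> in simp)
    with est[OF t] have "\<forall>\<^sub>F k in sequentially. I k < \<epsilon>"
      by eventually_elim (use half in linarith)
    moreover have "0 \<le> I k" for k
      unfolding I_def by (intro integral_nonneg integrable_cube continuous_intros has_grad_cont_grad[OF gr]) auto
    ultimately show "\<exists>no. \<forall>k\<ge>no. norm (I k - 0) < \<epsilon>"
      by (simp add: eventually_sequentially)
  qed
  have "uniform_limit (cube c) (\<lambda>k x. v (g k x)) (\<lambda>x. v (f x)) sequentially"
  proof (rule uniform_limit_compose_uniformly_continuous_on[where f=v and B="cball 0 (b + 1)" and g=g and g'=f])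
    show "uniform_limit (cube c) g f sequentially" by (rule uniform_limit_on_subset[OF lim cr])
    show "uniformly_continuous_on (cball 0 (b + 1)) v"
      by (intro compact_uniformly_continuous has_grad_cont[OF v]) auto
    show "\<forall>\<^sub>F k in sequentially. \<forall>x\<in>cube c. g k x \<in> cball 0 (b + 1)"
      using ev by eventually_elim (use cr in auto)
  qed auto
  moreover have "continuous_on (cube c) (\<lambda>x. v (f x))"
    by (rule continuous_on_compose2[OF has_grad_cont[OF v, of UNIV] continuous_on_subset[OF cf cr]]) auto
  ultimately show ?thesis
    using constant_of_small_gradients[where u="\<lambda>k x. v (g k x)" and v="\<lambda>x. v (f x)", OF gr _ _ _ c(1) xy] I0
    unfolding I_def by blast
qed

lemma cubeb_nonempty: "0 < c \<Longrightarrow> \<exists>x. x \<in> cubeb c"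
  by (rule exI[of _ "\<chi> i. c"]) (auto simp: cubeb_def mem_cube)

text \<open>The field \<eta>(|y - b|^2) (y - b) lives on |y - b| > m', so its pull-back vanishes
  near the boundary and the Jacobian integral of its divergence is 0. The divergence is nonnegative
  and dominates the gradient of \<eta>(|y - b|^2), because |y - b| \<ge> m' on the support. This
  function is therefore constant along f, and it is 0 on the boundary. The slack m' > m provides the
  collar.\<close>

lemma maximum_principle:
  assumes c: "0 < c" "c \<le> R" and m: "0 \<le> m" and bd: "\<And>x. x \<in> cubeb c \<Longrightarrow> norm (f x - b) \<le> m"
    and x: "x \<in> cube c"
  shows "norm (f x - b) \<le> m"
proof (rule dense_ge)
  fix m' assume m': "m < m'"
  then have m'0: "0 < m'" using m by simp
  define \<eta> where "\<eta> q = sqp (q - m'\<^sup>2)" for q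
  define \<eta>' where "\<eta>' q = 2 * max 0 (q - m'\<^sup>2)" for q
  have e1: "(\<eta> has_real_derivative \<eta>' q) (at q)" for q
    unfolding \<eta>_def[abs_def] \<eta>'_def
    by (rule DERIV_cong[OF DERIV_chain2[OF sqp_deriv]]) (auto intro!: derivative_eq_intros)
  have e2: "continuous_on UNIV \<eta>'" unfolding \<eta>'_def by (intro continuous_intros)
  obtain B where B: "C1_map (\<lambda>y. \<eta> ((norm (y - b))\<^sup>2) *\<^sub>R (0 + 1 *\<^sub>R (y - b))) B"
    and tr: "\<And>y. trace (B y) = real CARD('n) * 1 * \<eta> ((norm (y - b))\<^sup>2)
      + 2 * \<eta>' ((norm (y - b))\<^sup>2) * ((y - b) \<bullet> (0 + 1 *\<^sub>R (y - b)))"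
    using radial_field[OF e1 continuous_on_subset[OF e2]] by blast
  define d where "d y = trace (B y)" for y
  have d: "d y = real CARD('n) * \<eta> ((norm (y - b))\<^sup>2) + 2 * \<eta>' ((norm (y - b))\<^sup>2) * (norm (y - b))\<^sup>2" for y
    unfolding d_def tr by (simp add: power2_norm_eq_inner)
  have e0: "0 \<le> \<eta> q" "0 \<le> \<eta>' q" for q by (auto simp: \<eta>_def \<eta>'_def)
  have d0: "0 \<le> d y" for y unfolding d using e0 by simp
  define v where "v y = \<eta> ((norm (y - b))\<^sup>2)" for y
  have v: "has_grad v (\<lambda>y. \<eta>' ((norm (y - b))\<^sup>2) *\<^sub>R 2 *\<^sub>R (y - b))"
    unfolding v_def[abs_def] by (rule has_grad_compose[OF e1 e2 has_grad_norm2])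
  have dv: "norm (\<eta>' ((norm (y - b))\<^sup>2) *\<^sub>R 2 *\<^sub>R (y - b)) \<le> (1 / m') * d y" for y
  proof (cases "norm (y - b) \<le> m'")
    case True
    then have "(norm (y - b))\<^sup>2 \<le> m'\<^sup>2" by (intro power_mono) auto
    then show ?thesis using d0[of y] m'0 by (simp add: \<eta>'_def)
  next
    case False
    have "norm (\<eta>' ((norm (y - b))\<^sup>2) *\<^sub>R 2 *\<^sub>R (y - b)) * m' \<le> 2 * \<eta>' ((norm (y - b))\<^sup>2) * norm (y - b) * norm (y - b)"
      using False e0 mult_left_mono[of m' "norm (y - b)" "2 * \<eta>' ((norm (y - b))\<^sup>2) * norm (y - b)"]
      by (simp add: mult_ac)
    also have "\<dots> \<le> d y" unfolding d using e0 by (simp add: power2_eq_square mult_ac)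
    finally show ?thesis using m'0 by (simp add: field_simps)
  qed
  have lip: "\<bar>- norm (y - b) - - norm (y' - b)\<bar> \<le> dist y y'" for y y'
    using norm_triangle_ineq3[of "y' - b" "y - b"] by (simp add: dist_norm norm_minus_commute)
  \<comment> \<open>\<open>collar\<close> propagates lower bounds, so it is applied to the negative
    distance to b.\<close>
  obtain a where a: "0 \<le> a" "a < c" "\<forall>\<^sub>F k in sequentially. \<forall>x\<in>cube c - cube a. - m' < - norm (g k x - b)"
    using collar[of "\<lambda>y. - norm (y - b)" c "- m" "- m'", OF lip] c bd m' by auto
  have null: "\<forall>\<^sub>F k in sequentially. integral (cube c) (\<lambda>x. d (g k x) * det (G k x)) = 0"
    using a(3)
  proof eventually_elim
    case (elim k)
    show ?case unfolding d_def
    proof (rule integral_divergence_collar[OF B g a(1,2)])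
      fix x :: "real ^ 'n" assume "x \<in> cube c" "x \<notin> cube a"
      then have "norm (g k x - b) \<le> m'" using bspec[OF elim, of x] by simp
      then have "(norm (g k x - b))\<^sup>2 \<le> m'\<^sup>2" by (intro power_mono) auto
      then show "\<eta> ((norm (g k x - b))\<^sup>2) *\<^sub>R (0 + 1 *\<^sub>R (g k x - b)) = 0 \<and> trace (B (g k x)) = 0"
        unfolding tr by (simp add: \<eta>_def \<eta>'_def)
    qed
  qed
  have cd: "continuous_on UNIV d" unfolding d_def by (rule continuous_on_trace[OF C1_map_cont_deriv[OF B]])
  obtain p :: "real ^ 'n" where p: "p \<in> cubeb c" using cubeb_nonempty[OF c(1)] by blast
  have "v (f x) = v (f p)"
    by (rule constant_of_null_integral[OF cd d0 c null v dv x]) (use p cubeb_subset in blast)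
  also have "\<dots> = 0"
  proof -
    have "norm (f p - b) \<le> m'" using bd[OF p] m' by simp
    then have "(norm (f p - b))\<^sup>2 \<le> m'\<^sup>2" by (intro power_mono) auto
    then show ?thesis by (simp add: v_def \<eta>_def)
  qed
  finally have "(norm (f x - b))\<^sup>2 \<le> m'\<^sup>2" by (simp add: v_def \<eta>_def)
  then show "norm (f x - b) \<le> m'" using m'0 by (simp add: power2_le_iff_abs_le)
qed

text \<open>If infinitely many g_k omit a point of the ball, the bump on that ball has vanishing
  Jacobian integral along a subsequence, and its square would be constant along f. But the bump is
  positive at f 0 = 0 and vanishes at the boundary values of f.\<close>

lemma eventually_covers:
  assumes c: "0 < c" "c \<le> R" and bd: "\<And>x. x \<in> cubeb c \<Longrightarrow> M \<le> norm (f x)" and f0: "f 0 = 0"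
    and M': "0 < M'" "M' < M"
  shows "\<forall>\<^sub>F k in sequentially. ball 0 M' \<subseteq> g k ` cube c"
proof (rule ccontr)
  assume "\<not> ?thesis"
  then obtain r :: "nat \<Rightarrow> nat" where r: "strict_mono r" "\<And>k. \<not> ball 0 M' \<subseteq> g (r k) ` cube c"
    using not_eventually_sequentiallyD by blast
  interpret sub: qr_approx "\<lambda>k. g (r k)" "\<lambda>k. G (r k)" f K R by (rule subsequence[OF r(1)])
  obtain a where a: "0 \<le> a" "a < c" "\<forall>\<^sub>F k in sequentially. \<forall>x\<in>cube c - cube a. M' < norm (g (r k) x)"
    using sub.collar[of norm c M M'] c bd M' by (auto simp: dist_norm norm_triangle_ineq3)
  define d where "d y = sqp (M'\<^sup>2 - (norm y)\<^sup>2)" for y :: "real ^ 'n"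
  have null: "\<forall>\<^sub>F k in sequentially. integral (cube c) (\<lambda>x. d (g (r k) x) * det (G (r k) x)) = 0"
    using a(3)
  proof eventually_elim
    case (elim k)
    obtain y where y: "norm y < M'" "y \<notin> g (r k) ` cube c" using r(2)[of k] by (auto simp: subset_iff)
    show ?case unfolding d_def
      by (rule integral_bump_eq_0_of_omitted[OF g a(1,2) _ y]) (use elim in \<open>auto intro: less_imp_le\<close>)
  qed
  have e1: "((\<lambda>q. sqp (M'\<^sup>2 - q)) has_real_derivative - 2 * max 0 (M'\<^sup>2 - q)) (at q)" for q
  proof -
    have "((\<lambda>q. M'\<^sup>2 - q) has_real_derivative - 1) (at q)" by (auto intro!: derivative_eq_intros)
    from DERIV_chain2[OF sqp_deriv this] show ?thesis by simp
  qed
  have e2: "continuous_on UNIV (\<lambda>q. - 2 * max 0 (M'\<^sup>2 - q))" by (intro continuous_intros)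
  have gd: "has_grad d (\<lambda>y. (- 2 * max 0 (M'\<^sup>2 - (norm (y - 0))\<^sup>2)) *\<^sub>R 2 *\<^sub>R (y - 0))"
    using has_grad_compose[OF e1 e2 has_grad_norm2[of 0]] by (simp add: d_def[abs_def])
  \<comment> \<open>The gradient of \<open>d\<close> itself is only of order sqrt d near the edge of
    its support. The square of \<open>d\<close> has gradient 2 d times that of d, which is dominated
    by a multiple of \<open>d\<close>.\<close>
  define V where "V y = (2 * max 0 (d y)) *\<^sub>R ((- 2 * max 0 (M'\<^sup>2 - (norm (y - 0))\<^sup>2)) *\<^sub>R 2 *\<^sub>R (y - 0))" for y
  have v: "has_grad (\<lambda>y. sqp (d y)) V" unfolding V_def by (rule has_grad_sqp[OF gd])
  have d0: "0 \<le> d y" for y by (simp add: d_def)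
  have dv: "norm (V y) \<le> (8 * M'\<^sup>2 * M') * d y" for y
  proof (cases "norm y \<le> M'")
    case True
    have "norm (V y) = 8 * d y * (max 0 (M'\<^sup>2 - (norm y)\<^sup>2) * norm y)"
      using d0[of y] by (simp add: V_def abs_mult)
    also have "\<dots> \<le> 8 * d y * (M'\<^sup>2 * M')"
      using True M' d0 by (intro mult_left_mono mult_mono) auto
    finally show ?thesis by (simp add: mult_ac)
  next
    case False
    then have "M'\<^sup>2 \<le> (norm y)\<^sup>2" using M' by (intro power_mono) auto
    then have "V y = 0" by (simp add: V_def d_def)
    then show ?thesis using d0[of y] M' by simp
  qed
  obtain p :: "real ^ 'n" where p: "p \<in> cubeb c" using cubeb_nonempty[OF c(1)] by blast
  have "sqp (d (f 0)) = sqp (d (f p))"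
    by (rule sub.constant_of_null_integral[OF has_grad_cont[OF gd] d0 c null v dv])
      (use p cubeb_subset c in auto)
  moreover have "d (f p) = 0"
  proof -
    have "M' \<le> norm (f p)" using bd[OF p] M' by simp
    then have "M'\<^sup>2 \<le> (norm (f p))\<^sup>2" using M' by (intro power_mono) auto
    then show ?thesis by (simp add: d_def)
  qed
  moreover have "0 < d (f 0)" using M' by (simp add: f0 d_def sqp_def max_def)
  ultimately show False by (metis less_eq_real_def not_less order_refl sqp_eq_0)
qed

end

section \<open>The energy estimate\<close>

text \<open>The field \<open>- (om q ^ n * Llog q) *\<^sub>R y\<close> with \<open>q = (norm y)\<^sup>2\<close> is designed so that its divergence is at least
  \<open>om q ^ n\<close> for large \<open>q\<close>, while \<open>om q * norm (Dg)\<close> still dominates the gradient of \<open>ln (Llog ((norm g)\<^sup>2))\<close>,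
  which is unbounded.\<close>

definition Llog :: "real \<Rightarrow> real" where "Llog q = 1 + ln (1 + q)"

definition om :: "real \<Rightarrow> real" where "om q = 1 / (sqrt (1 + q) * Llog q)"

lemma Llog_ge_1: "0 \<le> q \<Longrightarrow> 1 \<le> Llog q" by (simp add: Llog_def)

lemma Llog_mono: "0 \<le> q \<Longrightarrow> q \<le> q' \<Longrightarrow> Llog q \<le> Llog q'" by (simp add: Llog_def)

lemma om_pos: "0 \<le> q \<Longrightarrow> 0 < om q"
  using Llog_ge_1[of q] by (simp add: om_def)

lemma om_antimono: "0 \<le> q \<Longrightarrow> q \<le> q' \<Longrightarrow> om q' \<le> om q"
  unfolding om_def using Llog_ge_1[of q] Llog_mono[of q q'] by (intro divide_left_mono mult_mono) auto

lemma om_le_1: "0 \<le> q \<Longrightarrow> om q \<le> 1"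
  using om_antimono[of 0 q] by (simp add: om_def Llog_def)

lemma continuous_on_Llog: "continuous_on {0..} Llog"
  unfolding Llog_def by (intro continuous_intros) auto

lemma continuous_on_om: "continuous_on {0..} om"
  unfolding om_def by (intro continuous_intros continuous_on_Llog) (use Llog_ge_1 in \<open>force simp: add_nonneg_eq_0_iff\<close>)

lemma om_deriv:
  assumes q: "0 \<le> q"
  shows "(om has_real_derivative - om q * (1 / (2 * (1 + q)) + 1 / (Llog q * (1 + q)))) (at q)"
proof -
  have L: "0 < Llog q" using Llog_ge_1[OF q] by simp
  have s: "0 < sqrt (1 + q)" using q by simp
  have L': "(Llog has_real_derivative 1 / (1 + q)) (at q)"
    unfolding Llog_def using q by (auto intro!: derivative_eq_intros)
  have s': "((\<lambda>q. sqrt (1 + q)) has_real_derivative 1 / (2 * sqrt (1 + q))) (at q)"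
    using q by (auto intro!: derivative_eq_intros simp: field_simps)
  have "((\<lambda>q. 1 / (sqrt (1 + q) * Llog q)) has_real_derivative
      - (1 / (2 * sqrt (1 + q)) * Llog q + 1 / (1 + q) * sqrt (1 + q)) / (sqrt (1 + q) * Llog q)\<^sup>2) (at q)"
    by (rule DERIV_cong[OF DERIV_divide[OF DERIV_const DERIV_mult[OF s' L']]])
      (use L s in \<open>auto simp: power2_eq_square\<close>)
  moreover have "- (1 / (2 * sqrt (1 + q)) * Llog q + 1 / (1 + q) * sqrt (1 + q)) / (sqrt (1 + q) * Llog q)\<^sup>2
    = - om q * (1 / (2 * (1 + q)) + 1 / (Llog q * (1 + q)))"
  proof -
    define S where "S = sqrt (1 + q)"
    have S: "1 + q = S * S" "0 < S" using q s by (auto simp: S_def)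
    show ?thesis unfolding om_def S(1) using S(2) L
      by (simp add: real_sqrt_mult_self divide_simps power2_eq_square)
  qed
  ultimately show ?thesis unfolding om_def[abs_def] by simp
qed

text \<open>For large r = |y| the field behaves like - y / (r^n L^(n - 1)) with a logarithm L. Since
  y / r^n is divergence free, only the derivative of L^(1 - n) contributes, and with n \<ge> 2 it
  has a positive sign of size 2 (n - 1) times the weight.\<close>

lemma log_field:
  assumes n: "CARD('n::finite) \<ge> 2"
  shows "\<exists>B. C1_map (\<lambda>y::real ^ 'n. (- (om ((norm y)\<^sup>2) ^ CARD('n) * Llog ((norm y)\<^sup>2))) *\<^sub>R y) B \<and>
    (\<forall>y. trace (B y) = om ((norm y)\<^sup>2) ^ CARD('n) * (2 * (real CARD('n) - 1) * (norm y)\<^sup>2 - real CARD('n) * Llog ((norm y)\<^sup>2)) / (1 + (norm y)\<^sup>2))"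
proof -
  define N where "N = CARD('n)"
  obtain m where m: "N = Suc m" using n by (cases N) (auto simp: N_def)
  define \<eta> where "\<eta> q = - (om q ^ N * Llog q)" for q
  define \<eta>' where "\<eta>' q = om q ^ N * (real N * Llog q / 2 + real N - 1) / (1 + q)" for q
  have 1: "(\<eta> has_real_derivative \<eta>' q) (at q)" if q: "0 \<le> q" for q
  proof -
    have L: "0 < Llog q" using Llog_ge_1[OF q] by simp
    have L': "(Llog has_real_derivative 1 / (1 + q)) (at q)"
      unfolding Llog_def using q by (auto intro!: derivative_eq_intros)
    have p: "((\<lambda>q. om q ^ N) has_real_derivative real N * (- om q * (1 / (2 * (1 + q)) + 1 / (Llog q * (1 + q))) * om q ^ (N - 1))) (at q)"
      using DERIV_power[OF om_deriv[OF q], of N] by (simp add: m)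
    have "- ((real N * (- om q * (1 / (2 * (1 + q)) + 1 / (Llog q * (1 + q))) * om q ^ (N - 1))) * Llog q + 1 / (1 + q) * om q ^ N) = \<eta>' q"
      unfolding \<eta>'_def m using L q by (simp add: divide_simps) (simp add: algebra_simps)
    from DERIV_cong[OF DERIV_minus[OF DERIV_mult[OF p L']] this] show ?thesis
      unfolding \<eta>_def .
  qed
  have 2: "continuous_on {0..} \<eta>'"
    unfolding \<eta>'_def by (intro continuous_intros continuous_on_om continuous_on_Llog) auto
  obtain B where B: "C1_map (\<lambda>y::real ^ 'n. \<eta> ((norm (y - 0))\<^sup>2) *\<^sub>R (0 + 1 *\<^sub>R (y - 0))) B"
    and tr: "\<And>y. trace (B y) = real CARD('n) * 1 * \<eta> ((norm (y - 0))\<^sup>2)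
      + 2 * \<eta>' ((norm (y - 0))\<^sup>2) * ((y - 0) \<bullet> (0 + 1 *\<^sub>R (y - 0)))"
    using radial_field[OF 1 2] by blast
  have "trace (B y) = om ((norm y)\<^sup>2) ^ N * (2 * (real N - 1) * (norm y)\<^sup>2 - real N * Llog ((norm y)\<^sup>2)) / (1 + (norm y)\<^sup>2)" for y
  proof -
    define q where "q = (norm y)\<^sup>2"
    have q: "0 \<le> q" by (simp add: q_def)
    have "trace (B y) = real N * \<eta> q + 2 * \<eta>' q * q"
      unfolding tr q_def N_def by (simp add: power2_norm_eq_inner)
    also have "\<dots> = om q ^ N * (2 * (real N - 1) * q - real N * Llog q) / (1 + q)"
      unfolding \<eta>_def \<eta>'_def using q by (simp add: divide_simps) (simp add: algebra_simps)
    finally show ?thesis by (simp add: q_def)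
  qed
  then show ?thesis using B by (auto simp: \<eta>_def N_def)
qed

text \<open>The three bounds meet three needs of the energy estimate: for large values the
  divergence absorbs the weighted Jacobian, for small values it is merely bounded, and the field
  itself is at most om^(n - 1), the power that Young's inequality can handle.\<close>

lemma log_field_bounds:
  fixes N :: nat
  assumes N: "2 \<le> N" and q: "0 \<le> q"
  defines "d \<equiv> om q ^ N * (2 * (real N - 1) * q - real N * Llog q) / (1 + q)"
  shows "16 \<le> q \<Longrightarrow> om q ^ N \<le> d" and "\<bar>d\<bar> \<le> 2 * real N" and "sqrt q * (om q ^ N * Llog q) \<le> om q ^ (N - 1)"
proof -
  have L: "1 \<le> Llog q" by (rule Llog_ge_1[OF q])
  have o: "0 < om q" "om q \<le> 1" using om_pos[OF q] om_le_1[OF q] by auto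
  have oN: "0 \<le> om q ^ N" "om q ^ N \<le> 1" using o by (auto intro: power_le_one)
  show "om q ^ N \<le> d" if "16 \<le> q"
  proof -
    \<comment> \<open>Splitting off the factor 8 makes the tangent-line bound for ln strong enough.
      The resulting 2 L + 1 \<le> q already holds from q = 10 on; the threshold 16 = 4^2 gives a
      round radius below the normalised level 5.\<close>
    have "ln (1 + q) = ln ((1 + q) / 8) + ln 8" using q by (simp add: ln_div)
    also have "ln ((1 + q) / 8) \<le> (1 + q) / 8 - 1" using q by (intro ln_le_minus_one) auto
    also have "ln (8::real) \<le> 3"
    proof -
      have "ln (8::real) = 3 * ln 2" using ln_realpow[of 2 3] by simp
      also have "ln (2::real) \<le> 1" using ln_le_minus_one[of "2::real"] by simp
      finally show ?thesis by simp
    qed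
    finally have "8 * Llog q \<le> q + 25" by (simp add: Llog_def field_simps)
    then have "2 * Llog q + 1 \<le> q" using that by simp
    then have "1 + q \<le> 2 * (q - Llog q)" by simp
    also have "\<dots> \<le> real N * (q - Llog q)" using N \<open>2 * Llog q + 1 \<le> q\<close> L by (intro mult_right_mono) auto
    also have "\<dots> \<le> 2 * (real N - 1) * q - real N * Llog q"
    proof -
      have "real N * q \<le> 2 * (real N - 1) * q" using N q by (intro mult_right_mono) auto
      then show ?thesis by (simp add: algebra_simps)
    qed
    finally have "1 \<le> (2 * (real N - 1) * q - real N * Llog q) / (1 + q)" using q by (simp add: field_simps)
    then have "om q ^ N * 1 \<le> om q ^ N * ((2 * (real N - 1) * q - real N * Llog q) / (1 + q))"
      using oN by (intro mult_left_mono)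
    then show ?thesis by (simp add: d_def)
  qed
  have oL: "om q * Llog q = 1 / sqrt (1 + q)" using L by (simp add: om_def)
  have s: "1 \<le> sqrt (1 + q)" "sqrt q \<le> sqrt (1 + q)" using q by auto
  have pN: "om q ^ N = om q ^ (N - 1) * om q" using N by (cases N) auto
  have p1: "0 \<le> om q ^ (N - 1)" "om q ^ (N - 1) \<le> 1" using o by (auto intro: power_le_one)
  have "sqrt q * (om q ^ N * Llog q) = om q ^ (N - 1) * (sqrt q * (om q * Llog q))"
    unfolding pN by (simp only: mult_ac)
  also have "\<dots> = om q ^ (N - 1) * (sqrt q / sqrt (1 + q))" unfolding oL by simp
  also have "\<dots> \<le> om q ^ (N - 1) * 1" using s p1 by (intro mult_left_mono) (auto simp: divide_le_eq)
  finally show "sqrt q * (om q ^ N * Llog q) \<le> om q ^ (N - 1)" by simp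
  have "om q ^ N * Llog q / (1 + q) \<le> 1"
  proof -
    have "om q ^ N * Llog q \<le> 1"
    proof -
      have "om q ^ N * Llog q = om q ^ (N - 1) * (1 / sqrt (1 + q))"
        unfolding pN oL[symmetric] by (simp only: mult_ac)
      also have "\<dots> \<le> 1 * 1" using p1 s by (intro mult_mono) auto
      finally show ?thesis by simp
    qed
    then show ?thesis using q by (simp add: divide_le_eq)
  qed
  then have l: "real N * (om q ^ N * Llog q / (1 + q)) \<le> real N * 1" by (intro mult_left_mono) auto
  have "q / (1 + q) * om q ^ N \<le> 1 * 1" using oN q by (intro mult_mono) auto
  then have u: "2 * (real N - 1) * (q / (1 + q) * om q ^ N) \<le> 2 * (real N - 1) * 1"
    using N by (intro mult_left_mono) auto
  have d2: "d = 2 * (real N - 1) * (q / (1 + q) * om q ^ N) - real N * (om q ^ N * Llog q / (1 + q))"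
    unfolding d_def by (simp add: diff_divide_distrib add_divide_distrib algebra_simps)
  have "0 \<le> 2 * (real N - 1) * (q / (1 + q) * om q ^ N)" "0 \<le> real N * (om q ^ N * Llog q / (1 + q))"
    using N q oN L by auto
  moreover have "\<bar>X - Y\<bar> \<le> 2 * real N" if "0 \<le> X" "0 \<le> Y" "X \<le> 2 * (real N - 1) * 1" "Y \<le> real N * 1" for X Y
    using that N by (simp add: abs_le_iff)
  ultimately show "\<bar>d\<bar> \<le> 2 * real N" using l u unfolding d2 by blast
qed

context qr_approx
begin

text \<open>A Caccioppoli argument. The weight is exchanged for the divergence \<open>d\<close>, at
  the price of the Jacobian on |g| \<le> 4, where p = 1, and of the distortion error. The
  pulled-back divergence is integrated by parts against the n-th power of the cutoff, and half of
  the left-hand side is absorbed.\<close>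

lemma energy_estimate:
  assumes \<Phi>: "has_grad (cut (R/2) R :: real ^ 'n \<Rightarrow> real) \<Phi>" and B: "\<And>x. x \<in> cube R \<Longrightarrow> norm (\<Phi> x) \<le> B" "0 \<le> B"
    and p: "continuous_on UNIV p" "\<And>y. 0 \<le> p y" "\<And>y. norm y \<le> 4 \<Longrightarrow> p y = 1"
    and A: "integral (cube R) (\<lambda>x. p (g k x) * \<bar>det (G k x)\<bar>) \<le> A" and e1: "integral (cube R) (e k) \<le> 1"
  shows "integral (cube (R/2)) (\<lambda>x. (om ((norm (g k x))\<^sup>2) * norm (G k x)) ^ CARD('n)) \<le>
    2 * (2 ^ (CARD('n) - 1) * (K * (real CARD('n))\<^sup>2 * fact CARD('n) * B) ^ CARD('n) * (2 * R) ^ CARD('n)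
      + K * (2 * real CARD('n) + 1) * A + K * (2 * real CARD('n) + 1) + 1)"
proof -
  define N where "N = CARD('n)"
  have N2: "2 \<le> N" using n2 by (simp add: N_def)
  obtain m where m: "N = Suc m" using N2 by (cases N) auto
  define \<phi> where "\<phi> = (cut (R/2) R :: real ^ 'n \<Rightarrow> real)"
  have \<phi>01: "0 \<le> \<phi> x" "\<phi> x \<le> 1" for x by (auto simp: \<phi>_def cut_nonneg cut_le_1)
  define q where "q x = (norm (g k x))\<^sup>2" for x
  have q0: "0 \<le> q x" for x by (simp add: q_def)
  define J where "J x = det (G k x)" for x
  obtain Bf where Bf: "C1_map (\<lambda>y::real ^ 'n. (- (om ((norm y)\<^sup>2) ^ N * Llog ((norm y)\<^sup>2))) *\<^sub>R y) Bf"
    and tr: "\<And>y. trace (Bf y) = om ((norm y)\<^sup>2) ^ N * (2 * (real N - 1) * (norm y)\<^sup>2 - real N * Llog ((norm y)\<^sup>2)) / (1 + (norm y)\<^sup>2)"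
    using log_field[OF n2] unfolding N_def by blast
  define b where "b y = (- (om ((norm y)\<^sup>2) ^ N * Llog ((norm y)\<^sup>2))) *\<^sub>R y" for y :: "real ^ 'n"
  define d where "d x = trace (Bf (g k x))" for x
  have d: "d x = om (q x) ^ N * (2 * (real N - 1) * q x - real N * Llog (q x)) / (1 + q x)" for x
    by (simp add: d_def tr q_def)
  have C1b: "C1_map b Bf" using Bf unfolding b_def .
  have cd: "continuous_on S d" for S unfolding d_def
    by (rule continuous_on_trace) (rule continuous_on_compose2[OF C1_map_cont_deriv[OF C1b, of UNIV] cg], auto)
  have cb: "continuous_on S (\<lambda>x. b (g k x))" for S
    by (rule continuous_on_compose2[OF C1_map_cont[OF C1b, of UNIV] cg]) auto
  have c\<phi>: "continuous_on S \<phi>" "continuous_on S \<Phi>" for S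
    using has_grad_cont[OF \<Phi>] has_grad_cont_grad[OF \<Phi>] by (auto simp: \<phi>_def)
  have cp: "continuous_on S (\<lambda>x. p (g k x))" for S by (rule continuous_on_compose2[OF p(1) cg]) auto
  have co: "continuous_on S (\<lambda>x. om (q x))" for S
    unfolding q_def by (rule continuous_on_compose2[OF continuous_on_om]) (auto intro!: continuous_intros cg)
  have cJ: "continuous_on S J" for S unfolding J_def by (intro continuous_intros cG)
  define w where "w x = om (q x) ^ N" for x
  have w01: "0 \<le> w x" "w x \<le> 1" for x
    using om_pos[OF q0, of x] om_le_1[OF q0, of x] by (auto simp: w_def intro: power_le_one less_imp_le)
  define c where "c = K * (2 * real N + 1)"
  have pt: "w x * norm (G k x) ^ N \<le> K * (d x * J x) + c * (p (g k x) * \<bar>J x\<bar>) + (c + 1) * e k x" for x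
  proof -
    have nl: "norm (G k x) ^ N \<le> K * J x + e k x" using norm_le[of k x] by (simp add: J_def N_def)
    moreover have "0 \<le> norm (G k x) ^ N" by simp
    ultimately have KJ: "- e k x \<le> K * J x" by linarith
    have b2: "\<bar>d x\<bar> \<le> 2 * real N" unfolding d by (rule log_field_bounds(2)[OF N2 q0])
    have pe: "0 \<le> p (g k x) * \<bar>J x\<bar>" "0 \<le> e k x" using p(2) e_nonneg by auto
    have "w x * norm (G k x) ^ N \<le> w x * (K * J x + e k x)" using nl w01 by (intro mult_left_mono)
    also have "\<dots> = K * (d x * J x) + (w x - d x) * (K * J x) + w x * e k x" by (simp add: algebra_simps)
    also have "(w x - d x) * (K * J x) \<le> c * (p (g k x) * \<bar>J x\<bar>) + c * e k x"
    \<comment> \<open>For large q the difference w - d is nonpositive and K J \<ge> - e, so only the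
      error survives. For small q one has |w - d| \<le> 2 n + 1, the origin of \<open>c\<close>, and
      the Jacobian is charged to p = 1.\<close>
    proof (cases "16 \<le> q x")
      case True
      then have "w x \<le> d x" unfolding d w_def by (rule log_field_bounds(1)[OF N2 q0])
      then have "(w x - d x) * (K * J x) \<le> (d x - w x) * e k x"
        using mult_left_mono[OF KJ, of "d x - w x"] by (simp add: algebra_simps)
      also have "\<dots> \<le> c * e k x"
      proof (rule mult_right_mono)
        have "2 * real N + 1 \<le> K * (2 * real N + 1)" using K by (simp add: mult_le_cancel_right1)
        then show "d x - w x \<le> c" using b2 w01[of x] unfolding c_def by linarith
      qed (rule pe)
      also have "\<dots> \<le> c * (p (g k x) * \<bar>J x\<bar>) + c * e k x" using pe K by (simp add: c_def)
      finally show ?thesis .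
    next
      case False
      have "norm (g k x) \<le> 4"
      proof (rule ccontr)
        assume "\<not> ?thesis"
        then have "4\<^sup>2 \<le> (norm (g k x))\<^sup>2" by (intro power_mono) auto
        with False show False by (simp add: q_def)
      qed
      then have p1: "p (g k x) = 1" by (rule p(3))
      have "(w x - d x) * (K * J x) \<le> \<bar>w x - d x\<bar> * (K * \<bar>J x\<bar>)"
        using K abs_ge_self[of "(w x - d x) * (K * J x)"] by (simp add: abs_mult)
      also have "\<dots> \<le> (2 * real N + 1) * (K * \<bar>J x\<bar>)"
        using b2 w01[of x] K by (intro mult_right_mono) auto
      also have "\<dots> = c * (p (g k x) * \<bar>J x\<bar>)" using p1 by (simp add: c_def)
      also have "\<dots> \<le> c * (p (g k x) * \<bar>J x\<bar>) + c * e k x" using pe K by (simp add: c_def)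
      finally show ?thesis .
    qed
    also have "w x * e k x \<le> e k x" using w01[of x] pe by (simp add: mult_left_le_one_le)
    finally show ?thesis by (simp add: algebra_simps)
  qed
  define X where "X = integral (cube R) (\<lambda>x. \<phi> x ^ N * (w x * norm (G k x) ^ N))"
  define D where "D = K * (real N)\<^sup>2 * fact N * B"
  have D0: "0 \<le> D" using K B by (simp add: D_def)
  \<comment> \<open>The power n of the cutoff is chosen so that its gradient still carries \<phi> ^
    (n - 1), matching the n - 1 factors of the matrix norm left in the determinant.\<close>
  define \<Psi> where "\<Psi> x = (real N * \<phi> x ^ (N - 1)) *\<^sub>R \<Phi> x" for x
  have \<Psi>: "has_grad (\<lambda>x. \<phi> x ^ N) \<Psi>"
    unfolding \<Psi>_def
    by (rule has_grad_compose[of "\<lambda>t. t ^ N" "\<lambda>t. real N * t ^ (N - 1)"])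
      (use \<Phi> in \<open>auto intro!: derivative_eq_intros continuous_intros simp: \<phi>_def\<close>)
  define s where "s x = (\<Sum>i\<in>UNIV. b (g k x) $ i * det (\<chi> j. if j = i then \<Psi> x else G k x $ j))" for x
  have cs: "continuous_on S s" for S
    unfolding s_def \<Psi>_def by (intro continuous_intros cb continuous_on_det_replace_row c\<phi> cG)
  have id: "integral (cube R) (\<lambda>x. \<phi> x ^ N * d x * J x) = - integral (cube R) s"
    unfolding d_def J_def s_def
    by (rule integral_pullback_divergence[OF C1b \<Psi> _ g R]) (use cut_eq_0[of "R/2" R] R N2 in \<open>auto simp: \<phi>_def\<close>)
  have s_bound: "K * (- s x) \<le> 1 / 2 * (\<phi> x ^ N * (w x * norm (G k x) ^ N)) + 2 ^ m * D ^ N" if x: "x \<in> cube R" for x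
  proof -
    \<comment> \<open>The field is at most om^(n - 1), so all factors combine to a ^ (n - 1).
      Young's inequality with parameter 1/2 yields half of a ^ n, the integrand of \<open>X\<close>,
      and a constant.\<close>
    define a where "a = \<phi> x * om (q x) * norm (G k x)"
    have a0: "0 \<le> a" using \<phi>01 om_pos[OF q0, of x] by (simp add: a_def)
    have nb: "norm (b (g k x)) \<le> om (q x) ^ (N - 1)"
    proof -
      have "norm (b (g k x)) = sqrt (q x) * (om (q x) ^ N * Llog (q x))"
        using om_pos[OF q0, of x] Llog_ge_1[OF q0, of x] by (simp add: b_def q_def abs_mult)
      then show ?thesis using log_field_bounds(3)[OF N2 q0, of x] by simp
    qed
    have "\<bar>s x\<bar> \<le> (\<Sum>i\<in>(UNIV :: 'n set). om (q x) ^ (N - 1) * (fact N * (norm (\<Psi> x) * norm (G k x) ^ (N - 1))))"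
      unfolding s_def
    proof (rule order_trans[OF sum_abs sum_mono])
      fix i
      have "\<bar>b (g k x) $ i\<bar> \<le> om (q x) ^ (N - 1)" using component_le_norm_cart[of "b (g k x)" i] nb by simp
      then show "\<bar>b (g k x) $ i * det (\<chi> j. if j = i then \<Psi> x else G k x $ j)\<bar> \<le> om (q x) ^ (N - 1) * (fact N * (norm (\<Psi> x) * norm (G k x) ^ (N - 1)))"
        unfolding abs_mult N_def by (intro mult_mono det_replace_row_bound) auto
    qed
    also have "\<dots> = real N * (om (q x) ^ m * (fact N * ((real N * \<phi> x ^ m * norm (\<Phi> x)) * norm (G k x) ^ m)))"
      using \<phi>01[of x] by (simp add: \<Psi>_def m abs_mult flip: N_def)
    also have "\<dots> = (real N)\<^sup>2 * fact N * norm (\<Phi> x) * a ^ m"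
      by (simp add: a_def power_mult_distrib power2_eq_square mult_ac)
    also have "\<dots> \<le> (real N)\<^sup>2 * fact N * B * a ^ m"
      using B(1)[OF x] a0 by (intro mult_right_mono mult_left_mono) auto
    finally have "K * \<bar>s x\<bar> \<le> K * ((real N)\<^sup>2 * fact N * B * a ^ m)" using K by (intro mult_left_mono) auto
    then have "K * (- s x) \<le> K * ((real N)\<^sup>2 * fact N * B * a ^ m)"
      using K abs_ge_minus_self[of "s x"] mult_left_mono[of "- s x" "\<bar>s x\<bar>" K] by linarith
    also have "\<dots> = D * a ^ m" by (simp add: D_def mult_ac)
    also have "\<dots> \<le> 1 / 2 * a ^ N + 2 ^ m * D ^ N"
      using young_split[OF D0 a0, of "1/2" m] by (simp add: m)
    finally show ?thesis by (simp add: a_def w_def power_mult_distrib mult_ac)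
  qed
  have ci: "continuous_on S (\<lambda>x. \<phi> x ^ N * (w x * norm (G k x) ^ N))" for S
    unfolding w_def by (intro continuous_intros c\<phi> co cG)
  have "X \<le> integral (cube R) (\<lambda>x. K * (\<phi> x ^ N * d x * J x) + c * (p (g k x) * \<bar>J x\<bar>) + (c + 1) * e k x)"
    unfolding X_def
  proof (rule integral_le)
    fix x :: "real ^ 'n"
    have f: "0 \<le> \<phi> x ^ N" "\<phi> x ^ N \<le> 1" using \<phi>01[of x] by (auto intro: power_le_one)
    have r0: "0 \<le> c * (p (g k x) * \<bar>J x\<bar>) + (c + 1) * e k x"
      using K p(2) e_nonneg[of k x] by (simp add: c_def)
    have "\<phi> x ^ N * (w x * norm (G k x) ^ N) \<le> \<phi> x ^ N * (K * (d x * J x) + c * (p (g k x) * \<bar>J x\<bar>) + (c + 1) * e k x)"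
      using pt f by (intro mult_left_mono)
    also have "\<dots> = K * (\<phi> x ^ N * d x * J x) + \<phi> x ^ N * (c * (p (g k x) * \<bar>J x\<bar>) + (c + 1) * e k x)"
      by (simp add: algebra_simps)
    also have "\<phi> x ^ N * (c * (p (g k x) * \<bar>J x\<bar>) + (c + 1) * e k x) \<le> c * (p (g k x) * \<bar>J x\<bar>) + (c + 1) * e k x"
      using f r0 by (simp add: mult_left_le_one_le)
    finally show "\<phi> x ^ N * (w x * norm (G k x) ^ N) \<le> K * (\<phi> x ^ N * d x * J x) + c * (p (g k x) * \<bar>J x\<bar>) + (c + 1) * e k x" by simp
  qed (intro integrable_cube ci continuous_intros c\<phi> cd cJ cp ce)+
  also have "\<dots> = K * integral (cube R) (\<lambda>x. \<phi> x ^ N * d x * J x) + c * integral (cube R) (\<lambda>x. p (g k x) * \<bar>J x\<bar>) + (c + 1) * integral (cube R) (e k)"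
  proof -
    have i1: "(\<lambda>x. K * (\<phi> x ^ N * d x * J x)) integrable_on cube R" and i2: "(\<lambda>x. c * (p (g k x) * \<bar>J x\<bar>)) integrable_on cube R"
      and i3: "(\<lambda>x. (c + 1) * e k x) integrable_on cube R"
      by (intro integrable_cube continuous_intros c\<phi> cd cJ cp ce)+
    show ?thesis by (simp add: integral_add[OF integrable_add[OF i1 i2] i3] integral_add[OF i1 i2])
  qed
  also have "K * integral (cube R) (\<lambda>x. \<phi> x ^ N * d x * J x) = integral (cube R) (\<lambda>x. K * (- s x))"
    unfolding id by simp
  also have "\<dots> \<le> integral (cube R) (\<lambda>x. 1 / 2 * (\<phi> x ^ N * (w x * norm (G k x) ^ N)) + 2 ^ m * D ^ N)"
    by (rule integral_le) (use s_bound in \<open>auto intro!: integrable_cube continuous_intros cs ci\<close>)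
  also have "\<dots> = 1 / 2 * X + 2 ^ m * D ^ N * (2 * R) ^ N"
  proof -
    have i1: "(\<lambda>x. 1 / 2 * (\<phi> x ^ N * (w x * norm (G k x) ^ N))) integrable_on cube R"
      and i2: "(\<lambda>x::real ^ 'n. 2 ^ m * D ^ N) integrable_on cube R"
      by (intro integrable_cube continuous_intros ci)+
    show ?thesis using R unfolding integral_add[OF i1 i2] X_def
      by (simp add: integral_cube_const N_def)
  qed
  finally have "1 / 2 * X \<le> 2 ^ m * D ^ N * (2 * R) ^ N + c * integral (cube R) (\<lambda>x. p (g k x) * \<bar>J x\<bar>) + (c + 1) * integral (cube R) (e k)"
    by simp
  also have "\<dots> \<le> 2 ^ m * D ^ N * (2 * R) ^ N + c * A + (c + 1) * 1"
    using A e1 K by (intro add_mono mult_left_mono order_refl) (auto simp: c_def J_def)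
  finally have X: "X \<le> 2 * (2 ^ m * D ^ N * (2 * R) ^ N + c * A + c + 1)" by simp
  have "integral (cube (R/2)) (\<lambda>x. (om (q x) * norm (G k x)) ^ N) = integral (cube (R/2)) (\<lambda>x. \<phi> x ^ N * (w x * norm (G k x) ^ N))"
  proof (rule integral_cong)
    fix x :: "real ^ 'n" assume "x \<in> cube (R/2)"
    then have "\<phi> x = 1" unfolding \<phi>_def using R by (intro cut_eq_1) auto
    then show "(om (q x) * norm (G k x)) ^ N = \<phi> x ^ N * (w x * norm (G k x) ^ N)"
      by (simp add: w_def power_mult_distrib)
  qed
  also have "\<dots> \<le> X" unfolding X_def
    by (rule integral_subset_le) (use R \<phi>01 w01 cube_mono[of "R/2" R] in \<open>auto intro!: integrable_cube ci\<close>)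
  also note X
  finally show ?thesis by (simp add: q_def N_def[symmetric] D_def c_def m mult_ac)
qed

end

section \<open>Small Jacobian integral forces small values\<close>

lemma measure_ball_scale:
  "0 \<le> r \<Longrightarrow> measure lebesgue (ball (0 :: real ^ 'n::finite) r) = measure lebesgue (ball (0 :: real ^ 'n) 1) * r ^ CARD('n)"
  using content_ball[of r "0 :: real ^ 'n"] content_ball[of 1 "0 :: real ^ 'n"] by simp

text \<open>A version, stable under the passage to the limit, of the statement that the Jacobian integral over
  \<open>{x. norm (f x) < M}\<close> is at most \<open>A\<close>.\<close>

definition jacobian_below :: "(nat \<Rightarrow> real ^ 'n::finite \<Rightarrow> real ^ 'n) \<Rightarrow> (nat \<Rightarrow> real ^ 'n \<Rightarrow> real ^ 'n ^ 'n) \<Rightarrow> real \<Rightarrow> real \<Rightarrow> real \<Rightarrow> bool" where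
  "jacobian_below g G R M A \<longleftrightarrow> (\<forall>p m. continuous_on UNIV p \<longrightarrow> (\<forall>y. 0 \<le> p y \<and> p y \<le> 1) \<longrightarrow> m < M \<longrightarrow>
    (\<forall>y. m \<le> norm y \<longrightarrow> p y = 0) \<longrightarrow>
    (\<forall>\<^sub>F k in sequentially. integral (cube R) (\<lambda>x. p (g k x) * \<bar>det (G k x)\<bar>) \<le> A))"

definition radial_cut :: "real \<Rightarrow> real \<Rightarrow> real ^ 'n::finite \<Rightarrow> real" where
  "radial_cut a b y = max 0 (min 1 ((b - norm y) / (b - a)))"

lemma radial_cut:
  assumes "a < b"
  shows "continuous_on S (radial_cut a b)" "0 \<le> radial_cut a b y" "radial_cut a b y \<le> 1"
    "norm y \<le> a \<Longrightarrow> radial_cut a b y = 1" "b \<le> norm y \<Longrightarrow> radial_cut a b y = 0"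
proof -
  show "continuous_on S (radial_cut a b)" unfolding radial_cut_def[abs_def]
    using assms by (intro continuous_intros) auto
qed (use assms in \<open>auto simp: radial_cut_def max_def min_def field_simps\<close>)

lemma integrable_compact:
  assumes "compact S" "continuous_on UNIV h"
  shows "(h :: real ^ 'n::finite \<Rightarrow> real) integrable_on S"
proof -
  have "set_integrable lborel S h"
    unfolding set_integrable_def
    by (rule borel_integrable_compact) (use assms in \<open>auto intro: continuous_on_subset\<close>)
  then show ?thesis by (rule set_borel_integral_eq_integral(1))
qed

lemma jacobian_belowD:
  assumes "jacobian_below g G R M A" "a < b" "b < M"
  shows "\<forall>\<^sub>F k in sequentially. integral (cube R) (\<lambda>x. radial_cut a b (g k x) * \<bar>det (G k x)\<bar>) \<le> A"
proof -
  have "continuous_on UNIV (radial_cut a b :: real ^ 'a \<Rightarrow> real)" "\<forall>y::real ^ 'a. 0 \<le> radial_cut a b y \<and> radial_cut a b y \<le> 1"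
    "\<forall>y::real ^ 'a. b \<le> norm y \<longrightarrow> radial_cut a b y = 0"
    using radial_cut[OF assms(2)] by auto
  with assms(1,3) show ?thesis unfolding jacobian_below_def by blast
qed

context qr_approx
begin

text \<open>If |f| \<ge> M on the whole boundary, then g_k eventually covers the ball of any radius
  m < M, and the area inequality makes the Jacobian integral over |g_k| \<le> m at least the volume
  of that ball. This exceeds \<open>A\<close> once m is close to M.\<close>

lemma boundary_point_below:
  assumes c: "0 < c" "c \<le> R" and f0: "f 0 = 0" and M: "0 < M"
    and A: "A < measure lebesgue (ball (0 :: real ^ 'n) 1) * M ^ CARD('n)"
    and J: "jacobian_below g G R M A"
  shows "\<exists>x\<in>cubeb c. norm (f x) < M"
proof (rule ccontr)
  assume "\<not> ?thesis"
  then have bd: "\<And>x. x \<in> cubeb c \<Longrightarrow> M \<le> norm (f x)" by (auto simp: not_less)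
  have "((\<lambda>m. measure lebesgue (ball (0 :: real ^ 'n) 1) * m ^ CARD('n)) \<longlongrightarrow> measure lebesgue (ball (0 :: real ^ 'n) 1) * M ^ CARD('n)) (at_left M)"
    by (intro tendsto_intros)
  then have "\<forall>\<^sub>F m in at_left M. A < measure lebesgue (ball (0 :: real ^ 'n) 1) * m ^ CARD('n)"
    using A by (rule order_tendstoD)
  moreover have "\<forall>\<^sub>F m in at_left M. m \<in> {0<..<M}" using M by (rule eventually_at_leftI[rotated]) auto
  ultimately have "\<forall>\<^sub>F m in at_left M. A < measure lebesgue (ball (0 :: real ^ 'n) 1) * m ^ CARD('n) \<and> 0 < m \<and> m < M"
    by eventually_elim auto
  then obtain m where m: "A < measure lebesgue (ball (0 :: real ^ 'n) 1) * m ^ CARD('n)" "0 < m" "m < M"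
    using eventually_happens'[OF trivial_limit_at_left_real] by blast
  define b where "b = (m + M) / 2"
  have b: "m < b" "b < M" using m by (auto simp: b_def)
  have "\<forall>\<^sub>F k in sequentially. ball 0 m \<subseteq> g k ` cube c \<and> integral (cube R) (\<lambda>x. radial_cut m b (g k x) * \<bar>det (G k x)\<bar>) \<le> A"
    by (intro eventually_conj eventually_covers[OF c bd f0 m(2,3)] jacobian_belowD[OF J b])
  then obtain k where k: "ball 0 m \<subseteq> g k ` cube c" "integral (cube R) (\<lambda>x. radial_cut m b (g k x) * \<bar>det (G k x)\<bar>) \<le> A"
    using eventually_happens'[OF sequentially_bot] by blast
  \<comment> \<open>Only points with values in the closed ball are kept: \<open>S\<close> stays
    compact, its image still contains the open ball, and the radial cutoff is 1 on it.\<close>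
  define S where "S = {x \<in> cube c. norm (g k x) \<le> m}"
  have "closed S" unfolding S_def
    by (intro continuous_on_closed_Collect_le continuous_intros cg closed_cube)
  moreover have "S = cube c \<inter> S" by (auto simp: S_def)
  ultimately have S: "compact S" using compact_Int_closed[OF compact_cube[of c]] by metis
  have SR: "S \<subseteq> cube R" using cube_mono[OF c(2)] by (auto simp: S_def)
  have cp: "continuous_on U (\<lambda>x. radial_cut m b (g k x))" for U
    by (rule continuous_on_compose2[OF radial_cut(1)[OF b(1), of UNIV] cg]) auto
  have cpJ: "continuous_on U (\<lambda>x. radial_cut m b (g k x) * \<bar>det (G k x)\<bar>)" for U by (intro continuous_intros cp cG)
  have "measure lebesgue (ball (0 :: real ^ 'n) 1) * m ^ CARD('n) = measure lebesgue (ball (0 :: real ^ 'n) m)"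
    using m by (intro measure_ball_scale[symmetric]) simp
  also have "\<dots> \<le> measure lebesgue (g k ` S)"
  proof (rule measure_mono_fmeasurable)
    have "y \<in> g k ` S" if "norm y < m" for y
    proof -
      have "y \<in> ball 0 m" using that by simp
      then obtain x where "x \<in> cube c" "y = g k x" using k(1) by blast
      then show ?thesis using that by (auto simp: S_def)
    qed
    then show "ball 0 m \<subseteq> g k ` S" by auto
    show "g k ` S \<in> lmeasurable" by (intro lmeasurable_compact compact_continuous_image cg S)
  qed auto
  also have "\<dots> \<le> integral S (\<lambda>x. \<bar>det (G k x)\<bar>)" by (rule measure_C1_image_le[OF g S])
  also have "\<dots> = integral S (\<lambda>x. radial_cut m b (g k x) * \<bar>det (G k x)\<bar>)"
    by (rule integral_cong) (use radial_cut(4)[OF b(1)] in \<open>auto simp: S_def\<close>)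
  also have "\<dots> \<le> integral (cube R) (\<lambda>x. radial_cut m b (g k x) * \<bar>det (G k x)\<bar>)"
    by (intro integral_subset_le SR integrable_compact[OF S] integrable_cube cpJ)
       (use radial_cut(2)[OF b(1)] in \<open>auto intro!: mult_nonneg_nonneg\<close>)
  also have "\<dots> \<le> A" by (rule k(2))
  finally show False using m(1) by simp
qed

end

lemma nn_integral_cube_le:
  fixes h :: "real ^ 'n::finite \<Rightarrow> real"
  assumes "continuous_on UNIV h" "\<And>x. 0 \<le> h x" "integral (cube r) h \<le> E"
  shows "(\<integral>\<^sup>+x. indicator (cube r) x * ennreal (h x) \<partial>lborel) \<le> ennreal E"
  unfolding nn_integral_cube_eq[OF assms(1,2)] using assms(3) by (rule ennreal_leI)

text \<open>Among \<open>N\<close> dyadic shells one carries at most the \<open>N\<close>-th part of the energy.\<close>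

lemma exists_small_shell:
  fixes h :: "real ^ 'n::finite \<Rightarrow> real"
  assumes h: "continuous_on UNIV h" "\<And>x. 0 \<le> h x" and r: "0 < r" and E: "integral (cube r) h < real N * E"
    and E0: "0 \<le> E"
  shows "\<exists>i<N. (\<integral>\<^sup>+x. indicator (cube (r / 2 ^ i) - cube (r / 2 ^ i / 2)) x * ennreal (h x) \<partial>lborel) \<le> ennreal E"
proof (rule ccontr)
  assume neg: "\<not> ?thesis"
  define A where "A i = (cube (r / 2 ^ i) - cube (r / 2 ^ i / 2) :: (real ^ 'n) set)" for i :: nat
  have [measurable]: "h \<in> borel_measurable borel" "A i \<in> sets borel" "cube s \<in> sets (borel :: (real ^ 'n) measure)" for i s
    using borel_measurable_continuous_onI[OF h(1)] by (auto simp: A_def borel_closed)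
  have dec: "cube (r / 2 ^ j) \<subseteq> cube (r / 2 ^ i / 2)" if "i < j" for i j :: nat
  proof (rule cube_mono)
    have "(2::real) ^ Suc i \<le> 2 ^ j" using that by (intro power_increasing) auto
    then show "r / 2 ^ j \<le> r / 2 ^ i / 2" using r by (simp add: field_simps)
  qed
  have disj: "disjoint_family_on A {..<N}"
  proof -
    have "A i \<inter> A j = {}" if "i < j" for i j using dec[OF that] unfolding A_def by blast
    then show ?thesis unfolding disjoint_family_on_def by (metis inf_commute linorder_neqE_nat)
  qed
  have "ennreal (real N * E) = (\<Sum>i<N. ennreal E)"
    using E0 by (simp add: ennreal_mult' ennreal_of_nat_eq_real_of_nat)
  also have "\<dots> \<le> (\<Sum>i<N. (\<integral>\<^sup>+x. indicator (A i) x * ennreal (h x) \<partial>lborel))"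
    using neg unfolding A_def by (intro sum_mono) (auto simp: not_le intro: less_imp_le)
  also have "\<dots> = (\<integral>\<^sup>+x. (\<Sum>i<N. indicator (A i) x * ennreal (h x)) \<partial>lborel)"
    by (rule nn_integral_sum[symmetric]) measurable
  also have "\<dots> \<le> (\<integral>\<^sup>+x. indicator (cube r) x * ennreal (h x) \<partial>lborel)"
  proof (rule nn_integral_mono)
    fix x
    have sub: "(\<Union>i<N. A i) \<subseteq> cube r"
    proof -
      have "A i \<subseteq> cube r" for i
      proof -
        have "r / 2 ^ i \<le> r" using r by (simp add: divide_le_eq)
        then show ?thesis using cube_mono[of "r / 2 ^ i" r] unfolding A_def by blast
      qed
      then show ?thesis by blast
    qed
    have "(\<Sum>i<N. indicator (A i) x * ennreal (h x)) = (\<Sum>i<N. indicator (A i) x) * ennreal (h x)"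
      by (simp add: sum_distrib_right)
    also have "(\<Sum>i<N. indicator (A i) x) = (indicator (\<Union>i<N. A i) x :: ennreal)"
      by (rule indicator_UN_disjoint[symmetric]) (auto simp: disj)
    also have "\<dots> * ennreal (h x) \<le> indicator (cube r) x * ennreal (h x)"
      using sub by (intro mult_right_mono) (auto simp: indicator_def)
    finally show "(\<Sum>i<N. indicator (A i) x * ennreal (h x)) \<le> indicator (cube r) x * ennreal (h x)" .
  qed
  also have "\<dots> = ennreal (integral (cube r) h)" by (rule nn_integral_cube_eq[OF h])
  finally have "real N * E \<le> integral (cube r) h"
    by (subst (asm) ennreal_le_iff) (auto intro!: integral_nonneg integrable_cube continuous_on_subset[OF h(1)] h(2))
  with E show False by simp
qed

text \<open>Two passes. The energy estimate bounds the oscillation of \<open>ln (Llog ((norm f)\<^sup>2))\<close> on the boundary of some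
  cube; as \<open>norm f\<close> is below \<open>5\<close> somewhere on it, \<open>f\<close> is bounded by a constant inside. There the estimate
  controls the energy of \<open>f\<close> itself, so that \<open>f\<close> oscillates little on the boundary of a cube whose size
  is bounded below.\<close>

lemma uniform_smallness:
  fixes K R :: real
  assumes n: "CARD('n::finite) \<ge> 2" and K: "1 \<le> K" and R: "0 < R"
  shows "\<exists>r>0. r \<le> R \<and> (\<forall>g G (f :: real ^ 'n \<Rightarrow> real ^ 'n) A. qr_approx g G f K R \<longrightarrow> f 0 = 0 \<longrightarrow>
    A < measure lebesgue (ball (0 :: real ^ 'n) 1) * 5 ^ CARD('n) \<longrightarrow> jacobian_below g G R 5 A \<longrightarrow>
    (\<forall>x\<in>cube r. norm (f x) \<le> 2))"
proof -
  define N where "N = CARD('n)"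
  have N: "2 \<le> N" using n by (simp add: N_def)
  obtain \<Phi> where \<Phi>: "has_grad (cut (R/2) R :: real ^ 'n \<Rightarrow> real) \<Phi>" using cut_grad by blast
  have "compact (\<Phi> ` cube R)" by (intro compact_continuous_image has_grad_cont_grad[OF \<Phi>]) auto
  then obtain B where B: "0 < B" "\<And>x. x \<in> cube R \<Longrightarrow> norm (\<Phi> x) \<le> B"
    by (metis bounded_pos compact_imp_bounded image_eqI)
  define \<alpha> where "\<alpha> = measure lebesgue (ball (0 :: real ^ 'n) 1) * 5 ^ N"
  have \<alpha>: "0 \<le> \<alpha>" by (simp add: \<alpha>_def)
  \<comment> \<open>The right-hand side of \<open>energy_estimate\<close> with \<open>A\<close>
    replaced by its upper bound \<alpha>. No constant defined here involves f, which is the required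
    uniformity.\<close>
  define E where "E = 2 * (2 ^ (N - 1) * (K * (real N)\<^sup>2 * fact N * B) ^ N * (2 * R) ^ N
      + K * (2 * real N + 1) * \<alpha> + K * (2 * real N + 1) + 1)"
  \<comment> \<open>The factor 2 ^ N arises because the gradient of ln (Llog (|y|^2)) is bounded by
    2 om. The maximum with 1 ensures \<kappa> \<le> \<kappa> ^ N.\<close>
  define \<kappa> where "\<kappa> = max 1 (2 ^ N * E)"
  have \<kappa>: "1 \<le> \<kappa>" "2 ^ N * E \<le> \<kappa> ^ N"
    using power_increasing[of 1 N \<kappa>] N by (auto simp: \<kappa>_def)
  define \<Omega> where "\<Omega> = osc_const N * \<kappa>"
  \<comment> \<open>\<open>Qm\<close> undoes both logarithms: ln (Llog q) \<le> \<Omega> + ln (Llog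
    36) implies q \<le> \<open>Qm\<close>. The value 36 = 6^2 bounds |g|^2 at a boundary point where
    |f| < 5 and |g - f| < 1/4.\<close>
  define Qm where "Qm = exp (exp \<Omega> * Llog 36)"
  define M2 where "M2 = sqrt Qm + 1"
  have M2: "0 \<le> M2" by (simp add: M2_def Qm_def)
  \<comment> \<open>As \<open>om\<close> decreases, \<open>o2\<close> bounds the weight from below
    wherever |g| \<le> M2 + 1; dividing by \<open>o2 ^ N\<close> turns weighted energy into the
    energy of g.\<close>
  define o2 where "o2 = om ((M2 + 1)\<^sup>2)"
  have o2: "0 < o2" unfolding o2_def by (rule om_pos) simp
  define E2 where "E2 = E / o2 ^ N"
  \<comment> \<open>Chosen so that the oscillations of the n components of g add up to 1/2; with two
    approximation errors of 1/4 this makes f oscillate by at most 1.\<close>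
  define \<kappa>2 where "\<kappa>2 = 1 / (2 * real N * osc_const N)"
  have oc: "0 < osc_const N" using N by (intro osc_const_pos) simp
  have \<kappa>2: "0 < \<kappa>2" using oc N by (simp add: \<kappa>2_def)
  obtain T :: nat where T: "E2 / \<kappa>2 ^ N < real T" using reals_Archimedean2 by blast
  have TE: "E2 < real T * \<kappa>2 ^ N" using T \<kappa>2 by (simp add: field_simps)
  \<comment> \<open>The shell found below has an index i < T, and the good cube inside it has
    half-side above R / 4 / 2^(i + 1), which is at least r.\<close>
  define r where "r = R / 4 / 2 ^ T"
  have r: "0 < r" "r \<le> R"
  proof -
    show "0 < r" using R by (simp add: r_def)
    have "1 \<le> (2::real) ^ T" by (rule one_le_power) simp
    then have "1 \<le> (4::real) * 2 ^ T" by linarith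
    then show "r \<le> R" using R by (simp add: r_def divide_le_eq)
  qed
  have "norm (f x) \<le> 2"
    if "qr_approx g G f K R" and f0: "f 0 = 0" and A: "A < \<alpha>" and J: "jacobian_below g G R 5 A" and x: "x \<in> cube r"
    for g G and f :: "real ^ 'n \<Rightarrow> real ^ 'n" and A x
  proof -
    interpret qr_approx g G f K R by fact
    \<comment> \<open>The cutoff is 1 for |y| \<le> 4, as the energy estimate requires, and vanishes
      from 9/2 < 5 on, as \<open>jacobian_below\<close> requires.\<close>
    have J5: "\<forall>\<^sub>F k in sequentially. integral (cube R) (\<lambda>x. radial_cut 4 (9/2) (g k x) * \<bar>det (G k x)\<bar>) \<le> A"
      by (rule jacobian_belowD[OF J]) auto
    have e1: "\<forall>\<^sub>F k in sequentially. integral (cube R) (e k) < 1"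
      using err' by (rule order_tendstoD) simp
    have close: "\<forall>\<^sub>F k in sequentially. \<forall>x\<in>cube R. dist (g k x) (f x) < 1 / 4"
      using lim[unfolded uniform_limit_iff, rule_format, of "1/4"] by simp
    define h where "h k x = (om ((norm (g k x))\<^sup>2) * norm (G k x)) ^ N" for k x
    have co: "continuous_on S (\<lambda>x. om ((norm (g k x))\<^sup>2))" for S k
      by (rule continuous_on_compose2[OF continuous_on_om]) (auto intro!: continuous_intros cg)
    have ch: "continuous_on S (h k)" for S k unfolding h_def by (intro continuous_intros co cG)
    have h0: "0 \<le> h k x" for k x unfolding h_def using om_pos[of "(norm (g k x))\<^sup>2"] by simp
    have en: "\<forall>\<^sub>F k in sequentially. integral (cube (R/2)) (h k) \<le> E"
      using J5 e1
    proof eventually_elim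
      case (elim k)
      have "integral (cube R) (\<lambda>x. radial_cut 4 (9/2) (g k x) * \<bar>det (G k x)\<bar>) \<le> \<alpha>" using elim(1) A by simp
      from energy_estimate[OF \<Phi> B(2) less_imp_le[OF B(1)] radial_cut(1) radial_cut(2) radial_cut(4) this less_imp_le[OF elim(2)]]
      show ?case by (simp add: h_def[abs_def] E_def N_def)
    qed
    obtain k1 where k1: "integral (cube (R/2)) (h k1) \<le> E" "\<forall>x\<in>cube R. dist (g k1 x) (f x) < 1 / 4"
      using eventually_happens'[OF sequentially_bot eventually_conj[OF en close]] by blast
    define u where "u x = ln (Llog ((norm (g k1 x - 0))\<^sup>2))" for x
    have p1: "((\<lambda>q. ln (Llog q)) has_real_derivative 1 / (Llog q * (1 + q))) (at q)" if "q \<in> {0..}" for q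
    proof -
      have "0 < Llog q" using Llog_ge_1[of q] that by simp
      then show ?thesis unfolding Llog_def using that by (auto intro!: derivative_eq_intros simp: divide_simps)
    qed
    have p2: "continuous_on {0..} (\<lambda>q. 1 / (Llog q * (1 + q)))"
      by (intro continuous_intros continuous_on_Llog) (use Llog_ge_1 in force)
    define U where "U x = ((1 / (Llog ((norm (g k1 x - 0))\<^sup>2) * (1 + (norm (g k1 x - 0))\<^sup>2))) *\<^sub>R 2 *\<^sub>R (g k1 x - 0)) v* G k1 x" for x
    have u: "has_grad u U"
      unfolding u_def[abs_def] U_def[abs_def]
      by (rule has_grad_chain[OF has_grad_compose_on[OF p1 p2 has_grad_norm2] g]) auto
    have Ub: "norm (U x) ^ N \<le> 2 ^ N * h k1 x" for x
    proof -
      define q where "q = (norm (g k1 x))\<^sup>2"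
      have q: "0 \<le> q" "1 \<le> Llog q" using Llog_ge_1[of q] by (auto simp: q_def)
      have "norm ((1 / (Llog q * (1 + q))) *\<^sub>R 2 *\<^sub>R (g k1 x)) = 2 * (sqrt q / (Llog q * (1 + q)))"
        using q by (simp add: q_def)
      also have "sqrt q / (Llog q * (1 + q)) \<le> om q"
      proof -
        have "1 + q = sqrt (1 + q) * sqrt (1 + q)" using q by simp
        then have "sqrt q / (Llog q * (1 + q)) = om q * (sqrt q / sqrt (1 + q))"
          unfolding om_def by (metis (no_types, opaque_lifting) mult.assoc mult.commute mult.left_neutral times_divide_times_eq)
        also have "\<dots> \<le> om q * 1" using q om_pos[of q] by (intro mult_left_mono) (auto simp: divide_le_eq)
        finally show ?thesis by simp
      qed
      finally have "norm (U x) \<le> 2 * om q * norm (G k1 x)"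
        unfolding U_def using order_trans[OF norm_vector_matrix_le mult_right_mono[of _ "2 * om q" "norm (G k1 x)"]]
        by (simp add: q_def)
      then have "norm (U x) ^ N \<le> (2 * om q * norm (G k1 x)) ^ N" by (intro power_mono) auto
      then show ?thesis by (simp add: h_def q_def power_mult_distrib)
    qed
    have h2: "0 \<le> 2 ^ N * h k1 z" for z by (rule mult_nonneg_nonneg[OF _ h0]) simp
    have "(\<integral>\<^sup>+z. indicator (cube (R/2) - cube (R/2/2)) z * ennreal (2 ^ N * h k1 z) \<partial>lborel)
      \<le> (\<integral>\<^sup>+z. indicator (cube (R/2)) z * ennreal (2 ^ N * h k1 z) \<partial>lborel)"
      by (intro nn_integral_mono mult_right_mono) (auto simp: indicator_def)
    also have "\<dots> \<le> ennreal (\<kappa> ^ N)"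
    proof (rule nn_integral_cube_le)
      have "2 ^ N * integral (cube (R/2)) (h k1) \<le> 2 ^ N * E" using k1(1) by (intro mult_left_mono) auto
      then show "integral (cube (R/2)) (\<lambda>z. 2 ^ N * h k1 z) \<le> \<kappa> ^ N"
        using order_trans[OF _ \<kappa>(2)] by (simp only: integral_mult_right)
    qed (auto intro!: continuous_intros ch h2)
    finally have "\<exists>c\<in>{R/2/2<..R/2}. \<forall>u U. has_grad u U \<longrightarrow> (\<forall>x\<in>cube (R/2). norm (U x) ^ CARD('n) \<le> 2 ^ N * h k1 x) \<longrightarrow>
      (\<forall>x\<in>cubeb c. \<forall>y\<in>cubeb c. \<bar>u x - u y\<bar> \<le> osc_const CARD('n) * \<kappa>)"
      unfolding N_def
      by (intro cube_boundary_osc n) (use R \<kappa> h2[unfolded N_def] in \<open>auto intro!: continuous_intros ch\<close>)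
    then obtain c where c: "R/4 < c" "c \<le> R/2" and osc: "\<And>x y. x \<in> cubeb c \<Longrightarrow> y \<in> cubeb c \<Longrightarrow> \<bar>u x - u y\<bar> \<le> \<Omega>"
      using u Ub unfolding \<Omega>_def N_def by (auto simp: field_simps)
    have c': "0 < c" "c \<le> R" using c R by auto
    obtain x0 where x0: "x0 \<in> cubeb c" "norm (f x0) < 5"
      using boundary_point_below[OF c' f0 _ _ J] A by (auto simp: \<alpha>_def N_def)
    have fM: "norm (f y) \<le> M2" if y: "y \<in> cubeb c" for y
    proof -
      have yR: "y \<in> cube R" "x0 \<in> cube R" using y x0 cubeb_subset cube_mono[OF c'(2)] by blast+
      have d: "norm (g k1 y - f y) < 1/4" "norm (g k1 x0 - f x0) < 1/4" using k1(2) yR by (auto simp: dist_norm)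
      then have "norm (g k1 x0) \<le> 6" using norm_triangle_sub[of "g k1 x0" "f x0"] x0 by simp
      then have "(norm (g k1 x0))\<^sup>2 \<le> 6\<^sup>2" by (intro power_mono) auto
      then have L0: "Llog ((norm (g k1 x0))\<^sup>2) \<le> Llog 36" by (intro Llog_mono) auto
      define q where "q = (norm (g k1 y))\<^sup>2"
      have q: "0 \<le> q" "1 \<le> Llog q" using Llog_ge_1[of q] by (auto simp: q_def)
      have Lx: "1 \<le> Llog ((norm (g k1 x0))\<^sup>2)" by (rule Llog_ge_1) simp
      have "ln (Llog q) \<le> \<Omega> + ln (Llog ((norm (g k1 x0))\<^sup>2))" using osc[OF y x0(1)] by (simp add: u_def q_def)
      also have "\<dots> \<le> \<Omega> + ln (Llog 36)" using L0 Lx by simp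
      finally have "exp (ln (Llog q)) \<le> exp (\<Omega> + ln (Llog 36))" by simp
      then have "Llog q \<le> exp \<Omega> * Llog 36" using q Llog_ge_1[of 36] by (simp add: exp_add)
      then have "ln (1 + q) \<le> exp \<Omega> * Llog 36" by (simp add: Llog_def)
      then have "exp (ln (1 + q)) \<le> Qm" unfolding Qm_def by simp
      then have "q \<le> Qm" using q by simp
      then have "norm (g k1 y) \<le> sqrt Qm" by (simp add: q_def real_le_rsqrt)
      then show ?thesis using d(1) norm_triangle_sub[of "f y" "g k1 y"] by (simp add: M2_def norm_minus_commute)
    qed
    have fM2: "norm (f y) \<le> M2" if "y \<in> cube (R/4)" for y
    proof -
      have "y \<in> cube c" using that cube_mono[of "R/4" c] c by auto
      then show ?thesis using maximum_principle[OF c' M2, of 0] fM by simp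
    qed
    obtain k2 where k2: "integral (cube (R/2)) (h k2) \<le> E" "\<forall>x\<in>cube R. dist (g k2 x) (f x) < 1 / 4"
      using eventually_happens'[OF sequentially_bot eventually_conj[OF en close]] by blast
    have cn: "continuous_on S (\<lambda>x. norm (G k2 x) ^ N)" for S by (intro continuous_intros cG)
    have "integral (cube (R/4)) (\<lambda>x. o2 ^ N * norm (G k2 x) ^ N) \<le> integral (cube (R/4)) (h k2)"
    proof (rule integral_le)
      fix y :: "real ^ 'n" assume y: "y \<in> cube (R/4)"
      then have "y \<in> cube R" using cube_mono[of "R/4" R] R by auto
      then have "norm (g k2 y - f y) < 1/4" using k2(2) by (auto simp: dist_norm)
      then have "norm (g k2 y) \<le> M2 + 1" using norm_triangle_sub[of "g k2 y" "f y"] fM2[OF y] by simp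
      then have "(norm (g k2 y))\<^sup>2 \<le> (M2 + 1)\<^sup>2" by (intro power_mono) auto
      then have "o2 \<le> om ((norm (g k2 y))\<^sup>2)" unfolding o2_def by (intro om_antimono) auto
      then show "o2 ^ N * norm (G k2 y) ^ N \<le> h k2 y"
        unfolding h_def power_mult_distrib[symmetric] using o2 by (intro power_mono mult_right_mono) auto
    qed (auto intro!: integrable_cube continuous_intros cn ch)
    also have "\<dots> \<le> integral (cube (R/2)) (h k2)"
      by (rule integral_subset_le) (use R h0 cube_mono[of "R/4" "R/2"] in \<open>auto intro!: integrable_cube ch\<close>)
    also have "\<dots> \<le> E" by (rule k2(1))
    finally have "o2 ^ N * integral (cube (R/4)) (\<lambda>x. norm (G k2 x) ^ N) \<le> E" by simp
    then have "integral (cube (R/4)) (\<lambda>x. norm (G k2 x) ^ N) \<le> E2" using o2 by (simp add: E2_def field_simps)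
    also note TE
    finally have "\<exists>i<T. (\<integral>\<^sup>+x. indicator (cube (R/4 / 2 ^ i) - cube (R/4 / 2 ^ i / 2)) x * ennreal (norm (G k2 x) ^ N) \<partial>lborel) \<le> ennreal (\<kappa>2 ^ N)"
      by (intro exists_small_shell cn) (use R \<kappa>2 in auto)
    then obtain i where i: "i < T" "(\<integral>\<^sup>+x. indicator (cube (R/4 / 2 ^ i) - cube (R/4 / 2 ^ i / 2)) x * ennreal (norm (G k2 x) ^ N) \<partial>lborel) \<le> ennreal (\<kappa>2 ^ N)"
      by blast
    define \<rho> where "\<rho> = R/4 / 2 ^ i"
    have \<rho>: "0 < \<rho>" "\<rho> \<le> R"
    proof -
      show "0 < \<rho>" using R by (simp add: \<rho>_def)
      have "1 \<le> (2::real) ^ i" by (rule one_le_power) simp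
      then have "1 \<le> (4::real) * 2 ^ i" by linarith
      then show "\<rho> \<le> R" using R by (simp add: \<rho>_def divide_le_eq)
    qed
    have "\<exists>c\<in>{\<rho>/2<..\<rho>}. \<forall>u U. has_grad u U \<longrightarrow> (\<forall>x\<in>cube \<rho>. norm (U x) ^ CARD('n) \<le> norm (G k2 x) ^ N) \<longrightarrow>
      (\<forall>x\<in>cubeb c. \<forall>y\<in>cubeb c. \<bar>u x - u y\<bar> \<le> osc_const CARD('n) * \<kappa>2)"
    proof (rule cube_boundary_osc[OF n cn _ \<rho>(1) \<kappa>2])
      show "(\<integral>\<^sup>+z. indicator (cube \<rho> - cube (\<rho>/2)) z * ennreal (norm (G k2 z) ^ N) \<partial>lborel) \<le> ennreal (\<kappa>2 ^ CARD('n))"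
        using i(2) unfolding \<rho>_def N_def .
    qed simp
    then obtain c2 where c2: "\<rho>/2 < c2" "c2 \<le> \<rho>" and osc2: "\<And>u U x y. has_grad u U \<Longrightarrow> (\<And>x. norm (U x) ^ N \<le> norm (G k2 x) ^ N) \<Longrightarrow>
      x \<in> cubeb c2 \<Longrightarrow> y \<in> cubeb c2 \<Longrightarrow> \<bar>u x - u y\<bar> \<le> osc_const N * \<kappa>2"
      unfolding N_def by (metis greaterThanAtMost_iff)
    have c2': "0 < c2" "c2 \<le> R" using c2 \<rho> by auto
    have og: "norm (g k2 y - g k2 z) \<le> 1 / 2" if yz: "y \<in> cubeb c2" "z \<in> cubeb c2" for y z
    proof -
      have "\<bar>g k2 y $ j - g k2 z $ j\<bar> \<le> osc_const N * \<kappa>2" for j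
        by (rule osc2[OF C1_map_grad[OF g]]) (use yz in \<open>auto intro!: power_mono Finite_Cartesian_Product.norm_nth_le\<close>)
      then have "(\<Sum>j\<in>UNIV. \<bar>(g k2 y - g k2 z) $ j\<bar>) \<le> real N * (osc_const N * \<kappa>2)"
        unfolding N_def using sum_bounded_above[of UNIV "\<lambda>j. \<bar>(g k2 y - g k2 z) $ j\<bar>"] by simp
      also have "\<dots> = 1 / 2" using oc N by (simp add: \<kappa>2_def)
      finally show ?thesis using norm_le_l1_cart[of "g k2 y - g k2 z"] by simp
    qed
    obtain p :: "real ^ 'n" where p: "p \<in> cubeb c2" using cubeb_nonempty[OF c2'(1)] by blast
    have fp: "norm (f y - f p) \<le> 1" if y: "y \<in> cubeb c2" for y
    proof -
      have yR: "y \<in> cube R" "p \<in> cube R" using y p cubeb_subset cube_mono[OF c2'(2)] by blast+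
      have d: "norm (g k2 y - f y) < 1/4" "norm (g k2 p - f p) < 1/4" using k2(2) yR by (auto simp: dist_norm)
      have "f y - f p = (g k2 y - g k2 p) - (g k2 y - f y) + (g k2 p - f p)" by simp
      then have "norm (f y - f p) \<le> norm ((g k2 y - g k2 p) - (g k2 y - f y)) + norm (g k2 p - f p)"
        by (metis norm_triangle_ineq)
      also have "norm ((g k2 y - g k2 p) - (g k2 y - f y)) \<le> norm (g k2 y - g k2 p) + norm (g k2 y - f y)"
        by (rule norm_triangle_ineq4)
      finally show ?thesis using d og[OF y p] by simp
    qed
    have fc: "norm (f y - f p) \<le> 1" if "y \<in> cube c2" for y
      by (rule maximum_principle[OF c2' _ fp that]) auto
    \<comment> \<open>The origin lies in every cube, so f 0 = 0 anchors the oscillation bound: |f p|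
      \<le> 1, and then |f| \<le> 2 on the cube.\<close>
    have "norm (f 0 - f p) \<le> 1" by (rule fc) (use c2' in auto)
    then have p1: "norm (f p) \<le> 1" by (simp add: f0)
    have "x \<in> cube c2"
    proof -
      have "r \<le> \<rho> / 2"
      proof -
        have "(2::real) ^ Suc i \<le> 2 ^ T" using i(1) by (intro power_increasing) auto
        then show ?thesis using R by (simp add: r_def \<rho>_def field_simps)
      qed
      then show ?thesis using x cube_mono[of r c2] c2 by auto
    qed
    from fc[OF this] p1 show ?thesis using norm_triangle_sub[of "f x" "f p"] by simp
  qed
  then show ?thesis using r unfolding \<alpha>_def N_def by blast
qed

section \<open>Smooth kernels\<close>

text \<open>The factor \<open>1 / s ^ m\<close> makes the span of the family closed under differentiation.\<close>

definition flat :: "nat \<Rightarrow> real \<Rightarrow> real" where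
  "flat m s = (if 0 < s then exp (- 1 / s) / s ^ m else 0)"

lemma flat_tendsto_0: "((\<lambda>s. exp (- 1 / s) / s ^ m) \<longlongrightarrow> 0) (at_right (0::real))"
proof -
  have "((\<lambda>x::real. x ^ m / exp x) \<longlongrightarrow> 0) at_top" by (rule tendsto_power_div_exp_0)
  from filterlim_compose[OF this filterlim_inverse_at_top_right]
  have "((\<lambda>s::real. inverse s ^ m / exp (inverse s)) \<longlongrightarrow> 0) (at_right 0)" .
  moreover have "inverse s ^ m / exp (inverse s) = exp (- 1 / s) / s ^ m" for s :: real
    by (simp add: divide_inverse exp_minus power_inverse mult.commute)
  ultimately show ?thesis by simp
qed

lemma flat_deriv: "(flat m has_real_derivative flat (m + 2) s - real m * flat (m + 1) s) (at s)"
proof (cases "s = 0")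
  case True
  have "((\<lambda>h. (flat m (0 + h) - flat m 0) / h) \<longlongrightarrow> 0) (at 0)"
    unfolding filterlim_at_split
  proof
    have "\<forall>\<^sub>F h in at_left 0. (flat m (0 + h) - flat m 0) / h = 0"
      by (rule eventually_at_leftI[of "-1"]) (auto simp: flat_def)
    then show "((\<lambda>h. (flat m (0 + h) - flat m 0) / h) \<longlongrightarrow> 0) (at_left 0)" by (rule tendsto_eventually)
    have "\<forall>\<^sub>F h::real in at_right 0. exp (- 1 / h) / h ^ Suc m = (flat m (0 + h) - flat m 0) / h"
      by (rule eventually_at_rightI[of _ 1]) (auto simp: flat_def)
    with flat_tendsto_0[of "Suc m"] show "((\<lambda>h. (flat m (0 + h) - flat m 0) / h) \<longlongrightarrow> 0) (at_right 0)"
      by (rule Lim_transform_eventually)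
  qed
  then show ?thesis using True by (simp add: DERIV_def flat_def)
next
  case False
  show ?thesis
  proof (cases "0 < s")
    case True
    have "((\<lambda>s. exp (- 1 / s) / s ^ m) has_real_derivative flat (m + 2) s - real m * flat (m + 1) s) (at s)"
    proof (cases m)
      case 0
      then show ?thesis using True
        by (auto intro!: derivative_eq_intros simp: flat_def power2_eq_square)
    next
      case (Suc l)
      then show ?thesis using True
        by (auto intro!: derivative_eq_intros simp: flat_def divide_simps) (cases l, auto simp: algebra_simps power2_eq_square)
    qed
    then show ?thesis
      by (rule has_field_derivative_transform_within_open[of _ _ _ "{0<..}"]) (use True in \<open>auto simp: flat_def\<close>)
  next
    case 2: False
    have "((\<lambda>s. 0) has_real_derivative flat (m + 2) s - real m * flat (m + 1) s) (at s)"
      using 2 by (auto intro!: derivative_eq_intros simp: flat_def)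
    then show ?thesis
      by (rule has_field_derivative_transform_within_open[of _ _ _ "{..<0}"]) (use 2 False in \<open>auto simp: flat_def\<close>)
  qed
qed

lemma continuous_on_flat: "continuous_on S (flat m)"
  by (meson DERIV_continuous_on flat_deriv has_field_derivative_at_within)

section \<open>Calculus of k times differentiable functions\<close>

lemma partial_deriv_has_grad: "has_grad u U \<Longrightarrow> partial_deriv j u = (\<lambda>x. U x $ j)"
proof
  fix x assume "has_grad u U"
  then have "frechet_derivative u (at x) = (\<lambda>h. U x \<bullet> h)"
    using frechet_derivative_at has_gradD by metis
  then show "partial_deriv j u x = U x $ j" by (simp add: partial_deriv_def inner_axis)
qed

lemma C_k_SucI:
  assumes u: "has_grad u U" and U: "\<And>j. C_k k (\<lambda>x. U x $ j)"
  shows "C_k (Suc k) u"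
  using U has_gradD[OF u] by (auto simp: partial_deriv_has_grad[OF u] differentiable_on_def differentiable_def intro: has_derivative_at_withinI)

lemma C_k_SucD: "C_k (Suc k) u \<Longrightarrow> C_k k u"
proof (induction k arbitrary: u)
  case 0
  then show ?case by (auto intro: differentiable_imp_continuous_on)
next
  case (Suc k)
  have "C_k k (partial_deriv j u)" for j
    by (rule Suc.IH) (use Suc.prems in simp)
  then show ?case using Suc.prems by simp
qed

lemma C_k_const: "C_k k (\<lambda>x. c)"
proof (induction k arbitrary: c)
  case (Suc k)
  show ?case by (rule C_k_SucI[OF has_grad_const]) (use Suc[of 0] in simp)
qed simp

lemma C_k_mult_add:
  "C_k k u \<Longrightarrow> C_k k v \<Longrightarrow> C_k k (\<lambda>x. u x * v x)"
  "C_k k u \<Longrightarrow> C_k k v \<Longrightarrow> C_k k (\<lambda>x. u x + v x)"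
proof (induction k arbitrary: u v)
  case 0
  { case 1 then show ?case by (simp add: continuous_on_mult) }
  { case 2 then show ?case by (simp add: continuous_on_add) }
next
  case (Suc k)
  have fd: "(w has_derivative frechet_derivative w (at x)) (at x)" if "C_k (Suc k) w" for w :: "real ^ 'a \<Rightarrow> real" and x
    using that by (auto simp: differentiable_on_def frechet_derivative_works)
  { case 1
    have "partial_deriv j (\<lambda>x. u x * v x) = (\<lambda>x. u x * partial_deriv j v x + v x * partial_deriv j u x)" for j
    proof
      fix x
      have "((\<lambda>x. u x * v x) has_derivative (\<lambda>h. u x * frechet_derivative v (at x) h + frechet_derivative u (at x) h * v x)) (at x)"
        by (rule has_derivative_mult[OF fd[OF 1(1)] fd[OF 1(2)]])
      from frechet_derivative_at[OF this, symmetric]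
      show "partial_deriv j (\<lambda>x. u x * v x) x = u x * partial_deriv j v x + v x * partial_deriv j u x"
        by (simp add: partial_deriv_def mult.commute)
    qed
    moreover have "C_k k (\<lambda>x. u x * partial_deriv j v x + v x * partial_deriv j u x)" for j
    proof -
      have "C_k k u" "C_k k v" by (rule C_k_SucD[OF 1(1)], rule C_k_SucD[OF 1(2)])
      moreover have "C_k k (partial_deriv j u)" "C_k k (partial_deriv j v)" using 1 by auto
      ultimately show ?thesis by (intro Suc.IH(2) Suc.IH(1))
    qed
    moreover have "(\<lambda>x. u x * v x) differentiable_on UNIV"
      using 1 by (auto simp: differentiable_on_def)
    ultimately show ?case by simp }
  { case 2
    have "partial_deriv j (\<lambda>x. u x + v x) = (\<lambda>x. partial_deriv j u x + partial_deriv j v x)" for j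
    proof
      fix x
      from frechet_derivative_at[OF has_derivative_add[OF fd[OF 2(1)] fd[OF 2(2)]], symmetric]
      show "partial_deriv j (\<lambda>x. u x + v x) x = partial_deriv j u x + partial_deriv j v x"
        by (simp add: partial_deriv_def)
    qed
    moreover have "C_k k (\<lambda>x. partial_deriv j u x + partial_deriv j v x)" for j
      using 2 by (intro Suc.IH(2)) auto
    moreover have "(\<lambda>x. u x + v x) differentiable_on UNIV"
      using 2 by (auto simp: differentiable_on_def)
    ultimately show ?case by simp }
qed

lemma C_k_coord: "C_k k (\<lambda>x. x $ i)"
proof (cases k)
  case 0
  then show ?thesis by (simp add: continuous_intros)
next
  case (Suc l)
  show ?thesis unfolding Suc by (rule C_k_SucI[OF has_grad_coord]) (rule C_k_const)
qed

lemma has_grad_flat: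
  "has_grad (\<lambda>y. flat m (c - (norm (y - b))\<^sup>2))
     (\<lambda>y. (flat (m + 2) (c - (norm (y - b))\<^sup>2) - real m * flat (m + 1) (c - (norm (y - b))\<^sup>2)) *\<^sub>R (- 2 *\<^sub>R (y - b)))"
  using has_grad_compose[OF flat_deriv _ has_grad_diff[OF has_grad_const[of c] has_grad_norm2[of b]], of m]
  by (simp add: continuous_intros continuous_on_flat)

text \<open>The induction must run over all \<open>m\<close> at once, since a derivative is a
  combination of \<open>flat (m + 1)\<close> and \<open>flat (m + 2)\<close> with coordinate
  factors.\<close>

lemma C_k_flat: "C_k k (\<lambda>y. flat m (c - (norm (y - b))\<^sup>2))"
proof (induction k arbitrary: m)
  case 0
  show ?case using has_grad_cont[OF has_grad_flat] by simp
next
  case (Suc k)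
  show ?case
  proof (rule C_k_SucI[OF has_grad_flat])
    fix j
    have "C_k k (\<lambda>y. (flat (m + 2) (c - (norm (y - b))\<^sup>2) + (- real m) * flat (m + 1) (c - (norm (y - b))\<^sup>2)) * (- 2 * (y $ j + (- b $ j))))"
      by (intro C_k_mult_add C_k_const C_k_coord Suc.IH)
    then show "C_k k (\<lambda>y. ((flat (m + 2) (c - (norm (y - b))\<^sup>2) - real m * flat (m + 1) (c - (norm (y - b))\<^sup>2)) *\<^sub>R (- 2 *\<^sub>R (y - b))) $ j)"
      by (rule back_subst[of "C_k k"]) (simp add: fun_eq_iff algebra_simps)
  qed
qed

text \<open>Besides the usual properties of a mollifier it is recorded that y -> \<eta> (x - y) is a
  test function, because weak derivatives will be tested with it. The gradient is carried along
  explicitly so that mollifications come with theirs.\<close>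

lemma exists_smooth_kernel:
  fixes r :: real
  assumes r: "0 < r"
  shows "\<exists>(\<eta> :: real ^ 'n::finite \<Rightarrow> real) H. has_grad \<eta> H \<and> (\<forall>z. 0 \<le> \<eta> z) \<and> (\<forall>z. \<eta> (- z) = \<eta> z) \<and>
    (\<forall>z. r \<le> norm z \<longrightarrow> \<eta> z = 0) \<and> (\<integral>\<^sup>+z. ennreal (\<eta> z) \<partial>lborel) = 1 \<and>
    (\<forall>x \<Omega>. cball x r \<subseteq> \<Omega> \<longrightarrow> test_function \<Omega> (\<lambda>y. \<eta> (x - y)))"
proof -
  define \<beta> where "\<beta> z = flat 0 (r\<^sup>2 - (norm (z - 0))\<^sup>2)" for z :: "real ^ 'n"
  have \<beta>0: "0 \<le> \<beta> z" for z by (simp add: \<beta>_def flat_def)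
  have \<beta>s: "\<beta> z = 0" if "r \<le> norm z" for z
  proof -
    have "r\<^sup>2 \<le> (norm z)\<^sup>2" using that r by (intro power_mono) auto
    then show ?thesis by (simp add: \<beta>_def flat_def)
  qed
  obtain H where H: "has_grad \<beta> H" unfolding \<beta>_def using has_grad_flat by blast
  have c\<beta>: "continuous_on S \<beta>" for S by (rule has_grad_cont[OF H])
  have out: "\<beta> z = 0" if "z \<notin> cube r" for z
  proof (rule \<beta>s, rule ccontr)
    assume "\<not> r \<le> norm z"
    then have "z \<in> cball 0 r" by simp
    with ball_subset_cube[of r] that show False by blast
  qed
  define I where "I = integral (cube r) \<beta>"
  have "0 < I"
  proof -
    have "0 \<le> I" unfolding I_def by (intro integral_nonneg integrable_cube c\<beta> \<beta>0)
    moreover have "I \<noteq> 0"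
    proof
      assume "I = 0"
      then have "(\<beta> has_integral 0) (cbox (\<chi> i. - r) (\<chi> i. r))"
        using integrable_integral[OF integrable_cube[OF c\<beta>, of r]] by (simp add: I_def cube_def)
      moreover have "0 \<in> cbox (\<chi> i. - r) (\<chi> i. r :: real ^ 'n)" "box (\<chi> i. - r) (\<chi> i. r) \<noteq> ({} :: (real ^ 'n) set)"
        using r by (auto simp: mem_box_cart interval_eq_empty_cart)
      ultimately have "\<beta> 0 = 0"
        using has_integral_0_cbox_imp_0[of "\<chi> i. - r" "\<chi> i. r" \<beta> 0] c\<beta> \<beta>0 by blast
      then show False using r by (simp add: \<beta>_def flat_def)
    qed
    ultimately show ?thesis by simp
  qed
  define \<eta> where "\<eta> z = (1 / I) * \<beta> z" for z
  have gr: "has_grad \<eta> (\<lambda>z. (1 / I) *\<^sub>R H z)" unfolding \<eta>_def by (rule has_grad_cmult[OF H])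
  have "(\<integral>\<^sup>+z. ennreal (\<eta> z) \<partial>lborel) = (\<integral>\<^sup>+z. indicator (cube r) z * ennreal (\<eta> z) \<partial>lborel)"
    by (intro nn_integral_cong) (auto simp: indicator_def \<eta>_def out)
  also have "\<dots> = ennreal (integral (cube r) \<eta>)"
    by (rule nn_integral_cube_eq) (use has_grad_cont[OF gr] \<beta>0 \<open>0 < I\<close> in \<open>auto simp: \<eta>_def\<close>)
  also have "integral (cube r) \<eta> = (1 / I) * I" unfolding \<eta>_def[abs_def] I_def by simp
  also have "ennreal ((1 / I) * I) = 1" using \<open>0 < I\<close> by simp
  finally have int: "(\<integral>\<^sup>+z. ennreal (\<eta> z) \<partial>lborel) = 1" .
  have test: "test_function \<Omega> (\<lambda>y. \<eta> (x - y))" if "cball x r \<subseteq> \<Omega>" for x \<Omega>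
    unfolding test_function_def
  proof (intro conjI allI)
    have eq: "(\<lambda>y. \<eta> (x - y)) = (\<lambda>y. (1 / I) * flat 0 (r\<^sup>2 - (norm (y - x))\<^sup>2))"
      by (simp add: \<eta>_def \<beta>_def norm_minus_commute)
    show "C_k k (\<lambda>y. \<eta> (x - y))" for k unfolding eq by (intro C_k_mult_add C_k_const C_k_flat)
    have "{y. \<eta> (x - y) \<noteq> 0} \<subseteq> cball x r"
      using \<beta>s by (auto simp: \<eta>_def dist_norm not_le intro: less_imp_le) (meson less_imp_le not_le)
    then have sub: "closure {y. \<eta> (x - y) \<noteq> 0} \<subseteq> cball x r" by (rule closure_minimal) simp
    then show "closure {y. \<eta> (x - y) \<noteq> 0} \<subseteq> \<Omega>" using that by blast
    show "compact (closure {y. \<eta> (x - y) \<noteq> 0})"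
      using sub compact_cball[of x r] by (metis bounded_subset closed_closure compact_eq_bounded_closed)
  qed
  show ?thesis
    by (rule exI[of _ \<eta>], rule exI[of _ "\<lambda>z. (1 / I) *\<^sub>R H z"])
      (use gr int test \<beta>0 \<beta>s \<open>0 < I\<close> in \<open>auto simp: \<eta>_def \<beta>_def\<close>)
qed

section \<open>Convergence of mollifications in mean\<close>

text \<open>Normalisation through the nonnegative integral makes integrability automatic. Evenness
  lets the unit mass be read in either variable of \<eta> (x - y).\<close>

definition kernel :: "real \<Rightarrow> (real ^ 'n::finite \<Rightarrow> real) \<Rightarrow> bool" where
  "kernel r \<eta> \<longleftrightarrow> continuous_on UNIV \<eta> \<and> (\<forall>z. 0 \<le> \<eta> z) \<and> (\<forall>z. \<eta> (- z) = \<eta> z) \<and>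
    (\<forall>z. r \<le> norm z \<longrightarrow> \<eta> z = 0) \<and> (\<integral>\<^sup>+z. ennreal (\<eta> z) \<partial>lborel) = 1"

definition mollify :: "(real ^ 'n::finite \<Rightarrow> real) \<Rightarrow> (real ^ 'n \<Rightarrow> real) \<Rightarrow> real ^ 'n \<Rightarrow> real" where
  "mollify \<eta> D x = (\<integral>y. \<eta> (x - y) * D y \<partial>lborel)"

lemma kernel_nn_integral:
  assumes k: "kernel r \<eta>"
  shows "(\<integral>\<^sup>+y. ennreal (\<eta> (x - y)) \<partial>lborel) = 1" "(\<integral>\<^sup>+y. ennreal (\<eta> (y - x)) \<partial>lborel) = 1"
proof -
  have [measurable]: "\<eta> \<in> borel_measurable borel"
    using k by (auto simp: kernel_def intro: borel_measurable_continuous_onI)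
  have "(\<integral>\<^sup>+y. ennreal (\<eta> y) \<partial>distr lborel borel ((+) (- x))) = (\<integral>\<^sup>+y. ennreal (\<eta> (- x + y)) \<partial>lborel)"
    by (rule nn_integral_distr) measurable
  then have *: "(\<integral>\<^sup>+y. ennreal (\<eta> (y - x)) \<partial>lborel) = 1"
    using k by (simp add: lborel_distr_plus kernel_def)
  then show "(\<integral>\<^sup>+y. ennreal (\<eta> (y - x)) \<partial>lborel) = 1" .
  have "\<eta> (x - y) = \<eta> (y - x)" for y using k unfolding kernel_def by (metis minus_diff_eq)
  then show "(\<integral>\<^sup>+y. ennreal (\<eta> (x - y)) \<partial>lborel) = 1" using * by simp
qed

text \<open>Convexity: the graph of t ^ p lies above its tangent at a. For a > 0 this is Bernoulli's
  inequality for t / a.\<close>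

lemma power_tangent_le:
  fixes a t :: real
  assumes "0 \<le> a" "0 \<le> t" "1 \<le> p"
  shows "real p * a ^ (p - 1) * t \<le> t ^ p + (real p - 1) * a ^ p"
proof (cases "a = 0")
  case True
  then show ?thesis using assms by (cases "p = 1") (auto simp: power_0_left)
next
  case False
  then have a: "0 < a" using assms by simp
  obtain m where m: "p = Suc m" using assms by (cases p) auto
  have "1 + real p * (t / a - 1) \<le> (1 + (t / a - 1)) ^ p"
    using assms a by (intro Bernoulli_inequality) auto
  then have "a ^ p * (1 + real p * (t / a - 1)) \<le> a ^ p * (t / a) ^ p"
    using a by (intro mult_left_mono) auto
  also have "\<dots> = t ^ p" using a by (simp add: power_divide)
  also have "a ^ p * (1 + real p * (t / a - 1)) = real p * a ^ (p - 1) * t - (real p - 1) * a ^ p"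
    using a by (simp add: m field_simps)
  finally show ?thesis by simp
qed

text \<open>The tangent inequality at the mean a of \<open>w\<close> is integrated against \<kappa>.
  For this a has to be finite, which follows from w \<le> 1 + w ^ p when the right-hand side is
  finite; otherwise nothing is to be shown.\<close>

lemma nn_jensen_power:
  fixes \<kappa> w :: "'a::euclidean_space \<Rightarrow> real"
  assumes [measurable]: "\<kappa> \<in> borel_measurable borel" "w \<in> borel_measurable borel"
    and k: "\<And>y. 0 \<le> \<kappa> y" "(\<integral>\<^sup>+y. ennreal (\<kappa> y) \<partial>lborel) = 1" and w: "\<And>y. 0 \<le> w y" and p: "1 \<le> p"
  shows "(\<integral>\<^sup>+y. ennreal (\<kappa> y * w y) \<partial>lborel) ^ p \<le> (\<integral>\<^sup>+y. ennreal (\<kappa> y * w y ^ p) \<partial>lborel)"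
proof (cases "(\<integral>\<^sup>+y. ennreal (\<kappa> y * w y ^ p) \<partial>lborel) = \<infinity>")
  case False
  define S where "S = enn2real (\<integral>\<^sup>+y. ennreal (\<kappa> y * w y ^ p) \<partial>lborel)"
  have S: "(\<integral>\<^sup>+y. ennreal (\<kappa> y * w y ^ p) \<partial>lborel) = ennreal S" "0 \<le> S"
    using False by (auto simp: S_def less_top)
  have "(\<integral>\<^sup>+y. ennreal (\<kappa> y * w y) \<partial>lborel) \<le> (\<integral>\<^sup>+y. ennreal (\<kappa> y) + ennreal (\<kappa> y * w y ^ p) \<partial>lborel)"
  proof (rule nn_integral_mono)
    fix y
    have "w y \<le> 1 + w y ^ p"
    proof (cases "w y \<le> 1")
      case True
      then show ?thesis using w[of y] by (simp add: add_increasing2)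
    next
      case False
      then have "w y ^ 1 \<le> w y ^ p" using p by (intro power_increasing) auto
      then show ?thesis by simp
    qed
    then have "\<kappa> y * w y \<le> \<kappa> y * (1 + w y ^ p)" using k by (intro mult_left_mono)
    then show "ennreal (\<kappa> y * w y) \<le> ennreal (\<kappa> y) + ennreal (\<kappa> y * w y ^ p)"
      using k w by (simp add: algebra_simps flip: ennreal_plus)
  qed
  also have "\<dots> = 1 + ennreal S" using k(2) S by (simp add: nn_integral_add)
  finally have fin: "(\<integral>\<^sup>+y. ennreal (\<kappa> y * w y) \<partial>lborel) < \<infinity>"
    by (simp add: ennreal_plus[symmetric] le_less_trans flip: ennreal_1)
  define a where "a = enn2real (\<integral>\<^sup>+y. ennreal (\<kappa> y * w y) \<partial>lborel)"
  have a: "(\<integral>\<^sup>+y. ennreal (\<kappa> y * w y) \<partial>lborel) = ennreal a" "0 \<le> a"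
    using fin by (auto simp: a_def less_top)
  have "ennreal (real p * a ^ (p - 1)) * ennreal a = (\<integral>\<^sup>+y. ennreal (real p * a ^ (p - 1)) * ennreal (\<kappa> y * w y) \<partial>lborel)"
    unfolding a(1)[symmetric] by (rule nn_integral_cmult[symmetric]) measurable
  also have "\<dots> \<le> (\<integral>\<^sup>+y. ennreal (\<kappa> y * w y ^ p) + ennreal ((real p - 1) * a ^ p) * ennreal (\<kappa> y) \<partial>lborel)"
  proof (rule nn_integral_mono)
    fix y
    have "\<kappa> y * (real p * a ^ (p - 1) * w y) \<le> \<kappa> y * (w y ^ p + (real p - 1) * a ^ p)"
      using k power_tangent_le[OF a(2) w p, of y] by (intro mult_left_mono)
    moreover define c where "c = (real p - 1) * a ^ p"
    have c: "0 \<le> c" using p a by (simp add: c_def)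
    have "ennreal (real p * a ^ (p - 1)) * ennreal (\<kappa> y * w y) = ennreal (\<kappa> y * (real p * a ^ (p - 1) * w y))"
      using k w a by (simp add: ennreal_mult[symmetric] mult_ac)
    moreover have "ennreal (\<kappa> y * (w y ^ p + c)) = ennreal (\<kappa> y * w y ^ p) + ennreal c * ennreal (\<kappa> y)"
      using k(1)[of y] w[of y] c by (simp add: distrib_left ennreal_plus ennreal_mult mult.commute)
    ultimately show "ennreal (real p * a ^ (p - 1)) * ennreal (\<kappa> y * w y) \<le> ennreal (\<kappa> y * w y ^ p) + ennreal ((real p - 1) * a ^ p) * ennreal (\<kappa> y)"
      using ennreal_leI unfolding c_def by metis
  qed
  also have "\<dots> = ennreal S + ennreal ((real p - 1) * a ^ p)"
    using k(2) S by (simp add: nn_integral_add nn_integral_cmult)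
  finally have "real p * a ^ (p - 1) * a \<le> S + (real p - 1) * a ^ p"
    using a S p by (simp flip: ennreal_plus ennreal_mult)
  moreover have "real p * a ^ (p - 1) * a = real p * a ^ p" using p by (cases p) auto
  ultimately have "real p * a ^ p \<le> S + (real p - 1) * a ^ p" by (simp only:)
  then have "a ^ p \<le> S" by (simp add: algebra_simps)
  then show ?thesis using a S by (simp add: ennreal_power)
qed simp

lemma power_sum2_le: "0 \<le> a \<Longrightarrow> 0 \<le> b \<Longrightarrow> (a + b) ^ p \<le> 2 ^ p * (a ^ p + b ^ p)" for a b :: real
proof -
  assume a: "0 \<le> a" and b: "0 \<le> b"
  have "(a + b) ^ p \<le> (2 * max a b) ^ p" using a b by (intro power_mono) auto
  also have "\<dots> = 2 ^ p * max a b ^ p" by (simp add: power_mult_distrib)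
  also have "\<dots> \<le> 2 ^ p * (a ^ p + b ^ p)"
    using a b by (intro mult_left_mono) (auto simp: max_def)
  finally show ?thesis .
qed

text \<open>Two applications of dominated convergence: truncation at level m reduces to bounded
  functions, and a measurable function is an almost everywhere limit of continuous ones, whose
  truncations at m have a common bound on the cube.\<close>

lemma dense_continuous_Lp:
  fixes D :: "real ^ 'n::finite \<Rightarrow> real"
  assumes [measurable]: "D \<in> borel_measurable borel"
    and fin: "(\<integral>\<^sup>+x. indicator (cube s) x * ennreal (\<bar>D x\<bar> ^ p) \<partial>lborel) < \<infinity>" and p: "1 \<le> p" and e: "0 < \<epsilon>"
  shows "\<exists>h. continuous_on UNIV h \<and> (\<integral>\<^sup>+x. indicator (cube s) x * ennreal (\<bar>D x - h x\<bar> ^ p) \<partial>lborel) \<le> ennreal \<epsilon>"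
proof -
  have [measurable]: "cube s \<in> sets (borel :: (real ^ 'n) measure)" by (simp add: borel_closed)
  define cl where "cl m t = max (- real m) (min (real m) t)" for m t
  have cl_le: "\<bar>cl m t\<bar> \<le> real m" "\<bar>t - cl m t\<bar> \<le> \<bar>t\<bar>" for m t by (auto simp: cl_def max_def min_def)
  have ccl: "continuous_on S (cl m)" for S m unfolding cl_def by (intro continuous_intros)
  have [measurable]: "cl m \<in> borel_measurable borel" for m by (rule borel_measurable_continuous_onI[OF ccl])
  define \<delta> where "\<delta> = \<epsilon> / (2 ^ p * 2)"
  have \<delta>: "0 < \<delta>" using e by (simp add: \<delta>_def)
  have "(\<lambda>m. \<integral>\<^sup>+x. indicator (cube s) x * ennreal (\<bar>D x - cl m (D x)\<bar> ^ p) \<partial>lborel) \<longlonglongrightarrow> (\<integral>\<^sup>+x. 0 \<partial>(lborel :: (real ^ 'n) measure))"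
  proof (rule nn_integral_dominated_convergence)
    show "AE x in lborel. indicator (cube s) x * ennreal (\<bar>D x - cl m (D x)\<bar> ^ p) \<le> indicator (cube s) x * ennreal (\<bar>D x\<bar> ^ p)" for m
      using cl_le by (intro AE_I2 mult_left_mono ennreal_leI power_mono) auto
    show "AE x in lborel. (\<lambda>m. indicator (cube s) x * ennreal (\<bar>D x - cl m (D x)\<bar> ^ p)) \<longlonglongrightarrow> 0"
    proof (rule AE_I2)
      fix x
      obtain m0 where "\<bar>D x\<bar> < real m0" using reals_Archimedean2 by blast
      then have "\<forall>\<^sub>F m in sequentially. indicator (cube s) x * ennreal (\<bar>D x - cl m (D x)\<bar> ^ p) = 0"
        unfolding eventually_sequentially using p
        by (intro exI[of _ m0]) (auto simp: cl_def max_def min_def power_0_left)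
      then show "(\<lambda>m. indicator (cube s) x * ennreal (\<bar>D x - cl m (D x)\<bar> ^ p)) \<longlonglongrightarrow> 0" by (rule tendsto_eventually)
    qed
  qed (use fin in measurable)
  then have "\<forall>\<^sub>F m in sequentially. (\<integral>\<^sup>+x. indicator (cube s) x * ennreal (\<bar>D x - cl m (D x)\<bar> ^ p) \<partial>lborel) < ennreal \<delta>"
    using \<delta> by (intro order_tendstoD(2)) auto
  then obtain m where m: "(\<integral>\<^sup>+x. indicator (cube s) x * ennreal (\<bar>D x - cl m (D x)\<bar> ^ p) \<partial>lborel) < ennreal \<delta>"
    using eventually_happens'[OF sequentially_bot] by blast
  have "D measurable_on UNIV"
    by (rule lebesgue_measurable_imp_measurable_on_real) (auto intro: measurable_completion)
  then obtain N g where N: "negligible N" and g: "\<And>j. continuous_on UNIV (g j)" "\<And>x. x \<notin> N \<Longrightarrow> (\<lambda>j. g j x) \<longlonglongrightarrow> D x"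
    unfolding measurable_on_def by auto
  have [measurable]: "g j \<in> borel_measurable borel" for j by (rule borel_measurable_continuous_onI[OF g(1)])
  have "(\<lambda>j. \<integral>\<^sup>+x. indicator (cube s) x * ennreal (\<bar>cl m (D x) - cl m (g j x)\<bar> ^ p) \<partial>lborel) \<longlonglongrightarrow> (\<integral>\<^sup>+x. 0 \<partial>(lborel :: (real ^ 'n) measure))"
  proof (rule nn_integral_dominated_convergence)
    show "AE x in lborel. indicator (cube s) x * ennreal (\<bar>cl m (D x) - cl m (g j x)\<bar> ^ p) \<le> ennreal ((2 * real m) ^ p) * indicator (cube s) x" for j
    proof (rule AE_I2)
      fix x
      have "\<bar>cl m (D x) - cl m (g j x)\<bar> \<le> 2 * real m" using cl_le(1)[of m "D x"] cl_le(1)[of m "g j x"] by linarith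
      then have "\<bar>cl m (D x) - cl m (g j x)\<bar> ^ p \<le> (2 * real m) ^ p" by (intro power_mono) auto
      then show "indicator (cube s) x * ennreal (\<bar>cl m (D x) - cl m (g j x)\<bar> ^ p) \<le> ennreal ((2 * real m) ^ p) * indicator (cube s) x"
        by (auto simp: indicator_def intro!: ennreal_leI)
    qed
    have "emeasure lborel (cube s :: (real ^ 'n) set) < \<infinity>"
      by (rule emeasure_bounded_finite) (simp add: compact_imp_bounded)
    then show "(\<integral>\<^sup>+x. ennreal ((2 * real m) ^ p) * indicator (cube s) x \<partial>(lborel :: (real ^ 'n) measure)) < \<infinity>"
      by (simp add: nn_integral_cmult ennreal_mult_less_top)
    have "AE x in lebesgue. x \<notin> N"
      using N by (intro AE_not_in) (simp add: negligible_iff_null_sets)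
    then have "AE x in lborel. x \<notin> N" by (simp add: AE_completion_iff)
    then show "AE x in lborel. (\<lambda>j. indicator (cube s) x * ennreal (\<bar>cl m (D x) - cl m (g j x)\<bar> ^ p)) \<longlonglongrightarrow> 0"
    proof eventually_elim
      case (elim x)
      have "(\<lambda>j. cl m (g j x)) \<longlonglongrightarrow> cl m (D x)"
        using continuous_on_tendsto_compose[OF ccl[of UNIV] g(2)[OF elim]] by simp
      then have "(\<lambda>j. \<bar>cl m (D x) - cl m (g j x)\<bar> ^ p) \<longlonglongrightarrow> \<bar>cl m (D x) - cl m (D x)\<bar> ^ p"
        by (intro tendsto_intros)
      moreover have "\<bar>cl m (D x) - cl m (D x)\<bar> ^ p = 0" using p by (simp add: power_0_left)
      ultimately have "(\<lambda>j. \<bar>cl m (D x) - cl m (g j x)\<bar> ^ p) \<longlonglongrightarrow> 0" by (simp only:)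
      from tendsto_ennrealI[OF this]
      have "(\<lambda>j. ennreal (\<bar>cl m (D x) - cl m (g j x)\<bar> ^ p)) \<longlonglongrightarrow> 0" by (simp only: ennreal_0)
      then show ?case by (cases "x \<in> cube s") auto
    qed
  qed measurable
  then have "\<forall>\<^sub>F j in sequentially. (\<integral>\<^sup>+x. indicator (cube s) x * ennreal (\<bar>cl m (D x) - cl m (g j x)\<bar> ^ p) \<partial>lborel) < ennreal \<delta>"
    using \<delta> by (intro order_tendstoD(2)) auto
  then obtain j where j: "(\<integral>\<^sup>+x. indicator (cube s) x * ennreal (\<bar>cl m (D x) - cl m (g j x)\<bar> ^ p) \<partial>lborel) < ennreal \<delta>"
    using eventually_happens'[OF sequentially_bot] by blast
  show ?thesis
  proof (intro exI conjI)
    show "continuous_on UNIV (\<lambda>x. cl m (g j x))"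
      by (rule continuous_on_compose2[OF ccl[of UNIV] g(1)]) auto
    have "(\<integral>\<^sup>+x. indicator (cube s) x * ennreal (\<bar>D x - cl m (g j x)\<bar> ^ p) \<partial>lborel)
      \<le> (\<integral>\<^sup>+x. ennreal (2 ^ p) * (indicator (cube s) x * ennreal (\<bar>D x - cl m (D x)\<bar> ^ p) + indicator (cube s) x * ennreal (\<bar>cl m (D x) - cl m (g j x)\<bar> ^ p)) \<partial>lborel)"
    proof (rule nn_integral_mono)
      fix x
      have "\<bar>D x - cl m (g j x)\<bar> ^ p \<le> (\<bar>D x - cl m (D x)\<bar> + \<bar>cl m (D x) - cl m (g j x)\<bar>) ^ p"
        by (intro power_mono) auto
      also have "\<dots> \<le> 2 ^ p * (\<bar>D x - cl m (D x)\<bar> ^ p + \<bar>cl m (D x) - cl m (g j x)\<bar> ^ p)"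
        by (rule power_sum2_le) auto
      finally have "ennreal (\<bar>D x - cl m (g j x)\<bar> ^ p) \<le> ennreal (2 ^ p) * (ennreal (\<bar>D x - cl m (D x)\<bar> ^ p) + ennreal (\<bar>cl m (D x) - cl m (g j x)\<bar> ^ p))"
        by (simp del: ennreal_plus add: ennreal_plus[symmetric] ennreal_mult[symmetric] ennreal_leI)
      then show "indicator (cube s) x * ennreal (\<bar>D x - cl m (g j x)\<bar> ^ p) \<le> ennreal (2 ^ p) * (indicator (cube s) x * ennreal (\<bar>D x - cl m (D x)\<bar> ^ p) + indicator (cube s) x * ennreal (\<bar>cl m (D x) - cl m (g j x)\<bar> ^ p))"
        by (auto simp: indicator_def)
    qed
    also have "\<dots> = ennreal (2 ^ p) * ((\<integral>\<^sup>+x. indicator (cube s) x * ennreal (\<bar>D x - cl m (D x)\<bar> ^ p) \<partial>lborel) + (\<integral>\<^sup>+x. indicator (cube s) x * ennreal (\<bar>cl m (D x) - cl m (g j x)\<bar> ^ p) \<partial>lborel))"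
      by (subst nn_integral_cmult, measurable, subst nn_integral_add, measurable)
    also have "\<dots> \<le> ennreal (2 ^ p) * (ennreal \<delta> + ennreal \<delta>)"
      using m j by (intro mult_left_mono add_mono) auto
    also have "\<dots> = ennreal \<epsilon>"
      using \<delta> by (simp del: ennreal_plus add: ennreal_plus[symmetric] ennreal_mult[symmetric] \<delta>_def)
    finally show "(\<integral>\<^sup>+x. indicator (cube s) x * ennreal (\<bar>D x - cl m (g j x)\<bar> ^ p) \<partial>lborel) \<le> ennreal \<epsilon>" .
  qed
qed

lemma integrable_kernel_mult:
  assumes k: "kernel r \<eta>" and [measurable]: "D \<in> borel_measurable borel"
    and fin: "(\<integral>\<^sup>+x. ennreal \<bar>D x\<bar> \<partial>lborel) < \<infinity>"
  shows "integrable lborel (\<lambda>y. \<eta> (x - y) * D y)"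
proof -
  have c\<eta>: "continuous_on UNIV \<eta>" using k by (simp add: kernel_def)
  have [measurable]: "\<eta> \<in> borel_measurable borel" using c\<eta> by (rule borel_measurable_continuous_onI)
  have "compact (\<eta> ` cball 0 (max r 0))" by (intro compact_continuous_image continuous_on_subset[OF c\<eta>]) auto
  then obtain B where B: "0 < B" "\<And>z. z \<in> cball 0 (max r 0) \<Longrightarrow> \<bar>\<eta> z\<bar> \<le> B"
    by (metis bounded_pos compact_imp_bounded image_eqI real_norm_def)
  have B': "\<bar>\<eta> z\<bar> \<le> B" for z
  proof (cases "r \<le> norm z")
    case True
    then show ?thesis using k B(1) by (simp add: kernel_def)
  next
    case False
    then show ?thesis by (intro B) auto
  qed
  have "integrable lborel D"
    by (rule integrableI_bounded) (use fin in auto)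
  then have "integrable lborel (\<lambda>y. B * D y)" by simp
  then show ?thesis
    by (rule Bochner_Integration.integrable_bound) (use B' B(1) in \<open>auto simp: abs_mult intro!: mult_right_mono\<close>)
qed

text \<open>Jensen for the probability density \<eta> (x - y) at each x, then Fubini and the unit
  mass in x.\<close>

lemma mollify_Lp_contraction:
  fixes \<eta> D :: "real ^ 'n::finite \<Rightarrow> real"
  assumes k: "kernel r \<eta>" and [measurable]: "D \<in> borel_measurable borel"
    and fin: "(\<integral>\<^sup>+x. ennreal \<bar>D x\<bar> \<partial>lborel) < \<infinity>" and p: "1 \<le> p"
  shows "(\<integral>\<^sup>+x. ennreal (\<bar>mollify \<eta> D x\<bar> ^ p) \<partial>lborel) \<le> (\<integral>\<^sup>+x. ennreal (\<bar>D x\<bar> ^ p) \<partial>lborel)"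
proof -
  have c\<eta>: "continuous_on UNIV \<eta>" and \<eta>0: "\<And>z. 0 \<le> \<eta> z" using k by (auto simp: kernel_def)
  have [measurable]: "\<eta> \<in> borel_measurable borel" using c\<eta> by (rule borel_measurable_continuous_onI)
  have "ennreal (\<bar>mollify \<eta> D x\<bar> ^ p) \<le> (\<integral>\<^sup>+y. ennreal (\<eta> (x - y) * \<bar>D y\<bar> ^ p) \<partial>lborel)" for x
  proof -
    have "ennreal \<bar>mollify \<eta> D x\<bar> \<le> (\<integral>\<^sup>+y. ennreal (\<eta> (x - y) * \<bar>D y\<bar>) \<partial>lborel)"
      using integral_norm_bound_ennreal[OF integrable_kernel_mult[OF k assms(2) fin, of x]] \<eta>0
      by (simp add: mollify_def abs_mult)
    then have "ennreal \<bar>mollify \<eta> D x\<bar> ^ p \<le> (\<integral>\<^sup>+y. ennreal (\<eta> (x - y) * \<bar>D y\<bar>) \<partial>lborel) ^ p"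
      by (intro power_mono) auto
    also have "\<dots> \<le> (\<integral>\<^sup>+y. ennreal (\<eta> (x - y) * \<bar>D y\<bar> ^ p) \<partial>lborel)"
      by (rule nn_jensen_power) (use \<eta>0 kernel_nn_integral[OF k] p in auto)
    finally show ?thesis by (simp add: ennreal_power)
  qed
  then have "(\<integral>\<^sup>+x. ennreal (\<bar>mollify \<eta> D x\<bar> ^ p) \<partial>lborel) \<le> (\<integral>\<^sup>+x. (\<integral>\<^sup>+y. ennreal (\<eta> (x - y) * \<bar>D y\<bar> ^ p) \<partial>lborel) \<partial>lborel)"
    by (intro nn_integral_mono)
  also have "\<dots> = (\<integral>\<^sup>+y. (\<integral>\<^sup>+x. ennreal (\<eta> (x - y) * \<bar>D y\<bar> ^ p) \<partial>lborel) \<partial>lborel)"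
    by (rule lborel_pair.Fubini') measurable
  also have "\<dots> = (\<integral>\<^sup>+y. (\<integral>\<^sup>+x. ennreal (\<eta> (x - y)) * ennreal (\<bar>D y\<bar> ^ p) \<partial>lborel) \<partial>lborel)"
    using \<eta>0 by (simp add: ennreal_mult)
  also have "\<dots> = (\<integral>\<^sup>+y. (\<integral>\<^sup>+x. ennreal (\<eta> (x - y)) \<partial>lborel) * ennreal (\<bar>D y\<bar> ^ p) \<partial>lborel)"
    by (intro nn_integral_cong nn_integral_multc) measurable
  also have "\<dots> = (\<integral>\<^sup>+y. ennreal (\<bar>D y\<bar> ^ p) \<partial>lborel)"
    using kernel_nn_integral(2)[OF k] by simp
  finally show ?thesis .
qed

lemma mollify_near:
  assumes k: "kernel r \<eta>" and h: "continuous_on S h" and x: "\<And>y. norm (x - y) < r \<Longrightarrow> \<bar>h y - c\<bar> \<le> \<epsilon> \<and> y \<in> S"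
    and S: "compact S"
  shows "\<bar>mollify \<eta> (\<lambda>y. indicator S y * h y) x - c\<bar> \<le> \<epsilon>"
proof -
  have c\<eta>: "continuous_on UNIV \<eta>" and \<eta>0: "\<And>z. 0 \<le> \<eta> z" and \<eta>s: "\<And>z. r \<le> norm z \<Longrightarrow> \<eta> z = 0" using k by (auto simp: kernel_def)
  have [measurable]: "\<eta> \<in> borel_measurable borel" using c\<eta> by (rule borel_measurable_continuous_onI)
  have i1: "integrable lborel (\<lambda>y. \<eta> (x - y))" and e1: "(\<integral>y. \<eta> (x - y) \<partial>lborel) = 1"
  proof -
    have "integrable lborel (\<lambda>y. \<eta> (x - y))"
      by (rule integrableI_nonneg) (use kernel_nn_integral(1)[OF k, of x] \<eta>0 in auto)
    then show "integrable lborel (\<lambda>y. \<eta> (x - y))" .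
    have "(\<integral>y. \<eta> (x - y) \<partial>lborel) = enn2real (\<integral>\<^sup>+y. ennreal (\<eta> (x - y)) \<partial>lborel)"
      using \<eta>0 by (intro integral_eq_nn_integral) auto
    then show "(\<integral>y. \<eta> (x - y) \<partial>lborel) = 1" using kernel_nn_integral(1)[OF k, of x] by simp
  qed
  have i2: "integrable lborel (\<lambda>y. \<eta> (x - y) * (indicator S y * h y))"
  proof -
    have "integrable lborel (\<lambda>y. indicator S y *\<^sub>R (\<eta> (x - y) * h y))"
      by (rule borel_integrable_compact[OF S])
        (intro continuous_intros continuous_on_compose2[OF c\<eta>] continuous_on_subset[OF h], auto)
    then show ?thesis by (simp add: mult_ac)
  qed
  have "mollify \<eta> (\<lambda>y. indicator S y * h y) x - c = (\<integral>y. \<eta> (x - y) * (indicator S y * h y) - c * \<eta> (x - y) \<partial>lborel)"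
    unfolding mollify_def using i1 i2 e1 by (simp add: Bochner_Integration.integral_diff)
  also have "\<bar>\<dots>\<bar> \<le> (\<integral>y. \<epsilon> * \<eta> (x - y) \<partial>lborel)"
  proof (rule Bochner_Integration.integral_abs_bound_integral)
    show "\<bar>\<eta> (x - y) * (indicator S y * h y) - c * \<eta> (x - y)\<bar> \<le> \<epsilon> * \<eta> (x - y)" for y
    proof (cases "norm (x - y) < r")
      case True
      then have "\<bar>h y - c\<bar> \<le> \<epsilon>" "y \<in> S" using x by auto
      then have "\<eta> (x - y) * \<bar>h y - c\<bar> \<le> \<eta> (x - y) * \<epsilon>" using \<eta>0 by (intro mult_left_mono)
      moreover have "\<eta> (x - y) * (indicator S y * h y) - c * \<eta> (x - y) = \<eta> (x - y) * (h y - c)"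
        using \<open>y \<in> S\<close> by (simp add: algebra_simps)
      ultimately show ?thesis using \<eta>0[of "x - y"] by (simp add: abs_mult mult.commute)
    qed (simp add: \<eta>s)
  qed (use i1 i2 in auto)
  also have "\<dots> = \<epsilon>" using e1 by simp
  finally show ?thesis .
qed

text \<open>\<open>D\<close> is split into a continuous part and a remainder \<open>W\<close> of
  small p-norm. The remainder stays small by the contraction property, and uniform continuity
  handles the rest. Kernels of radius at most R look from \<open>cube R\<close> only into
  \<open>cube (2 * R)\<close>, so truncation of the continuous part there is not felt.\<close>

lemma mollify_converges_Lp:
  fixes D :: "real ^ 'n::finite \<Rightarrow> real" and r :: "nat \<Rightarrow> real"
  assumes k: "\<And>k. kernel (r k) (\<eta> k)" and r: "r \<longlonglongrightarrow> 0" and rR: "\<And>k. r k \<le> R"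
    and mD: "D \<in> borel_measurable borel" and out: "\<And>x. x \<notin> cube (2 * R) \<Longrightarrow> D x = 0"
    and fin: "(\<integral>\<^sup>+x. ennreal (\<bar>D x\<bar> ^ p) \<partial>lborel) < \<infinity>" and p: "1 \<le> p"
  shows "(\<lambda>k. \<integral>\<^sup>+x. indicator (cube R) x * ennreal (\<bar>mollify (\<eta> k) D x - D x\<bar> ^ p) \<partial>lborel) \<longlonglongrightarrow> 0"
proof (rule order_tendstoI)
  fix a :: ennreal assume "0 < a"
  then obtain \<epsilon>0 where \<epsilon>0: "0 < \<epsilon>0" "ennreal \<epsilon>0 < a" by (metis dense ennreal_cases ennreal_less_zero_iff not_less_iff_gr_or_eq top.not_eq_extremum)
  note [measurable] = mD
  have [measurable]: "cube s \<in> sets (borel :: (real ^ 'n) measure)" for s by (simp add: borel_closed)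
  define V where "V = measure lborel (cube R :: (real ^ 'n) set)"
  have V: "emeasure lborel (cube R :: (real ^ 'n) set) = ennreal V"
    unfolding V_def
    by (rule emeasure_eq_ennreal_measure)
      (use emeasure_bounded_finite[OF compact_imp_bounded[OF compact_cube[of R]]] in \<open>simp add: less_top\<close>)
  have V0: "0 \<le> V" by (simp add: V_def)
  define C where "C = 2 ^ p * (1 + 2 ^ p * (1 + V))"
  have C: "0 < C" using V0 by (simp add: C_def add_pos_nonneg)
  define \<epsilon> where "\<epsilon> = min 1 (\<epsilon>0 / C)"
  have \<epsilon>: "0 < \<epsilon>" "\<epsilon> \<le> 1" "C * \<epsilon> \<le> \<epsilon>0" using \<epsilon>0 C by (auto simp: \<epsilon>_def min_def field_simps)
  have D2: "(\<integral>\<^sup>+x. indicator (cube (2 * R)) x * ennreal (\<bar>D x\<bar> ^ p) \<partial>lborel) < \<infinity>"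
  proof -
    have "(\<integral>\<^sup>+x. indicator (cube (2 * R)) x * ennreal (\<bar>D x\<bar> ^ p) \<partial>lborel) \<le> (\<integral>\<^sup>+x. ennreal (\<bar>D x\<bar> ^ p) \<partial>lborel)"
      by (intro nn_integral_mono) (auto simp: indicator_def)
    then show ?thesis using fin by (rule le_less_trans)
  qed
  obtain h where h: "continuous_on UNIV h" "(\<integral>\<^sup>+x. indicator (cube (2 * R)) x * ennreal (\<bar>D x - h x\<bar> ^ p) \<partial>lborel) \<le> ennreal \<epsilon>"
    using dense_continuous_Lp[OF mD D2 p \<epsilon>(1)] by blast
  have [measurable]: "h \<in> borel_measurable borel" by (rule borel_measurable_continuous_onI[OF h(1)])
  define h' where "h' y = indicator (cube (2 * R)) y * h y" for y
  define W where "W y = D y - h' y" for y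
  have [measurable]: "h' \<in> borel_measurable borel" "W \<in> borel_measurable borel" unfolding h'_def W_def by measurable
  have Wp: "(\<integral>\<^sup>+x. ennreal (\<bar>W x\<bar> ^ p) \<partial>lborel) \<le> ennreal \<epsilon>"
  proof -
    have "ennreal (\<bar>W x\<bar> ^ p) = indicator (cube (2 * R)) x * ennreal (\<bar>D x - h x\<bar> ^ p)" for x
      using out[of x] p by (auto simp: W_def h'_def indicator_def power_0_left)
    then show ?thesis using h(2) by simp
  qed
  have L1: "(\<integral>\<^sup>+x. ennreal \<bar>F x\<bar> \<partial>lborel) < \<infinity>"
    if "(\<integral>\<^sup>+x. ennreal (\<bar>F x\<bar> ^ p) \<partial>lborel) < \<infinity>" "F \<in> borel_measurable borel" "\<And>x. x \<notin> cube (2 * R) \<Longrightarrow> F x = 0"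
    for F :: "real ^ 'n \<Rightarrow> real"
  proof -
    note [measurable] = that(2)
    have "(\<integral>\<^sup>+x. ennreal \<bar>F x\<bar> \<partial>lborel) \<le> (\<integral>\<^sup>+x. indicator (cube (2 * R)) x + ennreal (\<bar>F x\<bar> ^ p) \<partial>lborel)"
    proof (rule nn_integral_mono)
      fix x
      show "ennreal \<bar>F x\<bar> \<le> indicator (cube (2 * R)) x + ennreal (\<bar>F x\<bar> ^ p)"
      proof (cases "x \<in> cube (2 * R)")
        case True
        have "\<bar>F x\<bar> \<le> 1 + \<bar>F x\<bar> ^ p"
        proof (cases "\<bar>F x\<bar> \<le> 1")
          case True
          then show ?thesis by (simp add: add_increasing2)
        next
          case False
          then have "\<bar>F x\<bar> ^ 1 \<le> \<bar>F x\<bar> ^ p" using p by (intro power_increasing) auto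
          then show ?thesis by simp
        qed
        then have "ennreal \<bar>F x\<bar> \<le> ennreal (1 + \<bar>F x\<bar> ^ p)" by (rule ennreal_leI)
        then show ?thesis using True by simp
      qed (use that(3) in simp)
    qed
    also have "\<dots> = emeasure lborel (cube (2 * R) :: (real ^ 'n) set) + (\<integral>\<^sup>+x. ennreal (\<bar>F x\<bar> ^ p) \<partial>lborel)"
      by (subst nn_integral_add) auto
    also have "\<dots> < \<infinity>"
      using that(1) emeasure_bounded_finite[OF compact_imp_bounded[OF compact_cube], of "2 * R"] by auto
    finally show ?thesis .
  qed
  have WL1: "(\<integral>\<^sup>+x. ennreal \<bar>W x\<bar> \<partial>lborel) < \<infinity>"
    by (rule L1) (use Wp out in \<open>auto simp: W_def h'_def intro: le_less_trans\<close>)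
  have DL1: "(\<integral>\<^sup>+x. ennreal \<bar>D x\<bar> \<partial>lborel) < \<infinity>" by (rule L1[OF fin mD out])
  have "uniformly_continuous_on (cube (2 * R)) h"
    by (intro compact_uniformly_continuous continuous_on_subset[OF h(1)]) auto
  then obtain d where d: "d > 0" "\<And>x y. x \<in> cube (2 * R) \<Longrightarrow> y \<in> cube (2 * R) \<Longrightarrow> dist y x < d \<Longrightarrow> dist (h y) (h x) < \<epsilon>"
    unfolding uniformly_continuous_on_def using \<epsilon>(1) by metis
  have "\<forall>\<^sub>F k in sequentially. r k < d" using r d(1) by (rule order_tendstoD(2))
  then show "\<forall>\<^sub>F k in sequentially. (\<integral>\<^sup>+x. indicator (cube R) x * ennreal (\<bar>mollify (\<eta> k) D x - D x\<bar> ^ p) \<partial>lborel) < a"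
  proof eventually_elim
    case (elim k)
    have [measurable]: "\<eta> k \<in> borel_measurable borel"
      using k[of k] by (auto simp: kernel_def intro: borel_measurable_continuous_onI)
    have [measurable]: "mollify (\<eta> k) W \<in> borel_measurable borel"
      unfolding mollify_def[abs_def] by measurable
    have near: "\<bar>mollify (\<eta> k) h' x - h x\<bar> \<le> \<epsilon>" if x: "x \<in> cube R" for x
      unfolding h'_def[abs_def]
    proof (rule mollify_near[OF k continuous_on_subset[OF h(1)]])
      fix y assume y: "norm (x - y) < r k"
      have yR: "y \<in> cube (2 * R)"
        unfolding mem_cube
      proof
        fix i
        have "\<bar>x $ i\<bar> \<le> R" using x by (auto simp: mem_cube)
        moreover have "\<bar>(x - y) $ i\<bar> \<le> R" using component_le_norm_cart[of "x - y" i] y rR[of k] by linarith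
        ultimately show "\<bar>y $ i\<bar> \<le> 2 * R" by simp
      qed
      have "0 \<le> R" using rR[of k] y norm_ge_zero[of "x - y"] by linarith
      then have "x \<in> cube (2 * R)" using x cube_mono[of R "2 * R"] by auto
      then have "dist (h y) (h x) < \<epsilon>" using yR y elim by (intro d) (auto simp: dist_norm norm_minus_commute)
      then show "\<bar>h y - h x\<bar> \<le> \<epsilon> \<and> y \<in> cube (2 * R)" using yR by (auto simp: dist_real_def)
    qed auto
    have split: "mollify (\<eta> k) D x = mollify (\<eta> k) W x + mollify (\<eta> k) h' x" for x
    proof -
      have i1: "integrable lborel (\<lambda>y. \<eta> k (x - y) * W y)" by (rule integrable_kernel_mult[OF k _ WL1]) simp
      have i2: "integrable lborel (\<lambda>y. \<eta> k (x - y) * D y)" by (rule integrable_kernel_mult[OF k mD DL1])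
      have "(\<lambda>y. \<eta> k (x - y) * h' y) = (\<lambda>y. \<eta> k (x - y) * D y - \<eta> k (x - y) * W y)"
        by (simp add: W_def fun_eq_iff algebra_simps)
      then show ?thesis unfolding mollify_def using i1 i2 by simp
    qed
    have pt: "indicator (cube R) x * ennreal (\<bar>mollify (\<eta> k) D x - D x\<bar> ^ p) \<le>
      ennreal (2 ^ p) * ennreal (\<bar>mollify (\<eta> k) W x\<bar> ^ p) + ennreal (2 ^ p * 2 ^ p) * ennreal (\<bar>W x\<bar> ^ p) + ennreal (2 ^ p * 2 ^ p * \<epsilon>) * indicator (cube R) x" for x
    proof (cases "x \<in> cube R")
      case True
      have h'h: "h' x = h x"
      proof -
        have "0 \<le> R" using True by (force simp: mem_cube intro: order_trans[OF abs_ge_zero])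
        then have "x \<in> cube (2 * R)" using True cube_mono[of R "2 * R"] by auto
        then show ?thesis by (simp add: h'_def)
      qed
      have "\<bar>mollify (\<eta> k) D x - D x\<bar> \<le> \<bar>mollify (\<eta> k) W x\<bar> + (\<bar>W x\<bar> + \<bar>mollify (\<eta> k) h' x - h x\<bar>)"
        unfolding split by (simp add: W_def h'h)
      then have "\<bar>mollify (\<eta> k) D x - D x\<bar> ^ p \<le> (\<bar>mollify (\<eta> k) W x\<bar> + (\<bar>W x\<bar> + \<bar>mollify (\<eta> k) h' x - h x\<bar>)) ^ p"
        by (intro power_mono) auto
      also have "\<dots> \<le> 2 ^ p * (\<bar>mollify (\<eta> k) W x\<bar> ^ p + (\<bar>W x\<bar> + \<bar>mollify (\<eta> k) h' x - h x\<bar>) ^ p)"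
        by (rule power_sum2_le) auto
      also have "\<dots> \<le> 2 ^ p * (\<bar>mollify (\<eta> k) W x\<bar> ^ p + 2 ^ p * (\<bar>W x\<bar> ^ p + \<bar>mollify (\<eta> k) h' x - h x\<bar> ^ p))"
        by (intro mult_left_mono add_left_mono power_sum2_le) auto
      also have "\<dots> \<le> 2 ^ p * (\<bar>mollify (\<eta> k) W x\<bar> ^ p + 2 ^ p * (\<bar>W x\<bar> ^ p + \<epsilon>))"
      proof -
        have "\<bar>mollify (\<eta> k) h' x - h x\<bar> ^ p \<le> \<epsilon> ^ p" using near[OF True] by (intro power_mono) auto
        also have "\<dots> \<le> \<epsilon> ^ 1" using \<epsilon> p by (intro power_decreasing) auto
        finally show ?thesis by (intro mult_left_mono add_left_mono) auto
      qed
      also have "\<dots> = 2 ^ p * \<bar>mollify (\<eta> k) W x\<bar> ^ p + 2 ^ p * 2 ^ p * \<bar>W x\<bar> ^ p + 2 ^ p * 2 ^ p * \<epsilon>"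
        by (simp add: algebra_simps)
      finally have "ennreal (\<bar>mollify (\<eta> k) D x - D x\<bar> ^ p) \<le> ennreal (2 ^ p * \<bar>mollify (\<eta> k) W x\<bar> ^ p + 2 ^ p * 2 ^ p * \<bar>W x\<bar> ^ p + 2 ^ p * 2 ^ p * \<epsilon>)"
        by (rule ennreal_leI)
      also have "\<dots> = ennreal (2 ^ p) * ennreal (\<bar>mollify (\<eta> k) W x\<bar> ^ p) + ennreal (2 ^ p * 2 ^ p) * ennreal (\<bar>W x\<bar> ^ p) + ennreal (2 ^ p * 2 ^ p * \<epsilon>)"
        using \<epsilon> by (simp add: ennreal_plus ennreal_mult)
      finally show ?thesis using True by simp
    qed simp
    have "(\<integral>\<^sup>+x. indicator (cube R) x * ennreal (\<bar>mollify (\<eta> k) D x - D x\<bar> ^ p) \<partial>lborel) \<le>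
      (\<integral>\<^sup>+x. ennreal (2 ^ p) * ennreal (\<bar>mollify (\<eta> k) W x\<bar> ^ p) + ennreal (2 ^ p * 2 ^ p) * ennreal (\<bar>W x\<bar> ^ p) + ennreal (2 ^ p * 2 ^ p * \<epsilon>) * indicator (cube R) x \<partial>lborel)"
      by (intro nn_integral_mono pt)
    also have "\<dots> = ennreal (2 ^ p) * (\<integral>\<^sup>+x. ennreal (\<bar>mollify (\<eta> k) W x\<bar> ^ p) \<partial>lborel) + ennreal (2 ^ p * 2 ^ p) * (\<integral>\<^sup>+x. ennreal (\<bar>W x\<bar> ^ p) \<partial>lborel) + ennreal (2 ^ p * 2 ^ p * \<epsilon>) * ennreal V"
      by (simp add: nn_integral_add nn_integral_cmult V)
    also have "\<dots> \<le> ennreal (2 ^ p) * ennreal \<epsilon> + ennreal (2 ^ p * 2 ^ p) * ennreal \<epsilon> + ennreal (2 ^ p * 2 ^ p * \<epsilon>) * ennreal V"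
      using Wp order_trans[OF mollify_Lp_contraction[OF k _ WL1 p] Wp] by (intro add_mono mult_left_mono) auto
    also have "\<dots> = ennreal (C * \<epsilon>)"
      using \<epsilon> V0 unfolding C_def
      by (simp del: ennreal_plus add: ennreal_plus[symmetric] ennreal_mult[symmetric] algebra_simps)
    also have "\<dots> \<le> ennreal \<epsilon>0" using \<epsilon> by (intro ennreal_leI) auto
    also have "\<dots> < a" by (rule \<epsilon>0)
    finally show ?case .
  qed
qed simp

section \<open>Continuity of the n-th power of the norm and of the determinant under convergence in
  mean of order n\<close>

lemma prod_diff_le:
  fixes x y :: "'i \<Rightarrow> real"
  assumes "finite S" "\<And>i. i \<in> S \<Longrightarrow> \<bar>x i - y i\<bar> \<le> t" "\<And>i. i \<in> S \<Longrightarrow> \<bar>y i\<bar> \<le> s" "0 \<le> t" "0 \<le> s"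
  shows "\<bar>prod x S - prod y S\<bar> \<le> real (card S) * (t * (s + t) ^ (card S - 1))"
  using assms(1-3)
proof (induction S)
  case empty
  then show ?case by simp
next
  case (insert a S)
  define k where "k = card S"
  have xi: "\<bar>x i\<bar> \<le> s + t" if "i \<in> insert a S" for i
    using insert.prems(1)[OF that] insert.prems(2)[OF that] by linarith
  have X: "\<bar>prod x S\<bar> \<le> (s + t) ^ k"
    unfolding abs_prod k_def using xi by (intro order_trans[OF prod_mono[of S "\<lambda>i. \<bar>x i\<bar>" "\<lambda>_. s + t"]]) auto
  have IH: "\<bar>prod x S - prod y S\<bar> \<le> real k * (t * (s + t) ^ (k - 1))"
    unfolding k_def by (rule insert.IH) (use insert.prems in auto)
  have IH': "s * \<bar>prod x S - prod y S\<bar> \<le> real k * (t * (s + t) ^ k)"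
  proof (cases k)
    \<comment> \<open>Here truncated subtraction makes the exponent k - 1 equal to 0 instead of -1;
      the factor \<open>real k\<close> = 0 and equal empty products save the estimate.\<close>
    case 0
    then have "S = {}" using insert.hyps by (simp add: k_def)
    then show ?thesis by (simp add: 0)
  next
    case (Suc l)
    have "s * \<bar>prod x S - prod y S\<bar> \<le> (s + t) * (real k * (t * (s + t) ^ (k - 1)))"
      using IH assms(4,5) by (intro mult_mono) auto
    then show ?thesis by (simp add: Suc mult_ac)
  qed
  have "prod x (insert a S) - prod y (insert a S) = (x a - y a) * prod x S + y a * (prod x S - prod y S)"
    using insert.hyps by (simp add: algebra_simps)
  then have "\<bar>prod x (insert a S) - prod y (insert a S)\<bar> \<le> \<bar>x a - y a\<bar> * \<bar>prod x S\<bar> + \<bar>y a\<bar> * \<bar>prod x S - prod y S\<bar>"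
    by (metis abs_mult abs_triangle_ineq)
  also have "\<dots> \<le> t * (s + t) ^ k + s * \<bar>prod x S - prod y S\<bar>"
    using insert.prems X assms(4) by (intro add_mono mult_mono mult_right_mono) auto
  also have "\<dots> \<le> real (Suc k) * (t * (s + t) ^ k)" using IH' by (simp add: algebra_simps)
  finally show ?case using insert.hyps by (simp add: k_def)
qed

text \<open>Both functions are sums of products of n factors, so telescoping bounds the difference
  by a multiple of t (s + t) ^ (n - 1), where s = |b| and t = |a - b|. Young's inequality separates
  this into a small multiple of s ^ n and a large one of t ^ n.\<close>

lemma det_norm_power_diff:
  assumes "0 < \<epsilon>"
  shows "\<exists>C\<ge>0. \<forall>a b :: real ^ 'n::finite ^ 'n.
    \<bar>norm a ^ CARD('n) - norm b ^ CARD('n)\<bar> \<le> \<epsilon> * norm b ^ CARD('n) + C * norm (a - b) ^ CARD('n) \<and>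
    \<bar>det a - det b\<bar> \<le> \<epsilon> * norm b ^ CARD('n) + C * norm (a - b) ^ CARD('n)"
proof -
  define N where "N = CARD('n)"
  obtain m where m: "N = Suc m" by (cases N) (auto simp: N_def)
  define F :: real where "F = fact N * real N"
  have F: "(1::real) \<le> fact N" "real N \<le> F" "0 < F"
  proof -
    show f: "(1::real) \<le> fact N" by (rule fact_ge_1)
    show "real N \<le> F" unfolding F_def using f mult_right_mono[of 1 "fact N" "real N"] by simp
    then show "0 < F" using m by simp
  qed
  define e where "e = \<epsilon> / (F * 2 ^ N)"
  have e: "0 < e" using assms F by (simp add: e_def)
  define C where "C = F * (e * 2 ^ N + (1 / e) ^ m)"
  have C: "0 \<le> C" using F e by (simp add: C_def)
  have key: "F * (t * (s + t) ^ m) \<le> \<epsilon> * s ^ N + C * t ^ N" if "0 \<le> s" "0 \<le> t" for s t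
  proof -
    have "t * (s + t) ^ m \<le> e * (s + t) ^ N + (1 / e) ^ m * t ^ N"
      using young_split[of t "s + t" e m] that e by (simp add: m)
    also have "\<dots> \<le> e * (2 ^ N * (s ^ N + t ^ N)) + (1 / e) ^ m * t ^ N"
      using power_sum2_le[of s t N] that e by (intro add_right_mono mult_left_mono) auto
    finally have "F * (t * (s + t) ^ m) \<le> F * (e * (2 ^ N * (s ^ N + t ^ N)) + (1 / e) ^ m * t ^ N)"
      using F by (intro mult_left_mono) auto
    also have "\<dots> = (F * e * 2 ^ N) * s ^ N + C * t ^ N" by (simp add: C_def algebra_simps)
    also have "F * e * 2 ^ N = \<epsilon>" using F by (simp add: e_def)
    finally show ?thesis .
  qed
  have "\<bar>norm a ^ N - norm b ^ N\<bar> \<le> \<epsilon> * norm b ^ N + C * norm (a - b) ^ N \<and>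
    \<bar>det a - det b\<bar> \<le> \<epsilon> * norm b ^ N + C * norm (a - b) ^ N" for a b :: "real ^ 'n ^ 'n"
  proof
    define s where "s = norm b"
    define t where "t = norm (a - b)"
    have st: "0 \<le> s" "0 \<le> t" by (auto simp: s_def t_def)
    define P where "P = real N * (t * (s + t) ^ m)"
    have "\<bar>(\<Prod>i\<in>(UNIV :: 'n set). norm a) - (\<Prod>i\<in>(UNIV :: 'n set). norm b)\<bar> \<le> real (card (UNIV :: 'n set)) * (t * (s + t) ^ (card (UNIV :: 'n set) - 1))"
      by (rule prod_diff_le) (use st in \<open>auto simp: s_def t_def norm_triangle_ineq3\<close>)
    then have "\<bar>norm a ^ N - norm b ^ N\<bar> \<le> P" by (simp add: P_def N_def[symmetric] m)
    also have "\<dots> \<le> F * (t * (s + t) ^ m)" unfolding P_def using F st by (intro mult_right_mono) auto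
    also note key[OF st]
    finally show "\<bar>norm a ^ N - norm b ^ N\<bar> \<le> \<epsilon> * norm b ^ N + C * norm (a - b) ^ N" by (simp add: s_def t_def)
    have ent: "\<bar>A $ i $ j\<bar> \<le> norm A" for A :: "real ^ 'n ^ 'n" and i j
      using component_le_norm_cart[of "A $ i" j] Finite_Cartesian_Product.norm_nth_le[of A i] by simp
    have "\<bar>det a - det b\<bar> = \<bar>\<Sum>p | p permutes (UNIV :: 'n set). of_int (sign p) * ((\<Prod>i\<in>UNIV. a $ i $ p i) - (\<Prod>i\<in>UNIV. b $ i $ p i))\<bar>"
      unfolding det_def by (simp add: sum_subtractf right_diff_distrib)
    also have "\<dots> \<le> (\<Sum>p | p permutes (UNIV :: 'n set). P)"
    proof (rule order_trans[OF sum_abs sum_mono])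
      fix p :: "'n \<Rightarrow> 'n"
      have "\<bar>(\<Prod>i\<in>UNIV. a $ i $ p i) - (\<Prod>i\<in>UNIV. b $ i $ p i)\<bar> \<le> real (card (UNIV :: 'n set)) * (t * (s + t) ^ (card (UNIV :: 'n set) - 1))"
        by (rule prod_diff_le) (use st ent[of "a - b"] ent[of b] in \<open>auto simp: s_def t_def\<close>)
      then show "\<bar>of_int (sign p) * ((\<Prod>i\<in>UNIV. a $ i $ p i) - (\<Prod>i\<in>UNIV. b $ i $ p i))\<bar> \<le> P"
        by (simp add: abs_mult P_def N_def[symmetric] m flip: of_int_abs)
    qed
    also have "\<dots> = F * (t * (s + t) ^ m)" by (simp add: card_permutations P_def F_def N_def)
    also note key[OF st]
    finally show "\<bar>det a - det b\<bar> \<le> \<epsilon> * norm b ^ N + C * norm (a - b) ^ N" by (simp add: s_def t_def)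
  qed
  then show ?thesis using C unfolding N_def by blast
qed

text \<open>First \<epsilon> is chosen small against the finite energy of \<open>D\<close>; this
  fixes the constant C, and only then is k taken large enough for the difference term.\<close>

lemma tendsto_nn_integral_of_power:
  fixes G :: "nat \<Rightarrow> real ^ 'n::finite \<Rightarrow> real ^ 'n ^ 'n" and \<Phi> :: "real ^ 'n ^ 'n \<Rightarrow> real"
  assumes [measurable]: "\<And>k. G k \<in> borel_measurable borel" "D \<in> borel_measurable borel"
    and lim: "(\<lambda>k. \<integral>\<^sup>+x. indicator (cube R) x * ennreal (norm (G k x - D x) ^ N) \<partial>lborel) \<longlonglongrightarrow> 0"
    and fin: "(\<integral>\<^sup>+x. indicator (cube R) x * ennreal (norm (D x) ^ N) \<partial>lborel) < \<infinity>"
    and \<Phi>: "\<And>\<epsilon>. 0 < \<epsilon> \<Longrightarrow> \<exists>C\<ge>0. \<forall>a b. \<bar>\<Phi> a - \<Phi> b\<bar> \<le> \<epsilon> * norm b ^ N + C * norm (a - b) ^ N"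
  shows "(\<lambda>k. \<integral>\<^sup>+x. indicator (cube R) x * ennreal \<bar>\<Phi> (G k x) - \<Phi> (D x)\<bar> \<partial>lborel) \<longlonglongrightarrow> 0"
proof (rule order_tendstoI)
  fix a :: ennreal assume "0 < a"
  then obtain \<epsilon>0 where \<epsilon>0: "0 < \<epsilon>0" "ennreal \<epsilon>0 < a" by (metis dense ennreal_cases ennreal_less_zero_iff not_less_iff_gr_or_eq top.not_eq_extremum)
  have [measurable]: "cube R \<in> sets (borel :: (real ^ 'n) measure)" by (simp add: borel_closed)
  define S where "S = enn2real (\<integral>\<^sup>+x. indicator (cube R) x * ennreal (norm (D x) ^ N) \<partial>lborel)"
  have S: "(\<integral>\<^sup>+x. indicator (cube R) x * ennreal (norm (D x) ^ N) \<partial>lborel) = ennreal S" "0 \<le> S"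
    using fin by (auto simp: S_def less_top)
  define \<epsilon> where "\<epsilon> = \<epsilon>0 / (2 * (S + 1))"
  have \<epsilon>: "0 < \<epsilon>" "\<epsilon> * S \<le> \<epsilon>0 / 2" using \<epsilon>0 S by (auto simp: \<epsilon>_def field_simps)
  obtain C where C: "0 \<le> C" "\<And>a b. \<bar>\<Phi> a - \<Phi> b\<bar> \<le> \<epsilon> * norm b ^ N + C * norm (a - b) ^ N"
    using \<Phi>[OF \<epsilon>(1)] by blast
  define \<delta> where "\<delta> = \<epsilon>0 / (2 * (C + 1))"
  have \<delta>: "0 < \<delta>" "C * \<delta> \<le> \<epsilon>0 / 2" using \<epsilon>0 C by (auto simp: \<delta>_def field_simps)
  have "\<forall>\<^sub>F k in sequentially. (\<integral>\<^sup>+x. indicator (cube R) x * ennreal (norm (G k x - D x) ^ N) \<partial>lborel) < ennreal \<delta>"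
    using lim \<delta> by (intro order_tendstoD(2)) auto
  then show "\<forall>\<^sub>F k in sequentially. (\<integral>\<^sup>+x. indicator (cube R) x * ennreal \<bar>\<Phi> (G k x) - \<Phi> (D x)\<bar> \<partial>lborel) < a"
  proof eventually_elim
    case (elim k)
    have "(\<integral>\<^sup>+x. indicator (cube R) x * ennreal \<bar>\<Phi> (G k x) - \<Phi> (D x)\<bar> \<partial>lborel) \<le>
      (\<integral>\<^sup>+x. ennreal \<epsilon> * (indicator (cube R) x * ennreal (norm (D x) ^ N)) + ennreal C * (indicator (cube R) x * ennreal (norm (G k x - D x) ^ N)) \<partial>lborel)"
    proof (rule nn_integral_mono)
      fix x
      have "ennreal \<bar>\<Phi> (G k x) - \<Phi> (D x)\<bar> \<le> ennreal (\<epsilon> * norm (D x) ^ N + C * norm (G k x - D x) ^ N)"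
        by (rule ennreal_leI[OF C(2)])
      also have "\<dots> = ennreal \<epsilon> * ennreal (norm (D x) ^ N) + ennreal C * ennreal (norm (G k x - D x) ^ N)"
        using \<epsilon> C(1) by (simp add: ennreal_plus ennreal_mult)
      finally show "indicator (cube R) x * ennreal \<bar>\<Phi> (G k x) - \<Phi> (D x)\<bar> \<le>
        ennreal \<epsilon> * (indicator (cube R) x * ennreal (norm (D x) ^ N)) + ennreal C * (indicator (cube R) x * ennreal (norm (G k x - D x) ^ N))"
        by (auto simp: indicator_def)
    qed
    also have "\<dots> = ennreal \<epsilon> * ennreal S + ennreal C * (\<integral>\<^sup>+x. indicator (cube R) x * ennreal (norm (G k x - D x) ^ N) \<partial>lborel)"
      unfolding S(1)[symmetric] by (simp add: nn_integral_add nn_integral_cmult)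
    also have "\<dots> \<le> ennreal \<epsilon> * ennreal S + ennreal C * ennreal \<delta>"
      using elim by (intro add_left_mono mult_left_mono) auto
    also have "\<dots> = ennreal (\<epsilon> * S + C * \<delta>)"
      using \<epsilon> S C \<delta> by (simp add: ennreal_plus ennreal_mult)
    also have "\<dots> \<le> ennreal \<epsilon>0" using \<epsilon> \<delta> by (intro ennreal_leI) linarith
    also have "\<dots> < a" by (rule \<epsilon>0)
    finally show ?case .
  qed
qed simp

section \<open>Mollifying a weakly differentiable map\<close>

lemma has_grad_reflect:
  assumes "has_grad u U" shows "has_grad (\<lambda>y. u (x - y)) (\<lambda>y. - U (x - y))"
  unfolding has_grad_def
proof (intro conjI allI)
  fix y
  have "((\<lambda>y. x - y) has_derivative (\<lambda>h. - h)) (at y)" by (auto intro!: derivative_eq_intros)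
  moreover have "(\<lambda>h. U (x - y) \<bullet> - h) = (\<bullet>) (- U (x - y))" by (simp add: fun_eq_iff)
  ultimately show "((\<lambda>y. u (x - y)) has_derivative (\<bullet>) (- U (x - y))) (at y)"
    using has_derivative_compose[of "\<lambda>y. x - y" "\<lambda>h. - h" y UNIV u, OF _ has_gradD[OF assms]] by simp
  show "continuous_on UNIV (\<lambda>y. - U (x - y))"
    by (intro continuous_intros continuous_on_compose2[OF has_grad_cont_grad[OF assms, of UNIV]]) auto
qed

text \<open>The function is only known on a cube, so the convolution is cut off there;
  differentiation under the integral sign then acts on the kernel alone and no boundary term
  appears.\<close>

lemma has_grad_convolution:
  fixes \<phi> :: "real ^ 'n::finite \<Rightarrow> real"
  assumes \<phi>: "continuous_on (cube s) \<phi>" and \<eta>: "has_grad \<eta> H"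
  shows "has_grad (\<lambda>x. integral (cube s) (\<lambda>y. \<phi> y * \<eta> (x - y))) (\<lambda>x. integral (cube s) (\<lambda>y. \<phi> y *\<^sub>R H (x - y)))"
proof -
  have cH: "continuous_on UNIV H" and c\<eta>: "continuous_on UNIV \<eta>"
    using has_grad_cont_grad[OF \<eta>] has_grad_cont[OF \<eta>] by auto
  have c2: "continuous_on (UNIV \<times> cube s) (\<lambda>p. \<phi> (snd p) *\<^sub>R H (fst p - snd p))"
    by (intro continuous_intros continuous_on_compose2[OF \<phi>] continuous_on_compose2[OF cH]) auto
  have c1: "continuous_on (cube s) (\<lambda>y. \<phi> y *\<^sub>R H (x - y))" for x
    by (intro continuous_intros \<phi> continuous_on_compose2[OF cH]) auto
  show ?thesis
    unfolding has_grad_def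
  proof (intro conjI allI)
    fix x
    have "((\<lambda>x. integral (cube s) (\<lambda>y. \<phi> y * \<eta> (x - y))) has_derivative
      blinfun_apply (integral (cube s) (\<lambda>y. blinfun_inner_right (\<phi> y *\<^sub>R H (x - y))))) (at x within UNIV)"
      unfolding cube_def
    proof (rule leibniz_rule)
      fix x y :: "real ^ 'n"
      have "((\<lambda>x. x - y) has_derivative (\<lambda>h. h)) (at x)" by (auto intro!: derivative_eq_intros)
      note has_derivative_mult_right[OF has_derivative_compose[OF this has_gradD[OF \<eta>]], of "\<phi> y"]
      moreover have "(\<lambda>h. \<phi> y * (H (x - y) \<bullet> h)) = (\<bullet>) (\<phi> y *\<^sub>R H (x - y))" by (simp add: fun_eq_iff)
      ultimately show "((\<lambda>x. \<phi> y * \<eta> (x - y)) has_derivative blinfun_apply (blinfun_inner_right (\<phi> y *\<^sub>R H (x - y)))) (at x within UNIV)"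
        by (simp add: blinfun_inner_right.rep_eq)
    next
      show "(\<lambda>y. \<phi> y * \<eta> (x - y)) integrable_on cbox (\<chi> i. - s) (\<chi> i. s)" for x
        unfolding cube_def[symmetric] by (intro integrable_cube continuous_intros \<phi> continuous_on_compose2[OF c\<eta>]) auto
      show "continuous_on (UNIV \<times> cbox (\<chi> i. - s) (\<chi> i. s)) (\<lambda>(x, y). blinfun_inner_right (\<phi> y *\<^sub>R H (x - y)))"
        using c2 unfolding split_beta cube_def
        by (rule bounded_linear.continuous_on[OF bounded_linear_blinfun_inner_right])
    qed auto
    moreover have "integral (cube s) (\<lambda>y. blinfun_inner_right (\<phi> y *\<^sub>R H (x - y))) = blinfun_inner_right (integral (cube s) (\<lambda>y. \<phi> y *\<^sub>R H (x - y)))"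
      using integral_linear[OF integrable_cube[OF c1] bounded_linear_blinfun_inner_right, of x] by (simp add: o_def)
    ultimately show "((\<lambda>x. integral (cube s) (\<lambda>y. \<phi> y * \<eta> (x - y))) has_derivative (\<bullet>) (integral (cube s) (\<lambda>y. \<phi> y *\<^sub>R H (x - y)))) (at x)"
      by (simp add: blinfun_inner_right.rep_eq)
  next
    show "continuous_on UNIV (\<lambda>x. integral (cube s) (\<lambda>y. \<phi> y *\<^sub>R H (x - y)))"
      using integral_continuous_on_param[of UNIV "\<chi> i. - s" "\<chi> i. s" "\<lambda>x y. \<phi> y *\<^sub>R H (x - y)"] c2
      by (simp add: cube_def split_beta)
  qed
qed

definition smooth_kernel :: "real \<Rightarrow> (real ^ 'n::finite \<Rightarrow> real) \<Rightarrow> (real ^ 'n \<Rightarrow> real ^ 'n) \<Rightarrow> bool" where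
  "smooth_kernel r \<eta> H \<longleftrightarrow> kernel r \<eta> \<and> has_grad \<eta> H \<and> (\<forall>x \<Omega>. cball x r \<subseteq> \<Omega> \<longrightarrow> test_function \<Omega> (\<lambda>y. \<eta> (x - y)))"

lemma smooth_kernel_ex: "0 < r \<Longrightarrow> \<exists>(\<eta> :: real ^ 'n::finite \<Rightarrow> real) H. smooth_kernel r \<eta> H"
  using exists_smooth_kernel[of r, where 'n='n] unfolding smooth_kernel_def kernel_def
  by (metis has_grad_cont)

lemma smooth_kernel_outside:
  assumes k: "smooth_kernel r \<eta> H" and z: "r \<le> norm z"
  shows "\<eta> z = 0" "H z = 0"
proof -
  show z0: "\<eta> z = 0" using assms by (auto simp: smooth_kernel_def kernel_def)
  have "has_grad (\<lambda>x. - 1 * \<eta> x) (\<lambda>x. - 1 *\<^sub>R H x)" using k by (intro has_grad_cmult) (simp add: smooth_kernel_def)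
  from has_grad_eq_0_max[OF this, of z] show "H z = 0"
    using k z0 by (simp add: smooth_kernel_def kernel_def)
qed

text \<open>Testing with y -> \<eta> (x - y), whose j-th partial derivative is - H (x - y)_j, moves
  the derivative from the kernel to \<open>E\<close>. As \<open>E\<close> is only Lebesgue
  measurable on \<Omega>, a Borel version \<open>d\<close> of the entry, cut off to the larger cube,
  takes its place; one \<open>d\<close> serves all kernels and all points.\<close>

lemma weak_derivative_mollified:
  fixes f :: "real ^ 'n::finite \<Rightarrow> real ^ 'm::finite"
  assumes wd: "has_weak_derivative \<Omega> f E" and \<Omega>: "open \<Omega>" "cube (2 * R) \<subseteq> \<Omega>" and cf: "continuous_on (cube (2 * R)) f" and R: "0 < R"
  shows "\<exists>d. d \<in> borel_measurable borel \<and> (\<forall>x. x \<notin> cube (2 * R) \<longrightarrow> d x = 0) \<and>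
    (AE x in lborel. x \<in> cube (2 * R) \<longrightarrow> d x = E x $ i $ j) \<and>
    (\<forall>r \<eta> H x. smooth_kernel r \<eta> H \<longrightarrow> r \<le> R \<longrightarrow> x \<in> cube R \<longrightarrow>
      integral (cube (2 * R)) (\<lambda>y. f y $ i * H (x - y) $ j) = mollify \<eta> d x)"
proof -
  define Q where "Q = (cube (2 * R) :: (real ^ 'n) set)"
  have mE: "E \<in> borel_measurable (lebesgue_on \<Omega>)"
    and weak: "\<And>\<phi> i j. test_function \<Omega> \<phi> \<Longrightarrow>
        (LINT x|lebesgue_on \<Omega>. f x $ i * partial_deriv j \<phi> x) = - (LINT x|lebesgue_on \<Omega>. E x $ i $ j * \<phi> x)"
    using wd by (auto simp: has_weak_derivative_def locally_Lp_def)
  have s\<Omega>: "\<Omega> \<inter> space lebesgue \<in> sets lebesgue" using \<Omega>(1) by (simp add: lebesgue_openin)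
  have sQ [measurable]: "Q \<in> sets borel" unfolding Q_def by (simp add: borel_closed)
  have mEij: "(\<lambda>x. E x $ i $ j) \<in> borel_measurable (lebesgue_on \<Omega>)"
    by (rule measurable_compose[OF mE]) (intro borel_measurable_continuous_onI continuous_intros)
  have mEl: "(\<lambda>x. indicator \<Omega> x * E x $ i $ j) \<in> borel_measurable lebesgue"
    using mEij borel_measurable_restrict_space_iff[OF s\<Omega>, of "\<lambda>x. E x $ i $ j"] by simp
  have "(\<lambda>x. indicator Q x * (indicator \<Omega> x * E x $ i $ j)) \<in> borel_measurable lebesgue"
    by (intro borel_measurable_times mEl measurable_completion borel_measurable_indicator) simp
  from completion_ex_borel_measurable_real[OF this]
  obtain d0 where d0: "d0 \<in> borel_measurable lborel" "AE x in lborel. indicator Q x * (indicator \<Omega> x * E x $ i $ j) = d0 x" by blast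
  define d where "d x = indicator Q x * d0 x" for x
  have [measurable]: "d0 \<in> borel_measurable borel" using d0(1) by simp
  have md [measurable]: "d \<in> borel_measurable borel" unfolding d_def by measurable
  have dE: "AE x in lborel. x \<in> Q \<longrightarrow> d x = E x $ i $ j"
    using d0(2) by eventually_elim (use \<Omega>(2) in \<open>auto simp: d_def Q_def indicator_def\<close>)
  have main: "integral (cube (2 * R)) (\<lambda>y. f y $ i * H (x - y) $ j) = mollify \<eta> d x"
    if sk: "smooth_kernel r \<eta> H" and r: "r \<le> R" and x: "x \<in> cube R" for r \<eta> H x
  proof -
    have gr: "has_grad \<eta> H" using sk by (simp add: smooth_kernel_def)
    have inQ: "y \<in> Q" if "norm (x - y) \<le> r" for y
      unfolding Q_def mem_cube
    proof
      fix i
      have "\<bar>x $ i\<bar> \<le> R" using x by (auto simp: mem_cube)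
      moreover have "\<bar>(x - y) $ i\<bar> \<le> R" using component_le_norm_cart[of "x - y" i] that r by linarith
      ultimately show "\<bar>y $ i\<bar> \<le> 2 * R" by simp
    qed
    have off: "\<eta> (x - y) = 0" "H (x - y) = 0" if "y \<notin> Q" for y
      using smooth_kernel_outside[OF sk, of "x - y"] inQ[of y] that by (cases "norm (x - y) \<le> r"; simp)+
    have "cball x r \<subseteq> \<Omega>" using inQ \<Omega>(2) by (auto simp: Q_def dist_norm)
    then have test: "test_function \<Omega> (\<lambda>y. \<eta> (x - y))" using sk by (simp add: smooth_kernel_def)
    have pd: "partial_deriv j (\<lambda>y. \<eta> (x - y)) = (\<lambda>y. - H (x - y) $ j)"
      using partial_deriv_has_grad[OF has_grad_reflect[OF gr, of x], of j] by simp
    define F where "F y = f y $ i * H (x - y) $ j" for y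
    have cF: "continuous_on Q F"
      unfolding F_def Q_def
      by (intro continuous_intros cf continuous_on_compose2[OF has_grad_cont_grad[OF gr, of UNIV]]) auto
    have iF: "integrable lborel (\<lambda>y. indicator Q y *\<^sub>R F y)"
      by (rule borel_integrable_compact[OF _ cF]) (simp add: Q_def)
    have "(LINT y|lebesgue_on \<Omega>. f y $ i * partial_deriv j (\<lambda>y. \<eta> (x - y)) y) = (LINT y|lebesgue. indicator \<Omega> y *\<^sub>R (- F y))"
      unfolding pd F_def by (subst integral_restrict_space[OF s\<Omega>]) simp
    also have "(\<lambda>y. indicator \<Omega> y *\<^sub>R (- F y)) = (\<lambda>y. - (indicator Q y *\<^sub>R F y))"
      using off \<Omega>(2) by (auto simp: fun_eq_iff F_def Q_def indicator_def)
    also have "(LINT y|lebesgue. - (indicator Q y *\<^sub>R F y)) = - (LINT y|lborel. indicator Q y *\<^sub>R F y)"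
      using integral_completion[of "\<lambda>y. - (indicator Q y *\<^sub>R F y)" lborel] borel_measurable_integrable[OF iF] by simp
    also have "(LINT y|lborel. indicator Q y *\<^sub>R F y) = integral Q F"
      using set_borel_integral_eq_integral(2)[of Q F] iF by (simp add: set_integrable_def set_lebesgue_integral_def)
    finally have L: "(LINT y|lebesgue_on \<Omega>. f y $ i * partial_deriv j (\<lambda>y. \<eta> (x - y)) y) = - integral Q F" .
    have [measurable]: "\<eta> \<in> borel_measurable borel"
      using has_grad_cont[OF gr] by (rule borel_measurable_continuous_onI)
    have m\<eta>: "(\<lambda>y. \<eta> (x - y)) \<in> borel_measurable borel" by measurable
    have "(LINT y|lebesgue_on \<Omega>. E y $ i $ j * \<eta> (x - y)) = (LINT y|lebesgue. indicator \<Omega> y *\<^sub>R (E y $ i $ j * \<eta> (x - y)))"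
      by (rule integral_restrict_space[OF s\<Omega>])
    also have "\<dots> = (LINT y|lebesgue. \<eta> (x - y) * d y)"
    proof (rule integral_cong_AE)
      have "(\<lambda>y. (indicator \<Omega> y * E y $ i $ j) * \<eta> (x - y)) \<in> borel_measurable lebesgue"
        by (intro borel_measurable_times mEl measurable_completion) (use m\<eta> in simp)
      then show "(\<lambda>y. indicator \<Omega> y *\<^sub>R (E y $ i $ j * \<eta> (x - y))) \<in> borel_measurable lebesgue" by (simp add: mult_ac)
      show "(\<lambda>y. \<eta> (x - y) * d y) \<in> borel_measurable lebesgue"
        by (intro measurable_completion) simp
      show "AE y in lebesgue. indicator \<Omega> y *\<^sub>R (E y $ i $ j * \<eta> (x - y)) = \<eta> (x - y) * d y"
        using AE_completion[OF dE]
      proof eventually_elim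
        case (elim y)
        show ?case
        proof (cases "y \<in> Q")
          case True
          then have "y \<in> \<Omega>" using \<Omega>(2) by (auto simp: Q_def)
          then show ?thesis using elim True by simp
        qed (simp add: off)
      qed
    qed
    also have "\<dots> = (LINT y|lborel. \<eta> (x - y) * d y)"
      by (rule integral_completion) simp
    also have "\<dots> = mollify \<eta> d x" by (simp add: mollify_def)
    finally have "(LINT y|lebesgue_on \<Omega>. E y $ i $ j * \<eta> (x - y)) = mollify \<eta> d x" .
    with L weak[OF test, of i j] show ?thesis by (simp add: Q_def F_def[abs_def])
  qed
  show ?thesis
    by (rule exI[of _ d]) (use md dE main in \<open>auto simp: d_def Q_def\<close>)
qed

lemma sum_power_le:
  fixes a :: "'i \<Rightarrow> real"
  assumes "finite S" "\<And>i. i \<in> S \<Longrightarrow> 0 \<le> a i" "1 \<le> p"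
  shows "(\<Sum>i\<in>S. a i) ^ p \<le> real (card S) ^ p * (\<Sum>i\<in>S. a i ^ p)"
proof (cases "S = {}")
  case True
  then show ?thesis using assms(3) by (simp add: power_0_left)
next
  case False
  define M where "M = Max (a ` S)"
  have "M \<in> a ` S" unfolding M_def using False assms(1) by (intro Max_in) auto
  then obtain j where j: "j \<in> S" "M = a j" by blast
  have "(\<Sum>i\<in>S. a i) \<le> real (card S) * M"
    by (rule sum_bounded_above) (use assms(1) in \<open>auto simp: M_def\<close>)
  then have "(\<Sum>i\<in>S. a i) ^ p \<le> (real (card S) * M) ^ p"
    by (intro power_mono sum_nonneg assms(2))
  also have "\<dots> = real (card S) ^ p * a j ^ p" by (simp add: power_mult_distrib j)
  also have "\<dots> \<le> real (card S) ^ p * (\<Sum>i\<in>S. a i ^ p)"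
    using assms j by (intro mult_left_mono member_le_sum) auto
  finally show ?thesis .
qed

lemma norm_matrix_le_sum:
  fixes A :: "real ^ 'n ^ 'm"
  shows "norm A \<le> (\<Sum>(i, j)\<in>UNIV. \<bar>A $ i $ j\<bar>)"
proof -
  have "norm A \<le> (\<Sum>i\<in>UNIV. norm (A $ i))" unfolding norm_vec_def by (rule L2_set_le_sum) auto
  also have "\<dots> \<le> (\<Sum>i\<in>UNIV. \<Sum>j\<in>UNIV. \<bar>A $ i $ j\<bar>)" by (intro sum_mono norm_le_l1_cart)
  also have "\<dots> = (\<Sum>(i, j)\<in>UNIV. \<bar>A $ i $ j\<bar>)"
    unfolding UNIV_Times_UNIV[symmetric] by (rule sum.cartesian_product)
  finally show ?thesis .
qed

text \<open>All n^2 entries are bounded by the operator norm. The Euclidean matrix norm is used in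
  the estimates, and this crude comparison is the source of the factor (n^2)^n in the distortion
  constant.\<close>

lemma norm_matrix_le_onorm:
  fixes A :: "real ^ 'n ^ 'n"
  shows "norm A \<le> (real CARD('n))\<^sup>2 * onorm ((*v) A)"
proof -
  have e: "\<bar>A $ i $ j\<bar> \<le> onorm ((*v) A)" for i j
  proof -
    have "A $ i $ j = (A *v axis j 1) $ i"
      by (simp add: matrix_vector_mult_def axis_def if_distrib cong: if_cong)
    then have "\<bar>A $ i $ j\<bar> \<le> norm (A *v axis j 1)" by (metis component_le_norm_cart)
    also have "\<dots> \<le> onorm ((*v) A) * norm (axis j (1::real) :: real ^ 'n)"
      by (rule onorm[OF matrix_vector_mul_bounded_linear])
    finally show ?thesis by simp
  qed
  have "norm A \<le> (\<Sum>(i, j)\<in>(UNIV :: ('n \<times> 'n) set). \<bar>A $ i $ j\<bar>)" by (rule norm_matrix_le_sum)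
  also have "\<dots> \<le> real (card (UNIV :: ('n \<times> 'n) set)) * onorm ((*v) A)"
    by (rule sum_bounded_above) (use e in auto)
  also have "real (card (UNIV :: ('n \<times> 'n) set)) = (real CARD('n))\<^sup>2"
    by (simp add: power2_eq_square)
  finally show ?thesis .
qed

lemma locally_Lp_component_finite:
  fixes E :: "real ^ 'n::finite \<Rightarrow> real ^ 'n ^ 'm::finite"
  assumes E: "locally_Lp p \<Omega> E" and Q: "cube s \<subseteq> \<Omega>"
    and d: "\<And>x. x \<notin> cube s \<Longrightarrow> d x = 0" "AE x in lborel. x \<in> cube s \<longrightarrow> d x = E x $ i $ j" and p: "1 \<le> p"
  shows "(\<integral>\<^sup>+x. ennreal (\<bar>d x\<bar> ^ p) \<partial>lborel) < \<infinity>"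
proof -
  have sQ: "cube s \<inter> space lebesgue \<in> sets lebesgue" by (simp add: cube_def)
  have "integrable (lebesgue_on (cube s)) (\<lambda>x. norm (E x) ^ p)"
    using E Q by (simp add: locally_Lp_def)
  then have "integrable lebesgue (\<lambda>x. indicator (cube s) x *\<^sub>R norm (E x) ^ p)"
    by (simp only: integrable_restrict_space[OF sQ])
  then have "(\<integral>\<^sup>+x. ennreal (norm (indicator (cube s) x *\<^sub>R norm (E x) ^ p)) \<partial>lebesgue) < \<infinity>"
    by (simp only: integrable_iff_bounded)
  then have fin: "(\<integral>\<^sup>+x. ennreal (norm (indicator (cube s) x *\<^sub>R norm (E x) ^ p)) \<partial>lborel) < \<infinity>"
    by (simp only: nn_integral_completion)
  have "(\<integral>\<^sup>+x. ennreal (\<bar>d x\<bar> ^ p) \<partial>lborel) \<le> (\<integral>\<^sup>+x. ennreal (norm (indicator (cube s) x *\<^sub>R norm (E x) ^ p)) \<partial>lborel)"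
  proof (rule nn_integral_mono_AE)
    show "AE x in lborel. ennreal (\<bar>d x\<bar> ^ p) \<le> ennreal (norm (indicator (cube s) x *\<^sub>R norm (E x) ^ p))"
      using d(2)
    proof eventually_elim
      case (elim x)
      have ent: "\<bar>E x $ i $ j\<bar> \<le> norm (E x)"
        using component_le_norm_cart[of "E x $ i" j] Finite_Cartesian_Product.norm_nth_le[of "E x" i] by simp
      show ?case
      proof (cases "x \<in> cube s")
        case True
        then show ?thesis using elim ent by (auto intro!: ennreal_leI power_mono)
      next
        case False
        then show ?thesis using d(1)[OF False] p by (simp add: power_0_left)
      qed
    qed
  qed
  then show ?thesis using fin by (rule le_less_trans)
qed

text \<open>The value of \<open>R\<close> puts \<open>cube (2 * R)\<close> inside the ball of radius
  1/2, which leaves room to mollify. The distortion inequality is nonlinear and is not preserved by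
  mollification; it is recovered in mean because the norm to the power n and the determinant of the
  derivatives converge in L^1.\<close>

lemma quasiregular_approx:
  fixes f :: "real ^ 'n::finite \<Rightarrow> real ^ 'n"
  assumes n: "CARD('n) \<ge> 2" and qr: "quasiregular K (ball 0 1) f"
  defines "R \<equiv> 1 / (4 * real CARD('n))" and "K' \<equiv> ((real CARD('n))\<^sup>2) ^ CARD('n) * K"
  shows "\<exists>g G (D :: real ^ 'n \<Rightarrow> real ^ 'n ^ 'n). D \<in> borel_measurable borel \<and> qr_approx g G f K' R \<and>
    (\<lambda>k. \<integral>\<^sup>+x. indicator (cube R) x * ennreal \<bar>det (G k x) - det (D x)\<bar> \<partial>lborel) \<longlonglongrightarrow> 0 \<and>
    (AE x in lborel. x \<in> cube R \<longrightarrow> det (D x) = jacobian_det (ball 0 1) f x \<and> 0 \<le> det (D x))"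
proof -
  define N where "N = CARD('n)"
  have N: "2 \<le> N" "1 \<le> N" using n by (auto simp: N_def)
  define \<Omega> where "\<Omega> = (ball 0 1 :: (real ^ 'n) set)"
  have R: "0 < R" using N by (simp add: R_def N_def[symmetric])
  have K1: "1 \<le> K" and cf0: "continuous_on \<Omega> f" and sob: "sobolev_W1_loc N \<Omega> f"
    and dist: "AE x in lebesgue_on \<Omega>. onorm ((*v) (weak_derivative \<Omega> f x)) ^ N \<le> K * jacobian_det \<Omega> f x"
    using qr unfolding quasiregular_def \<Omega>_def N_def by blast+
  have K': "1 \<le> K'"
  proof -
    have "(1::real) \<le> ((real N)\<^sup>2) ^ N" using N by (intro one_le_power) auto
    then have "1 * 1 \<le> ((real N)\<^sup>2) ^ N * K" using K1 by (intro mult_mono) auto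
    then show ?thesis by (simp add: K'_def N_def)
  qed
  have Q\<Omega>: "cube (2 * R) \<subseteq> \<Omega>"
  proof
    fix x :: "real ^ 'n" assume "x \<in> cube (2 * R)"
    then have "norm x \<le> real N * (2 * R)" unfolding N_def by (rule norm_cube)
    also have "\<dots> = 1 / 2" using N by (simp add: R_def N_def[symmetric])
    finally show "x \<in> \<Omega>" by (simp add: \<Omega>_def)
  qed
  have RQ: "cube R \<subseteq> (cube (2 * R) :: (real ^ 'n) set)" using R by (intro cube_mono) simp
  have o\<Omega>: "open \<Omega>" by (simp add: \<Omega>_def)
  have cf: "continuous_on (cube (2 * R)) f" using cf0 Q\<Omega> by (rule continuous_on_subset)
  obtain E2 where E2: "has_weak_derivative \<Omega> f E2" "locally_Lp N \<Omega> E2"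
    using sob by (auto simp: sobolev_W1_loc_def)
  \<comment> \<open>\<open>E1\<close> is the derivative occurring in the distortion inequality and
    the Jacobian, but its choice does not by itself guarantee n-integrability. That property belongs
    to \<open>E2\<close>; both are therefore mollified and compared.\<close>
  define E1 where "E1 = weak_derivative \<Omega> f"
  have E1: "has_weak_derivative \<Omega> f E1" unfolding E1_def weak_derivative_def by (rule someI[of _ E2], rule E2)
  define r where "r k = R / real (Suc k)" for k
  have r: "0 < r k" "r k \<le> R" for k using R by (auto simp: r_def field_simps)
  have r0: "r \<longlonglongrightarrow> 0" unfolding r_def using tendsto_mult_left[OF LIMSEQ_inverse_real_of_nat, of R] by (simp add: divide_inverse)
  have "\<forall>k. \<exists>\<eta> H. smooth_kernel (r k) (\<eta> :: real ^ 'n \<Rightarrow> real) H" using smooth_kernel_ex r by blast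
  then obtain \<eta> :: "nat \<Rightarrow> real ^ 'n \<Rightarrow> real" and H where sk: "\<And>k. smooth_kernel (r k) (\<eta> k) (H k)" by metis
  have ker: "kernel (r k) (\<eta> k)" and gr: "has_grad (\<eta> k) (H k)" for k using sk by (auto simp: smooth_kernel_def)
  define g where "g k x = (\<chi> i. integral (cube (2 * R)) (\<lambda>y. f y $ i * \<eta> k (x - y)))" for k x
  define G where "G k x = (\<chi> i. integral (cube (2 * R)) (\<lambda>y. f y $ i *\<^sub>R H k (x - y)))" for k x
  have cfi: "continuous_on (cube (2 * R)) (\<lambda>y. f y $ i)" for i by (intro continuous_intros cf)
  have C1: "C1_map (g k) (G k)" for k
    unfolding C1_map_def g_def G_def using has_grad_convolution[OF cfi gr] by simp
  have Gij: "G k x $ i $ j = integral (cube (2 * R)) (\<lambda>y. f y $ i * H k (x - y) $ j)" for k x i j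
  proof -
    have "continuous_on (cube (2 * R)) (\<lambda>y. f y $ i *\<^sub>R H k (x - y))"
      by (intro continuous_intros cf continuous_on_compose2[OF has_grad_cont_grad[OF gr, of UNIV]]) auto
    from integral_component_eq_cart[OF integrable_cube[OF this], of j] show ?thesis by (simp add: G_def)
  qed
  define P where "P E i j d \<longleftrightarrow> d \<in> borel_measurable borel \<and> (\<forall>x. x \<notin> cube (2 * R) \<longrightarrow> d x = 0) \<and>
    (AE x in lborel. x \<in> cube (2 * R) \<longrightarrow> d x = E x $ i $ j) \<and> (\<forall>k x. x \<in> cube R \<longrightarrow> G k x $ i $ j = mollify (\<eta> k) d x)"
    for E :: "real ^ 'n \<Rightarrow> real ^ 'n ^ 'n" and i j d
  have ex: "\<exists>d. \<forall>i j. P E i j (d i j)" if "has_weak_derivative \<Omega> f E" for E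
  proof -
    have "\<exists>d. P E i j d" for i j
      using weak_derivative_mollified[OF that o\<Omega> Q\<Omega> cf R, of i j] sk r(2) unfolding Gij P_def by blast
    then show ?thesis by metis
  qed
  obtain d1 where "\<And>i j. P E1 i j (d1 i j)" using ex[OF E1] by blast
  then have d1: "\<And>i j. d1 i j \<in> borel_measurable borel" "\<And>i j x. x \<notin> cube (2 * R) \<Longrightarrow> d1 i j x = 0"
    "\<And>i j. AE x in lborel. x \<in> cube (2 * R) \<longrightarrow> d1 i j x = E1 x $ i $ j"
    "\<And>i j k x. x \<in> cube R \<Longrightarrow> G k x $ i $ j = mollify (\<eta> k) (d1 i j) x" unfolding P_def by blast+
  obtain d2 where "\<And>i j. P E2 i j (d2 i j)" using ex[OF E2(1)] by blast
  then have d2: "\<And>i j. d2 i j \<in> borel_measurable borel" "\<And>i j x. x \<notin> cube (2 * R) \<Longrightarrow> d2 i j x = 0"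
    "\<And>i j. AE x in lborel. x \<in> cube (2 * R) \<longrightarrow> d2 i j x = E2 x $ i $ j"
    "\<And>i j k x. x \<in> cube R \<Longrightarrow> G k x $ i $ j = mollify (\<eta> k) (d2 i j) x" unfolding P_def by blast+
  note [measurable] = d1(1) d2(1)
  have [measurable]: "cube s \<in> sets (borel :: (real ^ 'n) measure)" for s by (simp add: borel_closed)
  have [measurable]: "\<eta> k \<in> borel_measurable borel" for k
    using has_grad_cont[OF gr] by (rule borel_measurable_continuous_onI)
  have [measurable]: "mollify (\<eta> k) (d1 i j) \<in> borel_measurable borel" "mollify (\<eta> k) (d2 i j) \<in> borel_measurable borel" for k i j
    unfolding mollify_def[abs_def] by measurable
  have L1: "locally_Lp 1 \<Omega> E1" "locally_Lp 1 \<Omega> E2" using E1 E2 by (auto simp: has_weak_derivative_def)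
  have conv1: "(\<lambda>k. \<integral>\<^sup>+x. indicator (cube R) x * ennreal (\<bar>mollify (\<eta> k) (d1 i j) x - d1 i j x\<bar> ^ 1) \<partial>lborel) \<longlonglongrightarrow> 0" for i j
    by (rule mollify_converges_Lp[OF ker r0 r(2) d1(1) d1(2) locally_Lp_component_finite[OF L1(1) Q\<Omega> d1(2) d1(3)]]) auto
  have conv2: "(\<lambda>k. \<integral>\<^sup>+x. indicator (cube R) x * ennreal (\<bar>mollify (\<eta> k) (d2 i j) x - d2 i j x\<bar> ^ 1) \<partial>lborel) \<longlonglongrightarrow> 0" for i j
    by (rule mollify_converges_Lp[OF ker r0 r(2) d2(1) d2(2) locally_Lp_component_finite[OF L1(2) Q\<Omega> d2(2) d2(3)]]) auto
  have convN: "(\<lambda>k. \<integral>\<^sup>+x. indicator (cube R) x * ennreal (\<bar>mollify (\<eta> k) (d2 i j) x - d2 i j x\<bar> ^ N) \<partial>lborel) \<longlonglongrightarrow> 0" for i j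
    by (rule mollify_converges_Lp[OF ker r0 r(2) d2(1) d2(2) locally_Lp_component_finite[OF E2(2) Q\<Omega> d2(2) d2(3)]]) (use N in auto)
  \<comment> \<open>On \<open>cube R\<close> the mollifications of both derivatives equal the matrix
    \<open>G k\<close>, and each converges in L^1 to its own derivative, so the two derivatives
    coincide almost everywhere.\<close>
  have eq12: "AE x in lborel. x \<in> cube R \<longrightarrow> d1 i j x = d2 i j x" for i j
  proof -
    define I where "I = (\<integral>\<^sup>+x. indicator (cube R) x * ennreal \<bar>d1 i j x - d2 i j x\<bar> \<partial>lborel)"
    have "I \<le> (\<integral>\<^sup>+x. indicator (cube R) x * ennreal (\<bar>mollify (\<eta> k) (d1 i j) x - d1 i j x\<bar> ^ 1) \<partial>lborel)
       + (\<integral>\<^sup>+x. indicator (cube R) x * ennreal (\<bar>mollify (\<eta> k) (d2 i j) x - d2 i j x\<bar> ^ 1) \<partial>lborel)" for k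
    proof -
      have "I \<le> (\<integral>\<^sup>+x. indicator (cube R) x * ennreal (\<bar>mollify (\<eta> k) (d1 i j) x - d1 i j x\<bar> ^ 1)
        + indicator (cube R) x * ennreal (\<bar>mollify (\<eta> k) (d2 i j) x - d2 i j x\<bar> ^ 1) \<partial>lborel)"
        unfolding I_def
      proof (rule nn_integral_mono)
        fix x
        show "indicator (cube R) x * ennreal \<bar>d1 i j x - d2 i j x\<bar> \<le> indicator (cube R) x * ennreal (\<bar>mollify (\<eta> k) (d1 i j) x - d1 i j x\<bar> ^ 1)
        + indicator (cube R) x * ennreal (\<bar>mollify (\<eta> k) (d2 i j) x - d2 i j x\<bar> ^ 1)"
        proof (cases "x \<in> cube R")
          case True
          have "\<bar>d1 i j x - d2 i j x\<bar> \<le> \<bar>mollify (\<eta> k) (d1 i j) x - d1 i j x\<bar> + \<bar>mollify (\<eta> k) (d2 i j) x - d2 i j x\<bar>"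
            using d1(4)[OF True, of k i j] d2(4)[OF True, of k i j] by linarith
          from ennreal_leI[OF this] True show ?thesis by (simp add: ennreal_plus)
        qed simp
      qed
      also have "\<dots> = (\<integral>\<^sup>+x. indicator (cube R) x * ennreal (\<bar>mollify (\<eta> k) (d1 i j) x - d1 i j x\<bar> ^ 1) \<partial>lborel)
       + (\<integral>\<^sup>+x. indicator (cube R) x * ennreal (\<bar>mollify (\<eta> k) (d2 i j) x - d2 i j x\<bar> ^ 1) \<partial>lborel)"
        by (rule nn_integral_add) measurable
      finally show ?thesis .
    qed
    then have "I \<le> 0 + 0"
      by (intro tendsto_lowerbound[OF tendsto_add[OF conv1[of i j] conv2[of i j]]]) auto
    then have "I = 0" by simp
    then have "AE x in lborel. indicator (cube R) x * ennreal \<bar>d1 i j x - d2 i j x\<bar> = 0"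
      unfolding I_def by (subst (asm) nn_integral_0_iff_AE) auto
    then show ?thesis by eventually_elim (auto simp: indicator_def)
  qed
  define D where "D x = (\<chi> i j. d2 i j x)" for x
  have mD: "D \<in> borel_measurable borel"
  proof (subst borel_measurable_euclidean_space, rule ballI)
    fix b :: "real ^ 'n ^ 'n" assume "b \<in> Basis"
    then obtain i j where "b = axis i (axis j 1)" by (auto simp: Basis_vec_def)
    then have "(\<lambda>x. D x \<bullet> b) = d2 i j" by (simp add: D_def inner_axis fun_eq_iff)
    then show "(\<lambda>x. D x \<bullet> b) \<in> borel_measurable borel" using d2(1) by simp
  qed
  have AEall: "AE x in lborel. x \<in> cube R \<longrightarrow> D x = E1 x"
  proof -
    have "AE x in lborel. \<forall>i\<in>UNIV. \<forall>j\<in>UNIV. x \<in> cube R \<longrightarrow> d2 i j x = E1 x $ i $ j"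
    proof (intro eventually_ball_finite finite ballI)
      fix i j
      show "AE x in lborel. x \<in> cube R \<longrightarrow> d2 i j x = E1 x $ i $ j"
        using eq12[of i j] d1(3)[of i j] by eventually_elim (use RQ in auto)
    qed
    then show ?thesis by eventually_elim (auto simp: D_def vec_eq_iff)
  qed
  have s\<Omega>: "\<Omega> \<inter> space lebesgue \<in> sets lebesgue" using o\<Omega> by (simp add: lebesgue_openin)
  have "AE x in lebesgue. x \<in> \<Omega> \<longrightarrow> onorm ((*v) (E1 x)) ^ N \<le> K * det (E1 x)"
    using dist s\<Omega> by (simp add: AE_restrict_space_iff jacobian_det_def E1_def)
  then have dist1: "AE x in lborel. x \<in> \<Omega> \<longrightarrow> onorm ((*v) (E1 x)) ^ N \<le> K * det (E1 x)"
    by (simp add: AE_completion_iff)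
  have distD: "AE x in lborel. x \<in> cube R \<longrightarrow> norm (D x) ^ N \<le> K' * det (D x) \<and> 0 \<le> det (D x) \<and> det (D x) = jacobian_det \<Omega> f x"
    using AEall dist1
  proof eventually_elim
    case (elim x)
    show ?case
    proof
      assume x: "x \<in> cube R"
      then have x\<Omega>: "x \<in> \<Omega>" using RQ Q\<Omega> by blast
      have o: "onorm ((*v) (D x)) ^ N \<le> K * det (D x)" using elim x x\<Omega> by simp
      have o0: "0 \<le> onorm ((*v) (D x))" by (rule onorm_pos_le[OF matrix_vector_mul_bounded_linear])
      have "norm (D x) ^ N \<le> ((real N)\<^sup>2 * onorm ((*v) (D x))) ^ N"
        unfolding N_def by (intro power_mono norm_matrix_le_onorm) auto
      also have "\<dots> = ((real N)\<^sup>2) ^ N * onorm ((*v) (D x)) ^ N" by (simp add: power_mult_distrib)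
      also have "\<dots> \<le> ((real N)\<^sup>2) ^ N * (K * det (D x))" using o by (intro mult_left_mono) auto
      finally have 1: "norm (D x) ^ N \<le> K' * det (D x)" by (simp add: K'_def N_def mult_ac)
      have "0 \<le> K * det (D x)" using o o0 by (meson order_trans zero_le_power)
      then have 2: "0 \<le> det (D x)" using K1 by (simp add: zero_le_mult_iff)
      have "det (D x) = jacobian_det \<Omega> f x" using elim(1) x by (simp add: jacobian_det_def E1_def)
      with 1 2 show "norm (D x) ^ N \<le> K' * det (D x) \<and> 0 \<le> det (D x) \<and> det (D x) = jacobian_det \<Omega> f x" by simp
    qed
  qed
  have mG [measurable]: "G k \<in> borel_measurable borel" for k
    by (rule borel_measurable_continuous_onI[OF C1_map_cont_deriv[OF C1]])
  note [measurable] = mD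
  define M where "M = real (card (UNIV :: ('n \<times> 'n) set)) ^ N"
  have M: "0 \<le> M" by (simp add: M_def)
  have normN: "norm A ^ N \<le> M * (\<Sum>(i, j)\<in>UNIV. \<bar>A $ i $ j\<bar> ^ N)" for A :: "real ^ 'n ^ 'n"
  proof -
    have "norm A ^ N \<le> (\<Sum>(i, j)\<in>UNIV. \<bar>A $ i $ j\<bar>) ^ N" by (intro power_mono norm_matrix_le_sum) auto
    also have "\<dots> = (\<Sum>p\<in>UNIV. \<bar>A $ fst p $ snd p\<bar>) ^ N" by (simp add: case_prod_beta)
    also have "\<dots> \<le> M * (\<Sum>p\<in>UNIV. \<bar>A $ fst p $ snd p\<bar> ^ N)"
      unfolding M_def by (rule sum_power_le) (use N in auto)
    finally show ?thesis by (simp add: case_prod_beta)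
  qed
  define J where "J k p = (\<integral>\<^sup>+x. indicator (cube R) x * ennreal (\<bar>mollify (\<eta> k) (d2 (fst p) (snd p)) x - d2 (fst p) (snd p) x\<bar> ^ N) \<partial>lborel)" for k and p :: "'n \<times> 'n"
  have GD: "(\<lambda>k. \<integral>\<^sup>+x. indicator (cube R) x * ennreal (norm (G k x - D x) ^ N) \<partial>lborel) \<longlonglongrightarrow> 0"
  proof (rule tendsto_sandwich[of "\<lambda>_. 0" _ _ "\<lambda>k. ennreal M * (\<Sum>p\<in>UNIV. J k p)"])
    have "(\<integral>\<^sup>+x. indicator (cube R) x * ennreal (norm (G k x - D x) ^ N) \<partial>lborel) \<le> ennreal M * (\<Sum>p\<in>UNIV. J k p)" for k
    proof -
      have "(\<integral>\<^sup>+x. indicator (cube R) x * ennreal (norm (G k x - D x) ^ N) \<partial>lborel) \<le>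
        (\<integral>\<^sup>+x. ennreal M * (\<Sum>p\<in>UNIV. indicator (cube R) x * ennreal (\<bar>mollify (\<eta> k) (d2 (fst p) (snd p)) x - d2 (fst p) (snd p) x\<bar> ^ N)) \<partial>lborel)"
      proof (rule nn_integral_mono)
        fix x
        show "indicator (cube R) x * ennreal (norm (G k x - D x) ^ N) \<le> ennreal M * (\<Sum>p\<in>UNIV. indicator (cube R) x * ennreal (\<bar>mollify (\<eta> k) (d2 (fst p) (snd p)) x - d2 (fst p) (snd p) x\<bar> ^ N))"
        proof (cases "x \<in> cube R")
          case True
          have "norm (G k x - D x) ^ N \<le> M * (\<Sum>p\<in>UNIV. \<bar>mollify (\<eta> k) (d2 (fst p) (snd p)) x - d2 (fst p) (snd p) x\<bar> ^ N)"
            using normN[of "G k x - D x"] d2(4)[OF True, of k] by (simp add: D_def case_prod_beta)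
          from ennreal_leI[OF this] True M show ?thesis by (simp add: ennreal_mult sum_nonneg sum_ennreal)
        qed simp
      qed
      also have "\<dots> = ennreal M * (\<Sum>p\<in>UNIV. J k p)"
        unfolding J_def by (subst nn_integral_cmult, measurable, subst nn_integral_sum, measurable)
      finally show ?thesis .
    qed
    then show "\<forall>\<^sub>F k in sequentially. (\<integral>\<^sup>+x. indicator (cube R) x * ennreal (norm (G k x - D x) ^ N) \<partial>lborel) \<le> ennreal M * (\<Sum>p\<in>UNIV. J k p)" by simp
    have "(\<lambda>k. \<Sum>p\<in>UNIV. J k p) \<longlonglongrightarrow> (\<Sum>p\<in>(UNIV :: ('n \<times> 'n) set). 0)"
      unfolding J_def by (intro tendsto_sum convN)
    then have "(\<lambda>k. ennreal M * (\<Sum>p\<in>UNIV. J k p)) \<longlonglongrightarrow> ennreal M * 0"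
      by (intro ennreal_tendsto_cmult) auto
    then show "(\<lambda>k. ennreal M * (\<Sum>p\<in>UNIV. J k p)) \<longlonglongrightarrow> 0" by simp
  qed auto
  have finD: "(\<integral>\<^sup>+x. indicator (cube R) x * ennreal (norm (D x) ^ N) \<partial>lborel) < \<infinity>"
  proof -
    have "(\<integral>\<^sup>+x. indicator (cube R) x * ennreal (norm (D x) ^ N) \<partial>lborel) \<le> (\<integral>\<^sup>+x. ennreal M * (\<Sum>p\<in>UNIV. ennreal (\<bar>d2 (fst p) (snd p) x\<bar> ^ N)) \<partial>lborel)"
    proof (rule nn_integral_mono)
      fix x
      have "ennreal (norm (D x) ^ N) \<le> ennreal (M * (\<Sum>p\<in>UNIV. \<bar>d2 (fst p) (snd p) x\<bar> ^ N))"
        using normN[of "D x"] by (intro ennreal_leI) (simp add: D_def case_prod_beta)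
      also have "\<dots> = ennreal M * (\<Sum>p\<in>UNIV. ennreal (\<bar>d2 (fst p) (snd p) x\<bar> ^ N))"
        using M by (simp add: ennreal_mult sum_nonneg sum_ennreal)
      finally show "indicator (cube R) x * ennreal (norm (D x) ^ N) \<le> ennreal M * (\<Sum>p\<in>UNIV. ennreal (\<bar>d2 (fst p) (snd p) x\<bar> ^ N))"
        by (auto simp: indicator_def)
    qed
    also have "\<dots> = ennreal M * (\<Sum>p\<in>UNIV. (\<integral>\<^sup>+x. ennreal (\<bar>d2 (fst p) (snd p) x\<bar> ^ N) \<partial>lborel))"
      by (subst nn_integral_cmult, measurable, subst nn_integral_sum, measurable)
    also have "\<dots> < \<infinity>"
      using locally_Lp_component_finite[OF E2(2) Q\<Omega> d2(2) d2(3) N(2)] by (simp add: ennreal_mult_less_top)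
    finally show ?thesis .
  qed
  have dn: "\<exists>C\<ge>0. \<forall>a b :: real ^ 'n ^ 'n. \<bar>norm a ^ N - norm b ^ N\<bar> \<le> \<epsilon> * norm b ^ N + C * norm (a - b) ^ N"
    and dd: "\<exists>C\<ge>0. \<forall>a b :: real ^ 'n ^ 'n. \<bar>det a - det b\<bar> \<le> \<epsilon> * norm b ^ N + C * norm (a - b) ^ N" if "0 < \<epsilon>" for \<epsilon>
    using det_norm_power_diff[OF that, where 'n='n] unfolding N_def by meson+
  have convdet: "(\<lambda>k. \<integral>\<^sup>+x. indicator (cube R) x * ennreal \<bar>det (G k x) - det (D x)\<bar> \<partial>lborel) \<longlonglongrightarrow> 0"
    by (rule tendsto_nn_integral_of_power[OF _ mD GD finD]) (use mG dd in auto)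
  have convnorm: "(\<lambda>k. \<integral>\<^sup>+x. indicator (cube R) x * ennreal \<bar>norm (G k x) ^ N - norm (D x) ^ N\<bar> \<partial>lborel) \<longlonglongrightarrow> 0"
    by (rule tendsto_nn_integral_of_power[where \<Phi>="\<lambda>A. norm A ^ N", OF _ mD GD finD]) (use mG dn in auto)
  have [measurable]: "det \<in> borel_measurable (borel :: (real ^ 'n ^ 'n) measure)"
    by (intro borel_measurable_continuous_onI continuous_on_det continuous_on_id)
  have ce: "continuous_on UNIV (\<lambda>x. max 0 (norm (G k x) ^ N - K' * det (G k x)))" for k
    by (intro continuous_intros C1_map_cont_deriv[OF C1])
  have "(\<lambda>k. ennreal (integral (cube R) (\<lambda>x. max 0 (norm (G k x) ^ N - K' * det (G k x))))) \<longlonglongrightarrow> 0"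
  proof (rule tendsto_sandwich[of "\<lambda>_. 0" _ _ "\<lambda>k. (\<integral>\<^sup>+x. indicator (cube R) x * ennreal \<bar>norm (G k x) ^ N - norm (D x) ^ N\<bar> \<partial>lborel) + ennreal K' * (\<integral>\<^sup>+x. indicator (cube R) x * ennreal \<bar>det (G k x) - det (D x)\<bar> \<partial>lborel)"])
    have "ennreal (integral (cube R) (\<lambda>x. max 0 (norm (G k x) ^ N - K' * det (G k x)))) \<le>
      (\<integral>\<^sup>+x. indicator (cube R) x * ennreal \<bar>norm (G k x) ^ N - norm (D x) ^ N\<bar> \<partial>lborel) + ennreal K' * (\<integral>\<^sup>+x. indicator (cube R) x * ennreal \<bar>det (G k x) - det (D x)\<bar> \<partial>lborel)" for k
    proof -
      have "ennreal (integral (cube R) (\<lambda>x. max 0 (norm (G k x) ^ N - K' * det (G k x)))) = (\<integral>\<^sup>+x. indicator (cube R) x * ennreal (max 0 (norm (G k x) ^ N - K' * det (G k x))) \<partial>lborel)"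
        by (rule nn_integral_cube_eq[symmetric, OF ce]) simp
      also have "\<dots> \<le> (\<integral>\<^sup>+x. indicator (cube R) x * ennreal \<bar>norm (G k x) ^ N - norm (D x) ^ N\<bar> + ennreal K' * (indicator (cube R) x * ennreal \<bar>det (G k x) - det (D x)\<bar>) \<partial>lborel)"
      proof (rule nn_integral_mono_AE)
        show "AE x in lborel. indicator (cube R) x * ennreal (max 0 (norm (G k x) ^ N - K' * det (G k x))) \<le>
          indicator (cube R) x * ennreal \<bar>norm (G k x) ^ N - norm (D x) ^ N\<bar> + ennreal K' * (indicator (cube R) x * ennreal \<bar>det (G k x) - det (D x)\<bar>)"
          using distD
        proof eventually_elim
          case (elim x)
          show ?case
          proof (cases "x \<in> cube R")
            case True
            have k: "K' * \<bar>det (G k x) - det (D x)\<bar> = \<bar>K' * det (G k x) - K' * det (D x)\<bar>"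
              using K' by (simp add: abs_mult flip: right_diff_distrib)
            \<comment> \<open>For the limit D the quantity |D|^n - K' det D is nonpositive, so its
              positive part at \<open>G k x\<close> is at most the change between the two
              matrices.\<close>
            have "max 0 (norm (G k x) ^ N - K' * det (G k x)) \<le> \<bar>norm (G k x) ^ N - norm (D x) ^ N\<bar> + K' * \<bar>det (G k x) - det (D x)\<bar>"
              unfolding k using elim True by (intro max.boundedI) (simp, linarith)
            then have "ennreal (max 0 (norm (G k x) ^ N - K' * det (G k x))) \<le> ennreal (\<bar>norm (G k x) ^ N - norm (D x) ^ N\<bar> + K' * \<bar>det (G k x) - det (D x)\<bar>)"
              by (rule ennreal_leI)
            also have "\<dots> = ennreal \<bar>norm (G k x) ^ N - norm (D x) ^ N\<bar> + ennreal K' * ennreal \<bar>det (G k x) - det (D x)\<bar>"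
              using K' by (simp add: ennreal_plus ennreal_mult)
            finally show ?thesis using True by simp
          qed simp
        qed
      qed
      also have "\<dots> = (\<integral>\<^sup>+x. indicator (cube R) x * ennreal \<bar>norm (G k x) ^ N - norm (D x) ^ N\<bar> \<partial>lborel) + ennreal K' * (\<integral>\<^sup>+x. indicator (cube R) x * ennreal \<bar>det (G k x) - det (D x)\<bar> \<partial>lborel)"
        by (simp add: nn_integral_add nn_integral_cmult)
      finally show ?thesis .
    qed
    then show "\<forall>\<^sub>F k in sequentially. ennreal (integral (cube R) (\<lambda>x. max 0 (norm (G k x) ^ N - K' * det (G k x)))) \<le>
      (\<integral>\<^sup>+x. indicator (cube R) x * ennreal \<bar>norm (G k x) ^ N - norm (D x) ^ N\<bar> \<partial>lborel) + ennreal K' * (\<integral>\<^sup>+x. indicator (cube R) x * ennreal \<bar>det (G k x) - det (D x)\<bar> \<partial>lborel)" by simp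
    have "(\<lambda>k. (\<integral>\<^sup>+x. indicator (cube R) x * ennreal \<bar>norm (G k x) ^ N - norm (D x) ^ N\<bar> \<partial>lborel) + ennreal K' * (\<integral>\<^sup>+x. indicator (cube R) x * ennreal \<bar>det (G k x) - det (D x)\<bar> \<partial>lborel)) \<longlonglongrightarrow> 0 + ennreal K' * 0"
      by (intro tendsto_add convnorm ennreal_tendsto_cmult convdet) auto
    then show "(\<lambda>k. (\<integral>\<^sup>+x. indicator (cube R) x * ennreal \<bar>norm (G k x) ^ N - norm (D x) ^ N\<bar> \<partial>lborel) + ennreal K' * (\<integral>\<^sup>+x. indicator (cube R) x * ennreal \<bar>det (G k x) - det (D x)\<bar> \<partial>lborel)) \<longlonglongrightarrow> 0" by simp
  qed auto
  then have err: "(\<lambda>k. integral (cube R) (\<lambda>x. max 0 (norm (G k x) ^ N - K' * det (G k x)))) \<longlonglongrightarrow> 0"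
    by (subst (asm) ennreal_tendsto_0_iff) (auto intro!: integral_nonneg integrable_cube continuous_on_subset[OF ce])
  have lim: "uniform_limit (cube R) g f sequentially"
    unfolding uniform_limit_iff
  proof (intro allI impI)
    fix \<epsilon> :: real assume "0 < \<epsilon>"
    define \<delta> where "\<delta> = \<epsilon> / (2 * real N)"
    have \<delta>: "0 < \<delta>" using \<open>0 < \<epsilon>\<close> N by (simp add: \<delta>_def)
    have "uniformly_continuous_on (cube (2 * R)) f" by (rule compact_uniformly_continuous[OF cf]) auto
    then obtain \<rho> where \<rho>: "0 < \<rho>" "\<And>x y. x \<in> cube (2 * R) \<Longrightarrow> y \<in> cube (2 * R) \<Longrightarrow> dist y x < \<rho> \<Longrightarrow> dist (f y) (f x) < \<delta>"
      unfolding uniformly_continuous_on_def using \<delta> by metis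
    have "\<forall>\<^sub>F k in sequentially. r k < \<rho>" using r0 \<rho>(1) by (rule order_tendstoD(2))
    then show "\<forall>\<^sub>F k in sequentially. \<forall>x\<in>cube R. dist (g k x) (f x) < \<epsilon>"
    proof eventually_elim
      case (elim k)
      show ?case
      proof
        fix x :: "real ^ 'n" assume x: "x \<in> cube R"
        have "\<bar>(g k x - f x) $ i\<bar> \<le> \<delta>" for i
        proof -
          have "g k x $ i = mollify (\<eta> k) (\<lambda>y. indicator (cube (2 * R)) y * f y $ i) x"
          proof -
            have "set_integrable lborel (cube (2 * R)) (\<lambda>y. f y $ i * \<eta> k (x - y))"
              unfolding set_integrable_def
              by (rule borel_integrable_compact)
                (auto intro!: continuous_intros cf continuous_on_compose2[OF has_grad_cont[OF gr, of UNIV]])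
            from set_borel_integral_eq_integral(2)[OF this] show ?thesis
              by (simp add: g_def mollify_def set_lebesgue_integral_def mult_ac)
          qed
          also have "\<bar>\<dots> - f x $ i\<bar> \<le> \<delta>"
          proof (rule mollify_near[OF ker cfi])
            fix y assume y: "norm (x - y) < r k"
            have yQ: "y \<in> cube (2 * R)"
              unfolding mem_cube
            proof
              fix i
              have "\<bar>x $ i\<bar> \<le> R" using x by (auto simp: mem_cube)
              moreover have "\<bar>(x - y) $ i\<bar> \<le> R" using component_le_norm_cart[of "x - y" i] y r(2)[of k] by linarith
              ultimately show "\<bar>y $ i\<bar> \<le> 2 * R" by simp
            qed
            have "dist (f y) (f x) < \<delta>" using yQ x RQ y elim by (intro \<rho>) (auto simp: dist_norm norm_minus_commute)
            then show "\<bar>f y $ i - f x $ i\<bar> \<le> \<delta> \<and> y \<in> cube (2 * R)"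
              using yQ component_le_norm_cart[of "f y - f x" i] by (simp add: dist_norm)
          qed auto
          finally show ?thesis by simp
        qed
        then have "(\<Sum>i\<in>UNIV. \<bar>(g k x - f x) $ i\<bar>) \<le> real (card (UNIV :: 'n set)) * \<delta>"
          by (intro sum_bounded_above) auto
        also have "\<dots> = \<epsilon> / 2" using N by (simp add: \<delta>_def N_def[symmetric])
        finally have "norm (g k x - f x) \<le> \<epsilon> / 2" using norm_le_l1_cart[of "g k x - f x"] by linarith
        then show "dist (g k x) (f x) < \<epsilon>" using \<open>0 < \<epsilon>\<close> by (simp add: dist_norm)
      qed
    qed
  qed
  have "qr_approx g G f K' R"
    by unfold_locales (use n C1 lim R K' err in \<open>auto simp: N_def\<close>)
  moreover have "AE x in lborel. x \<in> cube R \<longrightarrow> det (D x) = jacobian_det (ball 0 1) f x \<and> 0 \<le> det (D x)"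
    using distD unfolding \<Omega>_def by eventually_elim auto
  ultimately show ?thesis using mD convdet by blast
qed

section \<open>Rescaling of the values and conclusion\<close>

lemma det_scaleR: "det (a *\<^sub>R A) = a ^ CARD('n) * det (A :: real ^ 'n::finite ^ 'n)"
  unfolding det_def by (simp add: prod.distrib sum_distrib_left mult_ac)

text \<open>The norm to the power n and the determinant are both homogeneous of degree n, so the
  distortion error is only multiplied by a ^ n and K is unchanged. This reduces every M > 0 to M =
  5.\<close>

lemma (in qr_approx) scaled:
  assumes a: "0 < a"
  shows "qr_approx (\<lambda>k x. a *\<^sub>R g k x) (\<lambda>k x. a *\<^sub>R G k x) (\<lambda>x. a *\<^sub>R f x) K R"
proof
  show "uniform_limit (cube R) (\<lambda>k x. a *\<^sub>R g k x) (\<lambda>x. a *\<^sub>R f x) sequentially"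
    unfolding uniform_limit_iff
  proof (intro allI impI)
    fix \<epsilon> :: real assume "0 < \<epsilon>"
    then have "\<forall>\<^sub>F k in sequentially. \<forall>x\<in>cube R. dist (g k x) (f x) < \<epsilon> / a"
      using lim a unfolding uniform_limit_iff by simp
    then show "\<forall>\<^sub>F k in sequentially. \<forall>x\<in>cube R. dist (a *\<^sub>R g k x) (a *\<^sub>R f x) < \<epsilon>"
      by eventually_elim (use a in \<open>auto simp: dist_norm pos_less_divide_eq mult.commute simp flip: scaleR_right_diff_distrib\<close>)
  qed
  have "max 0 (norm (a *\<^sub>R G k x) ^ CARD('n) - K * det (a *\<^sub>R G k x)) = a ^ CARD('n) * max 0 (norm (G k x) ^ CARD('n) - K * det (G k x))" for k x
  proof -
    have "norm (a *\<^sub>R G k x) ^ CARD('n) - K * det (a *\<^sub>R G k x) = a ^ CARD('n) * (norm (G k x) ^ CARD('n) - K * det (G k x))"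
      using a by (simp add: det_scaleR power_mult_distrib algebra_simps)
    then show ?thesis using a by (simp add: max_mult_distrib_left)
  qed
  then show "(\<lambda>k. integral (cube R) (\<lambda>x. max 0 (norm (a *\<^sub>R G k x) ^ CARD('n) - K * det (a *\<^sub>R G k x)))) \<longlonglongrightarrow> 0"
    using tendsto_mult_left[OF err, of "a ^ CARD('n)"] by simp
qed (use n2 R K C1_map_scaleR[OF g] in auto)

theorem corollary1p7:
  fixes K :: real
  assumes "CARD('n::finite) \<ge> 2" and "K \<ge> 1"
  shows "\<exists>r\<^sub>0::real. 0 < r\<^sub>0 \<and> r\<^sub>0 < 1 \<and>
    (\<forall>f :: real ^ 'n \<Rightarrow> real ^ 'n. \<forall>M::real.
       quasiregular K (ball 0 1) f \<and> f 0 = 0 \<and>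
       0 \<le> M \<and> M < (SUP x\<in>cball 0 r\<^sub>0. norm (f x)) \<longrightarrow>
       (\<integral>\<^sup>+x\<in>{x \<in> ball 0 1. norm (f x) < M}. ennreal (jacobian_det (ball 0 1) f x) \<partial>lebesgue)
         \<ge> ennreal (measure lebesgue (ball (0 :: real ^ 'n) 1) * M ^ CARD('n)))"
proof -
  define N where "N = CARD('n)"
  have N: "2 \<le> N" using assms(1) by (simp add: N_def)
  define R where "R = 1 / (4 * real N)"
  define K' where "K' = ((real N)\<^sup>2) ^ N * K"
  have R: "0 < R" "R < 1" using N by (auto simp: R_def divide_less_eq)
  have K': "1 \<le> K'"
  proof -
    have "(1::real) \<le> ((real N)\<^sup>2) ^ N" using N by (intro one_le_power) auto
    then have "1 * 1 \<le> ((real N)\<^sup>2) ^ N * K" using assms(2) by (intro mult_mono) auto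
    then show ?thesis by (simp add: K'_def)
  qed
  define \<alpha> where "\<alpha> = measure lebesgue (ball (0 :: real ^ 'n) 1)"
  obtain r where r: "0 < r" "r \<le> R" and small: "\<And>g G (f :: real ^ 'n \<Rightarrow> real ^ 'n) A x. qr_approx g G f K' R \<Longrightarrow> f 0 = 0 \<Longrightarrow>
    A < \<alpha> * 5 ^ N \<Longrightarrow> jacobian_below g G R 5 A \<Longrightarrow> x \<in> cube r \<Longrightarrow> norm (f x) \<le> 2"
    using uniform_smallness[OF assms(1) K' R(1)] unfolding \<alpha>_def N_def by blast
  show ?thesis
  proof (intro exI[of _ r] conjI allI impI)
    show "0 < r" "r < 1" using r R by auto
    fix f :: "real ^ 'n \<Rightarrow> real ^ 'n" and M :: real
    assume "quasiregular K (ball 0 1) f \<and> f 0 = 0 \<and> 0 \<le> M \<and> M < (SUP x\<in>cball 0 r. norm (f x))"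
    then have qr: "quasiregular K (ball 0 1) f" and f0: "f 0 = 0" and M0: "0 \<le> M" and MS: "M < (SUP x\<in>cball 0 r. norm (f x))" by auto
    define I where "I = (\<integral>\<^sup>+x\<in>{x \<in> ball 0 1. norm (f x) < M}. ennreal (jacobian_det (ball 0 1) f x) \<partial>lebesgue)"
    have "ennreal (\<alpha> * M ^ N) \<le> I"
    proof (rule ccontr)
      assume neg: "\<not> ?thesis"
      \<comment> \<open>For M = 0 the asserted lower bound is 0 since n > 0; positivity is what
        permits scaling by 5 / M.\<close>
      have M: "0 < M"
      proof (rule ccontr)
        assume "\<not> 0 < M"
        then have "M = 0" using M0 by simp
        then show False using neg N by (simp add: power_0_left)
      qed
      have IM: "I < ennreal (\<alpha> * M ^ N)" using neg by simp
      obtain J where J: "I = ennreal J" "0 \<le> J" using IM by (cases I) auto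
      have JM: "J < \<alpha> * M ^ N" using IM J by (simp add: ennreal_less_iff)
      obtain g G and D :: "real ^ 'n \<Rightarrow> real ^ 'n ^ 'n" where D: "D \<in> borel_measurable borel" and qa: "qr_approx g G f K' R"
        and conv: "(\<lambda>k. \<integral>\<^sup>+x. indicator (cube R) x * ennreal \<bar>det (G k x) - det (D x)\<bar> \<partial>lborel) \<longlonglongrightarrow> 0"
        and AED: "AE x in lborel. x \<in> cube R \<longrightarrow> det (D x) = jacobian_det (ball 0 1) f x \<and> 0 \<le> det (D x)"
        using quasiregular_approx[OF assms(1) qr] unfolding R_def K'_def N_def by blast
      interpret qr_approx g G f K' R by (rule qa)
      define a where "a = 5 / M"
      have a: "0 < a" using M by (simp add: a_def)
      \<comment> \<open>The scaled midpoint between the actual integral J and the value \<alpha> M ^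
        n: still strictly below the critical value, but with a margin \<delta> above J for replacing
        the Jacobian of f by that of g_k.\<close>
      define A where "A = a ^ N * ((J + \<alpha> * M ^ N) / 2)"
      have aM: "a ^ N * (\<alpha> * M ^ N) = \<alpha> * 5 ^ N" using M by (simp add: a_def power_divide)
      have A5: "A < \<alpha> * 5 ^ N"
        unfolding A_def aM[symmetric] using JM a by (intro mult_strict_left_mono) auto
      have below: "jacobian_below (\<lambda>k x. a *\<^sub>R g k x) (\<lambda>k x. a *\<^sub>R G k x) R 5 A"
        unfolding jacobian_below_def
      proof (intro allI impI)
        fix p :: "real ^ 'n \<Rightarrow> real" and m :: real
        assume p: "continuous_on UNIV p" "\<forall>y. 0 \<le> p y \<and> p y \<le> 1" "m < 5" "\<forall>y. m \<le> norm y \<longrightarrow> p y = 0"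
        define \<delta> where "\<delta> = (\<alpha> * M ^ N - J) / 2"
        have \<delta>: "0 < \<delta>" using JM by (simp add: \<delta>_def)
        have ev1: "\<forall>\<^sub>F k in sequentially. (\<integral>\<^sup>+x. indicator (cube R) x * ennreal \<bar>det (G k x) - det (D x)\<bar> \<partial>lborel) < ennreal \<delta>"
          using conv \<delta> by (intro order_tendstoD(2)) auto
        \<comment> \<open>The margin is chosen so that |a g_k x| < m forces |a f x| < 5, that is |f
          x| < M: the cutoff p only sees points of the set over which the Jacobian integral is
          taken.\<close>
        have ev2: "\<forall>\<^sub>F k in sequentially. \<forall>x\<in>cube R. dist (g k x) (f x) < (5 - m) / a"
          using lim[unfolded uniform_limit_iff, rule_format, of "(5 - m) / a"] p(3) a by simp
        show "\<forall>\<^sub>F k in sequentially. integral (cube R) (\<lambda>x. p (a *\<^sub>R g k x) * \<bar>det (a *\<^sub>R G k x)\<bar>) \<le> A"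
          using ev1 ev2
        proof eventually_elim
          case (elim k)
          have ch: "continuous_on S (\<lambda>x. p (a *\<^sub>R g k x) * \<bar>det (G k x)\<bar>)" for S
            by (intro continuous_intros continuous_on_compose2[OF p(1)] cg cG) auto
          have [measurable]: "D \<in> borel_measurable borel" "G k \<in> borel_measurable borel" "cube R \<in> sets (borel :: (real ^ 'n) measure)"
            "det \<in> borel_measurable (borel :: (real ^ 'n ^ 'n) measure)"
            using D by (auto simp: borel_closed intro!: borel_measurable_continuous_onI cG continuous_on_det continuous_on_id)
          define F where "F = {x \<in> ball 0 1. norm (f x) < M}"
          have "continuous_on (ball 0 1) (\<lambda>x. norm (f x))"
            using qr by (auto simp: quasiregular_def intro!: continuous_intros)
          then have "open (ball 0 1 \<inter> (\<lambda>x. norm (f x)) -` {..<M})"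
            by (rule continuous_open_preimage) auto
          moreover have "ball 0 1 \<inter> (\<lambda>x. norm (f x)) -` {..<M} = F" by (auto simp: F_def)
          ultimately have [measurable]: "F \<in> sets borel" by auto
          have "ennreal (integral (cube R) (\<lambda>x. p (a *\<^sub>R g k x) * \<bar>det (G k x)\<bar>)) = (\<integral>\<^sup>+x. indicator (cube R) x * ennreal (p (a *\<^sub>R g k x) * \<bar>det (G k x)\<bar>) \<partial>lborel)"
            by (rule nn_integral_cube_eq[symmetric, OF ch]) (use p(2) in auto)
          also have "\<dots> \<le> (\<integral>\<^sup>+x. indicator (cube R) x * ennreal \<bar>det (G k x) - det (D x)\<bar> + ennreal (det (D x)) * indicator (cube R \<inter> F) x \<partial>lborel)"
          proof (rule nn_integral_mono_AE)
            show "AE x in lborel. indicator (cube R) x * ennreal (p (a *\<^sub>R g k x) * \<bar>det (G k x)\<bar>) \<le>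
              indicator (cube R) x * ennreal \<bar>det (G k x) - det (D x)\<bar> + ennreal (det (D x)) * indicator (cube R \<inter> F) x"
              using AED
            proof eventually_elim
              case (elim x)
              note el = elim
              show ?case
              proof (cases "x \<in> cube R \<and> p (a *\<^sub>R g k x) \<noteq> 0")
                case True
                then have x: "x \<in> cube R" and "\<not> m \<le> norm (a *\<^sub>R g k x)" using p(4) by auto
                then have "a * norm (g k x) < m" using a by simp
                moreover have "norm (g k x - f x) < (5 - m) / a"
                  using \<open>\<forall>x\<in>cube R. dist (g k x) (f x) < (5 - m) / a\<close> x by (simp add: dist_norm)
                then have "a * norm (g k x - f x) < 5 - m" using a by (simp add: field_simps)
                moreover have "a * norm (f x) \<le> a * (norm (g k x) + norm (g k x - f x))"
                  using norm_triangle_sub[of "f x" "g k x"] a by (intro mult_left_mono) (auto simp: norm_minus_commute)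
                ultimately have "a * norm (f x) < 5" by (simp add: distrib_left)
                then have "norm (f x) < M" using M by (simp add: a_def field_simps)
                moreover have "norm x < 1"
                proof -
                  have "norm x \<le> real N * R" using norm_cube[OF x] by (simp add: N_def)
                  also have "\<dots> < 1" using N by (simp add: R_def)
                  finally show ?thesis .
                qed
                ultimately have xF: "x \<in> F" by (simp add: F_def)
                have det: "det (D x) = jacobian_det (ball 0 1) f x" "0 \<le> det (D x)" using el x by auto
                have "p (a *\<^sub>R g k x) * \<bar>det (G k x)\<bar> \<le> \<bar>det (G k x)\<bar>" using p(2) by (simp add: mult_left_le_one_le)
                also have "\<dots> \<le> \<bar>det (G k x) - det (D x)\<bar> + det (D x)" using det(2) by linarith
                finally have "ennreal (p (a *\<^sub>R g k x) * \<bar>det (G k x)\<bar>) \<le> ennreal (\<bar>det (G k x) - det (D x)\<bar> + det (D x))" by (rule ennreal_leI)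
                also have "\<dots> = ennreal \<bar>det (G k x) - det (D x)\<bar> + ennreal (det (D x))" using det(2) by (simp add: ennreal_plus)
                finally show ?thesis using x xF by simp
              qed auto
            qed
          qed
          also have "\<dots> = (\<integral>\<^sup>+x. indicator (cube R) x * ennreal \<bar>det (G k x) - det (D x)\<bar> \<partial>lborel) + (\<integral>\<^sup>+x. ennreal (det (D x)) * indicator (cube R \<inter> F) x \<partial>lborel)"
            by (rule nn_integral_add) measurable
          also have "\<dots> \<le> ennreal \<delta> + ennreal J"
          proof (rule add_mono)
            have "(\<integral>\<^sup>+x. ennreal (det (D x)) * indicator (cube R \<inter> F) x \<partial>lborel) \<le> (\<integral>\<^sup>+x. ennreal (jacobian_det (ball 0 1) f x) * indicator F x \<partial>lborel)"
              by (rule nn_integral_mono_AE, use AED in eventually_elim) (auto simp: indicator_def)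
            also have "\<dots> = ennreal J" using J(1) by (simp add: nn_integral_completion I_def F_def)
            finally show "(\<integral>\<^sup>+x. ennreal (det (D x)) * indicator (cube R \<inter> F) x \<partial>lborel) \<le> ennreal J" .
          qed (use elim(1) in simp)
          also have "\<dots> = ennreal (\<delta> + J)" using \<delta> J by simp
          finally have "integral (cube R) (\<lambda>x. p (a *\<^sub>R g k x) * \<bar>det (G k x)\<bar>) \<le> \<delta> + J"
            using \<delta> J by (subst (asm) ennreal_le_iff) auto
          then have "a ^ N * integral (cube R) (\<lambda>x. p (a *\<^sub>R g k x) * \<bar>det (G k x)\<bar>) \<le> a ^ N * (\<delta> + J)"
            using a by (intro mult_left_mono) auto
          moreover have "\<delta> + J = (J + \<alpha> * M ^ N) / 2" by (simp add: \<delta>_def field_simps)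
          moreover have "p (a *\<^sub>R g k x) * \<bar>det (a *\<^sub>R G k x)\<bar> = a ^ N * (p (a *\<^sub>R g k x) * \<bar>det (G k x)\<bar>)" for x
            using a by (simp add: det_scaleR abs_mult N_def)
          ultimately show ?case by (simp only: A_def) simp
        qed
      qed
      have bound: "norm (f x) \<le> 2 * M / 5" if "x \<in> cball 0 r" for x
      proof -
        have "norm (a *\<^sub>R f x) \<le> 2"
          using small[OF scaled[OF a] _ A5 below] f0 that ball_subset_cube[of r] by auto
        then show ?thesis using M by (simp add: a_def field_simps)
      qed
      have "(SUP x\<in>cball 0 r. norm (f x)) \<le> 2 * M / 5"
        using r bound by (intro cSUP_least) auto
      then show False using MS M by simp
    qed
    then show "(\<integral>\<^sup>+x\<in>{x \<in> ball 0 1. norm (f x) < M}. ennreal (jacobian_det (ball 0 1) f x) \<partial>lebesgue)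
         \<ge> ennreal (measure lebesgue (ball (0 :: real ^ 'n) 1) * M ^ CARD('n))"
      by (simp add: I_def \<alpha>_def N_def)
  qed
qed

end
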